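(* Let $\Gamma=\mathrm{SL}_2(\mathbf{Z})$ and let $\rho\colon\Gamma\to\mathrm{GL}_4(\mathbf{C})$ be an irreducible representation. Write $\rho(-I)=(-1)^e$ with $e\in\{0,1\}$. Let $L$ be a choice of exponents for $\rho$, and let $k_1\le k_2\le k_3\le k_4$ be the weights of a homogeneous free basis of $M(\rho,L)$ over $M(1)=\mathbf{C}[E_4,E_6]$. Then exactly one of the following holds: (1) (cyclic case) if $3\operatorname{Tr}(L)\not\equiv e\pmod 2$, then $k_1=3\operatorname{Tr}(L)-3$ and $(k_1,k_2,k_3,k_4)=(k_1,k_1+2,k_1+4,k_1+6)$; (2) (noncyclic case) if $3\operatorname{Tr}(L)\equiv e\pmod 2$, then $k_1=3\operatorname{Tr}(L)-2$ and $(k_1,k_2,k_3,k_4)=(k_1,k_1+2,k_1+2,k_1+4)$.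
   Context: $T=\begin{pmatrix}1&1\\0&1\end{pmatrix}$. For a representation $\rho\colon\Gamma\to\mathrm{GL}_d(\mathbf{C})$, a choice of exponents is a matrix $L\in M_d(\mathbf{C})$ with $\rho(T)=e^{2\pi i L}$. For $k\in\mathbf{Z}$, $M_k(\rho,L)$ is the space of holomorphic $F\colon\mathfrak{H}\to\mathbf{C}^d$ with $F(\gamma\tau)=(c\tau+d)^k\rho(\gamma)F(\tau)$ for all $\gamma=\begin{pmatrix}a&b\\c&d\end{pmatrix}\in\Gamma$ and such that $e^{-2\pi i L\tau}F(\tau)$ has a $q$-expansion in nonnegative powers of $q=e^{2\pi i\tau}$; $M(\rho,L)=\bigoplus_k M_k(\rho,L)$ is a graded module over the ring $M(1)=\mathbf{C}[E_4,E_6]$ of level one modular forms. It is known that $M(\rho,L)$ is a free $M(1)$-module of rank $d$, and the multiset of weights of a homogeneous free basis is uniquely determined. For irreducible $\rho$ of rank 4 one has $(\det\rho(T))^3=1$, so $3\operatorname{Tr}(L)\in\mathbf{Z}$; also $\rho(-I)=\pm I$. *)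

theory Defs
  imports
    "HOL-Complex_Analysis.Complex_Analysis"
    "HOL-Number_Theory.Cong"
begin

section \<open>The modular group and its representations\<close>

definition upper_half_plane :: "complex set" where
  "upper_half_plane = {\<tau>. Im \<tau> > 0}"

definition SL2Z :: "(int^2^2) set" where
  "SL2Z = {\<gamma>. det \<gamma> = 1}"

definition T_mat :: "int^2^2" where
  "T_mat = vector [vector [1, 1], vector [0, 1]]"

definition automorphy_factor :: "int^2^2 \<Rightarrow> complex \<Rightarrow> complex" where
  "automorphy_factor \<gamma> \<tau> = of_int (\<gamma> $ 2 $ 1) * \<tau> + of_int (\<gamma> $ 2 $ 2)"

definition moebius :: "int^2^2 \<Rightarrow> complex \<Rightarrow> complex" where
  "moebius \<gamma> \<tau> = (of_int (\<gamma> $ 1 $ 1) * \<tau> + of_int (\<gamma> $ 1 $ 2)) / automorphy_factor \<gamma> \<tau>"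

text \<open>Only the values of \<open>\<rho>\<close> on \<^const>\<open>SL2Z\<close> matter; \<open>\<rho>(1) = 1\<close> follows from the two conditions.\<close>

definition representation :: "(int^2^2 \<Rightarrow> complex^'n^'n) \<Rightarrow> bool" where
  "representation \<rho> \<longleftrightarrow>
     (\<forall>\<gamma>\<in>SL2Z. invertible (\<rho> \<gamma>)) \<and>
     (\<forall>\<gamma>\<in>SL2Z. \<forall>\<delta>\<in>SL2Z. \<rho> (\<gamma> ** \<delta>) = \<rho> \<gamma> ** \<rho> \<delta>)"

text \<open>\<open>vec.subspace\<close> is the notion of a complex-linear subspace, unlike \<^const>\<open>subspace\<close>, which is
  real-linear.  The space \<open>complex^'n\<close> is never zero, so it need not be excluded.\<close>

definition irreducible_representation :: "(int^2^2 \<Rightarrow> complex^'n^'n) \<Rightarrow> bool" where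
  "irreducible_representation \<rho> \<longleftrightarrow> representation \<rho> \<and>
     (\<forall>W. vec.subspace W \<and> (\<forall>\<gamma>\<in>SL2Z. \<forall>w\<in>W. \<rho> \<gamma> *v w \<in> W) \<longrightarrow> W = {0} \<or> W = UNIV)"

section \<open>Exponents\<close>

text \<open>The type \<open>complex^'n^'n\<close> is not an instance of the classes required by \<^const>\<open>exp\<close>, so the
  exponential series is written out.  A complex multiple \<open>c A\<close> of a matrix is \<open>mat c ** A\<close>.\<close>

definition mat_exp :: "complex^'n^'n \<Rightarrow> complex^'n^'n" where
  "mat_exp A = (\<Sum>m. (1 / fact m) *\<^sub>R (((**) A ^^ m) (mat 1)))"

definition choice_of_exponents ::
    "(int^2^2 \<Rightarrow> complex^'n^'n) \<Rightarrow> complex^'n^'n \<Rightarrow> bool" where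
  "choice_of_exponents \<rho> L \<longleftrightarrow> \<rho> T_mat = mat_exp (mat (2 * of_real pi * \<i>) ** L)"

section \<open>The ring of level one modular forms\<close>

definition eisenstein :: "nat \<Rightarrow> complex \<Rightarrow> complex" where
  "eisenstein k \<tau> =
     (1 / 2) * (\<Sum>\<^sub>\<infinity>(c, d)\<in>{(c :: int, d :: int). coprime c d}. 1 / (of_int c * \<tau> + of_int d) ^ k)"

text \<open>Here and below, functions are compared on the upper half-plane only; their values elsewhere
  are irrelevant.\<close>

definition level_one_ring :: "(complex \<Rightarrow> complex) set" where
  "level_one_ring = {f. \<exists>(N :: nat) (a :: nat \<Rightarrow> nat \<Rightarrow> complex). \<forall>\<tau>\<in>upper_half_plane.
     f \<tau> = (\<Sum>i\<le>N. \<Sum>j\<le>N. a i j * eisenstein 4 \<tau> ^ i * eisenstein 6 \<tau> ^ j)}"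

section \<open>Vector-valued modular forms\<close>

definition vvmf_weight ::
    "(int^2^2 \<Rightarrow> complex^'n^'n) \<Rightarrow> complex^'n^'n \<Rightarrow> int \<Rightarrow> (complex \<Rightarrow> complex^'n) set" where
  "vvmf_weight \<rho> L k = {F.
     (\<forall>i. (\<lambda>\<tau>. F \<tau> $ i) holomorphic_on upper_half_plane) \<and>
     (\<forall>\<gamma>\<in>SL2Z. \<forall>\<tau>\<in>upper_half_plane.
        F (moebius \<gamma> \<tau>) = (automorphy_factor \<gamma> \<tau> powi k) *s (\<rho> \<gamma> *v F \<tau>)) \<and>
     (\<exists>a :: nat \<Rightarrow> complex^'n. \<forall>\<tau>\<in>upper_half_plane.
        (\<lambda>m. (exp (2 * of_real pi * \<i> * \<tau>) ^ m) *s a m) sums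
          (mat_exp (mat (- (2 * of_real pi * \<i> * \<tau>)) ** L) *v F \<tau>))}"

text \<open>The direct sum over all weights, realised inside the functions on the upper half-plane.
  The sum of the weight spaces is direct there: if \<open>F\<^sub>k\<close> has weight \<open>k\<close> and \<open>\<Sum>\<^sub>k F\<^sub>k = 0\<close>, then
  \<open>\<Sum>\<^sub>k (c \<tau> + d)\<^sup>k F\<^sub>k(\<tau>) = 0\<close> for all coprime \<open>c\<close>, \<open>d\<close>, and
  \<open>c \<tau> + d\<close> takes infinitely many values.\<close>

definition vvmf :: "(int^2^2 \<Rightarrow> complex^'n^'n) \<Rightarrow> complex^'n^'n \<Rightarrow> (complex \<Rightarrow> complex^'n) set" where
  "vvmf \<rho> L = {G. \<exists>(K :: int set) g. finite K \<and> (\<forall>k\<in>K. g k \<in> vvmf_weight \<rho> L k) \<and>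
     (\<forall>\<tau>\<in>upper_half_plane. G \<tau> = (\<Sum>k\<in>K. g k \<tau>))}"

definition homogeneous_free_basis ::
    "(int^2^2 \<Rightarrow> complex^'n^'n) \<Rightarrow> complex^'n^'n \<Rightarrow> ('m::finite \<Rightarrow> int) \<Rightarrow>
      ('m \<Rightarrow> complex \<Rightarrow> complex^'n) \<Rightarrow> bool" where
  "homogeneous_free_basis \<rho> L k F \<longleftrightarrow>
     (\<forall>i. F i \<in> vvmf_weight \<rho> L (k i)) \<and>
     (\<forall>G\<in>vvmf \<rho> L. \<exists>f. (\<forall>i. f i \<in> level_one_ring) \<and>
        (\<forall>\<tau>\<in>upper_half_plane. G \<tau> = (\<Sum>i\<in>UNIV. f i \<tau> *s F i \<tau>))) \<and>
     (\<forall>f. (\<forall>i. f i \<in> level_one_ring) \<and>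
        (\<forall>\<tau>\<in>upper_half_plane. (\<Sum>i\<in>UNIV. f i \<tau> *s F i \<tau>) = 0) \<longrightarrow>
        (\<forall>i. \<forall>\<tau>\<in>upper_half_plane. f i \<tau> = 0))"

end

theory Submission imports Defs begin

text \<open>
  The Eisenstein series \<open>E\<^sub>4\<close>, \<open>E\<^sub>6\<close> give a cusp form \<open>\<Delta> = E\<^sub>4\<^sup>3 - E\<^sub>6\<^sup>2\<close> with a simple zero at the cusp
  and, as Rankin-Cohen brackets and a bound of Hecke show, no zero in the upper half-plane.  Hence
  \<open>D F = F' - (k / 12) (\<Delta>' / \<Delta>) F\<close> maps forms of weight \<open>k\<close> to forms of weight \<open>k + 2\<close>, and on a free basis
  it acts by a matrix of level one forms of weights \<open>k\<^sub>i + 2 - k\<^sub>j\<close>, whose diagonal is zero.  Comparing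
  constant terms, which are linearly independent because one can divide by \<open>\<Delta>\<close>, yields
  \<open>k\<^sub>1 + \<dots> + k\<^sub>4 = 12 Tr L\<close>.

  A nonzero family of at most three forms that is stable under \<open>D\<close> over the holomorphic functions would span
  a proper invariant subspace, since linear differential equations have unique solutions.  Irreducibility
  thus bounds the gaps \<open>k\<^sub>i\<^sub>+\<^sub>1 - k\<^sub>i\<close> by 2, and \<open>\<rho>(-I) = \<plusminus>I\<close> makes them even.  Of the eight patterns
  of gaps 0 and 2 all but \<open>(2, 0, 2)\<close> and \<open>(2, 2, 2)\<close> admit such a family.
\<close>

text \<open>No valence formula is at hand, so the zeros of \<open>disc\<close> are controlled
  through cusp forms of weight 12 and 16, the weights of the brackets [E6,E4]_1, [E4,E4]_2 and
  [E6,E6]_2. The Hecke bound reaches weight 16 because 16 / (8 pi) < sqrt 3 / 2.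

  A free basis only comes with coefficients in C[E4,E6] that may mix weights. Directness of the sum
  of the weight spaces makes them homogeneous; then each entry of the matrix of D is zero (weight
  negative or 2), constant (weight 0), a multiple of \<open>E4\<close> (weight 4), or of higher
  weight.

  The stubborn pattern of gaps is (0, 2, 0), where no subset of the basis need be stable under D.
  There D^2 acts on the two lowest generators as \<open>E4\<close> times a constant 2 x 2 matrix,
  and an eigenvector of that matrix provides the small stable family.

  The weights of the two surviving patterns sum to 4 k_1 + 8 and 4 k_1 + 12. Equating this with 12
  Tr L gives k_1 and the integrality of 3 Tr L; since k_1 has the parity of e, the parity of 3 Tr L
  decides between them.\<close>

no_notation fps_nth (infixl \<open>$\<close> 75)

section \<open>The modular group\<close>

abbreviation uhp :: "complex set" (\<open>\<H>\<close>) where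
  "\<H> \<equiv> upper_half_plane"

abbreviation mat2 :: "int \<Rightarrow> int \<Rightarrow> int \<Rightarrow> int \<Rightarrow> int^2^2" where
  "mat2 a b c d \<equiv> vector [vector [a, b], vector [c, d]]"

lemma uhp_iff: "\<tau> \<in> \<H> \<longleftrightarrow> 0 < Im \<tau>"
  by (simp add: upper_half_plane_def)

lemma open_uhp: "open \<H>"
  by (simp add: upper_half_plane_def open_halfspace_Im_gt)

lemma connected_uhp: "connected \<H>"
  by (simp add: upper_half_plane_def convex_connected convex_halfspace_Im_gt)

lemma SL2Z_iff: "\<gamma> \<in> SL2Z \<longleftrightarrow> \<gamma>$1$1 * \<gamma>$2$2 - \<gamma>$1$2 * \<gamma>$2$1 = 1"
  by (simp add: SL2Z_def det_2)

lemma lin_form_nonzero: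
  assumes "\<tau> \<in> \<H>" "(c, d) \<noteq> (0, 0)"
  shows "of_int c * \<tau> + of_int d \<noteq> (0 :: complex)"
proof
  assume eq: "of_int c * \<tau> + of_int d = 0"
  have "Im (of_int c * \<tau> + of_int d) = of_int c * Im \<tau>" by simp
  then have "c = 0" using eq assms by (auto simp: uhp_iff)
  with eq assms show False by simp
qed

lemma automorphy_nonzero:
  assumes "\<gamma> \<in> SL2Z" "\<tau> \<in> \<H>"
  shows "automorphy_factor \<gamma> \<tau> \<noteq> 0"
  unfolding automorphy_factor_def
  using assms by (intro lin_form_nonzero) (auto simp: SL2Z_iff)

lemma Im_moebius:
  assumes "\<gamma> \<in> SL2Z"
  shows "Im (moebius \<gamma> \<tau>) = Im \<tau> / (cmod (automorphy_factor \<gamma> \<tau>))\<^sup>2"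
proof -
  have "real_of_int (\<gamma>$1$1 * \<gamma>$2$2 - \<gamma>$1$2 * \<gamma>$2$1) = 1"
    using assms by (simp only: SL2Z_iff)
  then have *: "real_of_int (\<gamma>$1$1) * of_int (\<gamma>$2$2) - of_int (\<gamma>$1$2) * of_int (\<gamma>$2$1) = 1"
    by simp
  have "Im ((of_int (\<gamma> $ 1 $ 1) * \<tau> + of_int (\<gamma> $ 1 $ 2)) / automorphy_factor \<gamma> \<tau>)
     = ((real_of_int (\<gamma>$1$1) * of_int (\<gamma>$2$2) - of_int (\<gamma>$1$2) * of_int (\<gamma>$2$1)) * Im \<tau>)
        / (cmod (automorphy_factor \<gamma> \<tau>))\<^sup>2"
    unfolding Im_divide cmod_power2 automorphy_factor_def
    by (simp add: algebra_simps)
  then show ?thesis unfolding moebius_def * by simp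
qed

lemma moebius_uhp: "\<gamma> \<in> SL2Z \<Longrightarrow> \<tau> \<in> \<H> \<Longrightarrow> moebius \<gamma> \<tau> \<in> \<H>"
  using automorphy_nonzero[of \<gamma> \<tau>] by (simp add: Im_moebius uhp_iff)

lemma has_field_derivative_automorphy [derivative_intros]:
  "(automorphy_factor \<gamma> has_field_derivative of_int (\<gamma>$2$1)) (at \<tau>)"
  unfolding automorphy_factor_def by (auto intro!: derivative_eq_intros)

lemma has_field_derivative_moebius:
  assumes "\<gamma> \<in> SL2Z" "\<tau> \<in> \<H>"
  shows "(moebius \<gamma> has_field_derivative 1 / (automorphy_factor \<gamma> \<tau>)\<^sup>2) (at \<tau>)"
proof -
  let ?J = "automorphy_factor \<gamma>"
  have J: "?J \<tau> \<noteq> 0" by (rule automorphy_nonzero[OF assms])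
  have "of_int (\<gamma>$1$1 * \<gamma>$2$2 - \<gamma>$1$2 * \<gamma>$2$1) = (1 :: complex)"
    using assms by (simp only: SL2Z_iff of_int_1)
  then have det: "of_int (\<gamma>$1$1) * of_int (\<gamma>$2$2) - of_int (\<gamma>$1$2) * of_int (\<gamma>$2$1) = (1 :: complex)"
    by simp
  have "((\<lambda>\<tau>. (of_int (\<gamma>$1$1) * \<tau> + of_int (\<gamma>$1$2)) / ?J \<tau>) has_field_derivative
      (of_int (\<gamma>$1$1) * ?J \<tau> - (of_int (\<gamma>$1$1) * \<tau> + of_int (\<gamma>$1$2)) * of_int (\<gamma>$2$1)) / (?J \<tau> * ?J \<tau>)) (at \<tau>)"
    using J by (auto intro!: derivative_eq_intros)
  moreover have "of_int (\<gamma>$1$1) * ?J \<tau> - (of_int (\<gamma>$1$1) * \<tau> + of_int (\<gamma>$1$2)) * of_int (\<gamma>$2$1) = 1"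
    unfolding automorphy_factor_def using det by (simp add: algebra_simps)
  ultimately show ?thesis
    unfolding moebius_def[abs_def] by (simp add: power2_eq_square)
qed

section \<open>Reduction to the fundamental domain\<close>

lemma finite_small_lin_forms:
  assumes "\<tau> \<in> \<H>"
  shows "finite {(c :: int, d :: int). cmod (of_int c * \<tau> + of_int d) \<le> 1}"
proof -
  define N where "N = \<lceil>1 / Im \<tau>\<rceil>"
  define M where "M = \<lceil>1 + of_int N * cmod \<tau>\<rceil>"
  have y: "Im \<tau> > 0" using assms by (simp add: uhp_iff)
  have "{(c :: int, d :: int). cmod (of_int c * \<tau> + of_int d) \<le> 1} \<subseteq> {-N..N} \<times> {-M..M}"
  proof clarify
    fix c d :: int
    assume le: "cmod (of_int c * \<tau> + of_int d) \<le> 1"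
    have "\<bar>of_int c * Im \<tau>\<bar> \<le> cmod (of_int c * \<tau> + of_int d)"
      using abs_Im_le_cmod[of "of_int c * \<tau> + of_int d"] by simp
    with le y have "\<bar>real_of_int c\<bar> \<le> 1 / Im \<tau>"
      by (simp add: abs_mult field_simps)
    also have "\<dots> \<le> of_int N" unfolding N_def by simp
    finally have c: "\<bar>real_of_int c\<bar> \<le> of_int N" .
    have "cmod (of_int d) \<le> cmod (of_int c * \<tau> + of_int d) + cmod (of_int c * \<tau>)"
      by (metis add_diff_cancel_left' norm_triangle_ineq4)
    also have "\<dots> \<le> 1 + \<bar>of_int c\<bar> * cmod \<tau>"
      using le by (simp add: norm_mult)
    also have "\<dots> \<le> 1 + of_int N * cmod \<tau>"
      using c by (intro add_left_mono mult_right_mono) auto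
    also have "\<dots> \<le> of_int M" unfolding M_def by simp
    finally have "\<bar>real_of_int d\<bar> \<le> of_int M" by simp
    with c show "c \<in> {-N..N} \<and> d \<in> {-M..M}" by (simp add: abs_le_iff)
  qed
  then show ?thesis by (rule finite_subset) simp
qed

text \<open>The bottom row minimises |c tau + d|. The top row is a coprime pair too, so its linear
  form is at least as large in modulus; hence |gamma tau| >= 1, and together with |Re| <= 1/2 this
  leaves Im^2 >= 3/4.\<close>

lemma fundamental_domain:
  assumes "\<tau> \<in> \<H>"
  obtains \<gamma> where "\<gamma> \<in> SL2Z" "\<bar>Re (moebius \<gamma> \<tau>)\<bar> \<le> 1/2" "3/4 \<le> (Im (moebius \<gamma> \<tau>))\<^sup>2"
proof -
  define N where "N = (\<lambda>(c :: int, d :: int). cmod (of_int c * \<tau> + of_int d))"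
  \<comment> \<open>The pair \<open>(0, 1)\<close> has norm 1, so a minimum over this finite set is
    a minimum over all coprime pairs.\<close>
  define S where "S = {(c, d). coprime c d \<and> N (c, d) \<le> 1}"
  have fin: "finite S"
    by (rule finite_subset[OF _ finite_small_lin_forms[OF assms]]) (auto simp: S_def N_def)
  have mem: "(0, 1) \<in> S" by (simp add: S_def N_def)
  obtain c d where cd: "(c, d) \<in> S" and min: "\<And>p. p \<in> S \<Longrightarrow> N (c, d) \<le> N p"
    using arg_min_if_finite(1)[OF fin, of N] arg_min_least[OF fin _, of _ N] mem
    by (metis empty_iff surj_pair)
  have min': "N (c, d) \<le> N (u, v)" if "coprime u v" for u v
    using min[of "(u, v)"] cd that by (cases "N (u, v) \<le> 1") (auto simp: S_def)
  have cop: "coprime c d" using cd by (simp add: S_def)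
  obtain u v where "u * c + v * d = gcd c d" using bezout_int by blast
  then have uv: "v * d - (- u) * c = 1" using cop by (simp add: coprime_iff_gcd_eq_1)
  \<comment> \<open>Subtracting \<open>n\<close> times the bottom row from the Bezout row
    \<open>(v, -u)\<close> translates the image by \<open>-n\<close>, which brings its real part
    into [-1/2, 1/2].\<close>
  define n where "n = round (Re ((of_int v * \<tau> + of_int (- u)) / (of_int c * \<tau> + of_int d)))"
  define \<gamma> where "\<gamma> = mat2 (v - n * c) (- u - n * d) c d"
  have SL: "\<gamma> \<in> SL2Z"
    using uv by (simp add: SL2Z_iff \<gamma>_def algebra_simps)
  have J: "automorphy_factor \<gamma> \<tau> = of_int c * \<tau> + of_int d"
    by (simp add: automorphy_factor_def \<gamma>_def)
  have J0: "of_int c * \<tau> + of_int d \<noteq> 0"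
    using automorphy_nonzero[OF SL assms] by (simp add: J)
  have m: "moebius \<gamma> \<tau> = (of_int v * \<tau> + of_int (- u)) / (of_int c * \<tau> + of_int d) - of_int n"
    unfolding moebius_def J using J0 by (simp add: \<gamma>_def field_simps)
  have re: "\<bar>Re (moebius \<gamma> \<tau>)\<bar> \<le> 1/2"
    unfolding m n_def using of_int_round_abs_le by (simp add: abs_minus_commute)
  have "coprime (v - n * c) (- u - n * d)"
  proof (rule coprimeI)
    fix w assume "w dvd v - n * c" "w dvd - u - n * d"
    then have "w dvd (v - n * c) * d - (- u - n * d) * c" by simp
    also have "\<dots> = 1" using uv by (simp add: algebra_simps)
    finally show "is_unit w" .
  qed
  from min'[OF this] have "N (c, d) \<le> cmod (moebius \<gamma> \<tau>) * N (c, d)"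
    unfolding moebius_def J using J0 by (simp add: N_def \<gamma>_def norm_divide)
  then have "1 \<le> cmod (moebius \<gamma> \<tau>)"
    using J0 by (simp add: N_def)
  then have "1 \<le> (cmod (moebius \<gamma> \<tau>))\<^sup>2" by simp
  moreover have "(Re (moebius \<gamma> \<tau>))\<^sup>2 \<le> (1/2)\<^sup>2"
    using re by (metis abs_ge_zero power2_abs power_mono)
  ultimately have "3/4 \<le> (Im (moebius \<gamma> \<tau>))\<^sup>2"
    by (simp add: cmod_power2 power_divide)
  with SL re show ?thesis by (rule that)
qed

section \<open>Eisenstein series\<close>

lemma has_sum_inverse_squares_int:
  "((\<lambda>n :: int. 1 / (of_int n)\<^sup>2) has_sum (pi\<^sup>2 / 3)) (- {0})"
proof -
  have nat: "((\<lambda>n. 1 / real ((n + 1)\<^sup>2)) has_sum (pi\<^sup>2 / 6)) UNIV"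
    using inverse_squares_sums by (intro sums_nonneg_imp_has_sum) auto
  have "((\<lambda>n :: int. 1 / (of_int n)\<^sup>2 :: real) has_sum (pi\<^sup>2 / 6)) {0<..}"
    by (rule has_sum_reindex_bij_witness[THEN iffD1, OF _ _ _ _ _ refl nat, of "\<lambda>n. nat n - 1" "\<lambda>n. int n + 1"]) auto
  moreover have "((\<lambda>n :: int. 1 / (of_int n)\<^sup>2 :: real) has_sum (pi\<^sup>2 / 6)) {..<0}"
    by (rule has_sum_reindex_bij_witness[THEN iffD1, OF _ _ _ _ _ refl nat, of "\<lambda>n. nat (-n) - 1" "\<lambda>n. - int n - 1"])
       (auto simp: power2_eq_square algebra_simps)
  ultimately have "((\<lambda>n :: int. 1 / (of_int n)\<^sup>2 :: real) has_sum (pi\<^sup>2 / 6 + pi\<^sup>2 / 6)) ({0<..} \<union> {..<0})"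
    by (rule has_sum_Un_disjoint) auto
  moreover have "{0<..} \<union> {..<0} = - {0 :: int}" by auto
  ultimately show ?thesis by simp
qed

lemma has_sum_inverse_squares_lattice:
  "((\<lambda>(c :: int, d :: int). 1 / ((of_int c)\<^sup>2 * (of_int d)\<^sup>2)) has_sum (pi\<^sup>2 / 3)\<^sup>2) ((- {0}) \<times> (- {0}))"
proof -
  let ?f = "\<lambda>(c :: int, d :: int). 1 / ((of_int c)\<^sup>2 * (of_int d)\<^sup>2) :: real"
  have inner: "((\<lambda>d. ?f (c, d)) has_sum (1 / (of_int c)\<^sup>2 * (pi\<^sup>2 / 3))) (- {0})" for c
    using has_sum_cmult_right[OF has_sum_inverse_squares_int, of "1 / (of_int c)\<^sup>2"] by simp
  have outer: "((\<lambda>c :: int. 1 / (of_int c)\<^sup>2 * (pi\<^sup>2 / 3)) has_sum (pi\<^sup>2 / 3 * (pi\<^sup>2 / 3))) (- {0})"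
    by (intro has_sum_cmult_left has_sum_inverse_squares_int)
  have "?f summable_on ((- {0}) \<times> (- {0}))"
    by (rule summable_on_SigmaI[OF inner]) (use outer in \<open>auto simp: summable_on_def\<close>)
  from has_sum_SigmaI[OF inner outer this] show ?thesis
    by (simp add: power2_eq_square)
qed

section \<open>Locally uniform convergence of the Eisenstein series\<close>

abbreviation coprime_pairs :: "(int \<times> int) set" where
  "coprime_pairs \<equiv> {(c :: int, d :: int). coprime c d}"

text \<open>Inverse squares off the axes factor into two convergent series. On the axes they
  degenerate and are replaced by 1, which is harmless because only four coprime pairs lie
  there.\<close>

definition lattice_majorant :: "int \<times> int \<Rightarrow> real" where
  "lattice_majorant = (\<lambda>(c, d). if c = 0 \<or> d = 0 then 1 else 1 / ((of_int c)\<^sup>2 * (of_int d)\<^sup>2))"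

lemma coprime_pairs_split:
  "coprime_pairs = {(0, 1), (0, -1), (1, 0), (-1, 0)} \<union> (coprime_pairs \<inter> ((- {0}) \<times> (- {0})))"
  by (auto simp: abs_if split: if_splits)

lemma summable_lattice_majorant: "lattice_majorant summable_on coprime_pairs"
proof -
  let ?off = "coprime_pairs \<inter> ((- {0}) \<times> (- {0}))"
  have "(\<lambda>(c :: int, d :: int). 1 / ((of_int c)\<^sup>2 * (of_int d)\<^sup>2) :: real) summable_on ?off"
    by (rule summable_on_subset_banach[of _ "(- {0}) \<times> (- {0})"])
       (use has_sum_inverse_squares_lattice in \<open>auto simp: summable_on_def\<close>)
  then have "lattice_majorant summable_on ?off"
    by (rule summable_on_cong[THEN iffD1, rotated]) (auto simp: lattice_majorant_def split: if_splits)
  then show ?thesis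
    by (subst coprime_pairs_split, intro summable_on_Un_disjoint) auto
qed

text \<open>Both |c| and |d| are O(|c tau + d|), with constants depending only on the bounds for Im
  tau and |tau|; multiply the two estimates.\<close>

lemma lattice_product_bound:
  assumes "0 < y" "y \<le> Im \<tau>" "cmod \<tau> \<le> R"
  shows "\<bar>real_of_int c\<bar> * \<bar>real_of_int d\<bar> \<le> (1 + R / y) / y * (cmod (of_int c * \<tau> + of_int d))\<^sup>2"
proof -
  let ?N = "cmod (of_int c * \<tau> + of_int d)"
  have R: "0 \<le> R" using assms(3) norm_ge_zero order_trans by blast
  have "\<bar>real_of_int c\<bar> * y \<le> \<bar>real_of_int c\<bar> * Im \<tau>"
    using assms by (intro mult_left_mono) auto
  also have "\<dots> \<le> ?N"
    using abs_Im_le_cmod[of "of_int c * \<tau> + of_int d"] assms by (simp add: abs_mult)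
  finally have c: "\<bar>real_of_int c\<bar> \<le> ?N / y"
    using assms by (simp add: field_simps)
  have "cmod (of_int d) \<le> ?N + cmod (of_int c * \<tau>)"
    by (metis add_diff_cancel_left' norm_triangle_ineq4)
  also have "\<dots> = ?N + \<bar>real_of_int c\<bar> * cmod \<tau>" by (simp add: norm_mult)
  also have "\<dots> \<le> ?N + (?N / y) * R"
    using c assms R by (intro add_left_mono mult_mono) auto
  finally have d: "\<bar>real_of_int d\<bar> \<le> ?N * (1 + R / y)" by (simp add: algebra_simps)
  have "\<bar>real_of_int c\<bar> * \<bar>real_of_int d\<bar> \<le> (?N / y) * (?N * (1 + R / y))"
    using c d assms by (intro mult_mono) auto
  then show ?thesis by (simp add: power2_eq_square mult_ac)
qed

lemma inverse_power_le_inverse_square: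
  fixes x C N :: real
  assumes "1 \<le> x" "x \<le> C * N\<^sup>2" "0 < N" "0 < C" "2 \<le> m"
  shows "1 / N ^ (2 * m) \<le> C ^ m / x\<^sup>2"
proof -
  have "x\<^sup>2 \<le> x ^ m" using assms by (intro power_increasing) auto
  also have "\<dots> \<le> (C * N\<^sup>2) ^ m" using assms by (intro power_mono) auto
  also have "\<dots> = C ^ m * N ^ (2 * m)" by (simp add: power_mult_distrib power_mult)
  finally show ?thesis using assms by (simp add: field_simps)
qed

text \<open>The three summands of the constant serve the cases \<open>c = 0\<close>,
  \<open>d = 0\<close> and neither. The constant involves only \<open>y\<close> and
  \<open>R\<close>, so it is uniform on small closed discs.\<close>

lemma eisenstein_term_le:
  assumes "0 < y" "y \<le> Im \<tau>" "cmod \<tau> \<le> R" "coprime c d" "2 \<le> m"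
  shows "cmod (1 / (of_int c * \<tau> + of_int d) ^ (2 * m))
     \<le> (1 + 1 / y ^ (2 * m) + ((1 + R / y) / y) ^ m) * lattice_majorant (c, d)"
proof -
  have R: "0 \<le> R" using assms(3) norm_ge_zero order_trans by blast
  have C: "0 < (1 + R / y) / y" using assms R by (simp add: add_pos_nonneg)
  then have C': "0 < ((1 + R / y) / y) ^ m" by simp
  have yp: "0 \<le> 1 / y ^ (2 * m)" using assms by simp
  have \<tau>: "\<tau> \<in> \<H>" using assms by (simp add: uhp_iff)
  consider "c = 0" "\<bar>d\<bar> = 1" | "d = 0" "\<bar>c\<bar> = 1" | "c \<noteq> 0" "d \<noteq> 0"
    using assms(4) by (cases "c = 0"; cases "d = 0") auto
  then show ?thesis
  proof cases
    case 1
    have "\<bar>real_of_int d\<bar> = 1" using 1 by linarith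
    then show ?thesis using 1 C' yp by (simp add: lattice_majorant_def norm_divide norm_power)
  next
    case 2
    have c: "\<bar>real_of_int c\<bar> = 1" using 2 by linarith
    have "y \<le> cmod \<tau>" using assms abs_Im_le_cmod[of \<tau>] by linarith
    then have "1 / cmod \<tau> ^ (2 * m) \<le> 1 / y ^ (2 * m)"
      using assms by (intro divide_left_mono power_mono mult_pos_pos zero_less_power) auto
    then show ?thesis
      using 2 c C' by (simp add: lattice_majorant_def norm_divide norm_power norm_mult)
  next
    case 3
    let ?N = "cmod (of_int c * \<tau> + of_int d)"
    have "c * d \<noteq> 0" using 3 by simp
    then have "1 \<le> \<bar>c * d\<bar>" by linarith
    then have "1 \<le> \<bar>real_of_int c\<bar> * \<bar>real_of_int d\<bar>"
      by (metis abs_mult of_int_1_le_iff of_int_abs of_int_mult)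
    moreover have "0 < ?N" using lin_form_nonzero[OF \<tau>, of c d] 3 by simp
    ultimately have "1 / ?N ^ (2 * m) \<le> ((1 + R / y) / y) ^ m / (\<bar>real_of_int c\<bar> * \<bar>real_of_int d\<bar>)\<^sup>2"
      using lattice_product_bound[OF assms(1-3)] C assms(5)
      by (intro inverse_power_le_inverse_square) auto
    also have "\<dots> = ((1 + R / y) / y) ^ m * lattice_majorant (c, d)"
      using 3 by (simp add: lattice_majorant_def power_mult_distrib)
    also have "\<dots> \<le> (1 + 1 / y ^ (2 * m) + ((1 + R / y) / y) ^ m) * lattice_majorant (c, d)"
      using yp by (intro mult_right_mono) (auto simp: lattice_majorant_def)
    finally show ?thesis by (simp add: norm_divide norm_power)
  qed
qed

lemma eisenstein_abs_summable:
  assumes "\<tau> \<in> \<H>" "2 \<le> m"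
  shows "(\<lambda>p. norm (case p of (c, d) \<Rightarrow> 1 / (of_int c * \<tau> + of_int d) ^ (2 * m))) summable_on coprime_pairs"
proof (rule summable_on_comparison_test)
  let ?C = "1 + 1 / Im \<tau> ^ (2 * m) + ((1 + cmod \<tau> / Im \<tau>) / Im \<tau>) ^ m"
  show "(\<lambda>p. ?C * lattice_majorant p) summable_on coprime_pairs"
    by (intro summable_on_cmult_right summable_lattice_majorant)
  show "norm (case p of (c, d) \<Rightarrow> 1 / (of_int c * \<tau> + of_int d) ^ (2 * m)) \<le> ?C * lattice_majorant p"
    if "p \<in> coprime_pairs" for p
    using that eisenstein_term_le[of "Im \<tau>" \<tau> "cmod \<tau>" "fst p" "snd p" m] assms
    by (auto simp: uhp_iff split: prod.splits)
qed auto

lemma eisenstein_holomorphic: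
  assumes "2 \<le> m"
  shows "eisenstein (2 * m) holomorphic_on \<H>"
proof -
  let ?f = "\<lambda>p \<tau>. case p of (c :: int, d :: int) \<Rightarrow> 1 / (of_int c * \<tau> + of_int d :: complex) ^ (2 * m)"
  let ?s = "\<lambda>\<tau>. \<Sum>\<^sub>\<infinity>p\<in>coprime_pairs. ?f p \<tau>"
  have "?s analytic_on \<H>"
  unfolding analytic_on_def
  proof (intro ballI)
    fix \<tau>0 assume "\<tau>0 \<in> \<H>"
    then have y: "0 < Im \<tau>0" by (simp add: uhp_iff)
    \<comment> \<open>Half the height, so that the closed disc of radius \<open>r\<close> stays at
      height at least \<open>r\<close>.\<close>
    define r where "r = Im \<tau>0 / 2"
    have near: "r \<le> Im \<tau>" "cmod \<tau> \<le> cmod \<tau>0 + r" if "\<tau> \<in> cball \<tau>0 r" for \<tau>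
    proof -
      have le: "cmod (\<tau> - \<tau>0) \<le> r" using that by (simp add: dist_norm norm_minus_commute)
      have "\<bar>Im \<tau> - Im \<tau>0\<bar> \<le> r" using abs_Im_le_cmod[of "\<tau> - \<tau>0"] le by simp
      then show "r \<le> Im \<tau>" unfolding r_def by linarith
      show "cmod \<tau> \<le> cmod \<tau>0 + r" using le norm_triangle_sub[of \<tau> \<tau>0] by linarith
    qed
    have r: "0 < r" using y by (simp add: r_def)
    let ?C = "1 + 1 / r ^ (2 * m) + ((1 + (cmod \<tau>0 + r) / r) / r) ^ m"
    have unif: "uniform_limit (cball \<tau>0 r) (\<lambda>X \<tau>. \<Sum>p\<in>X. ?f p \<tau>) ?s (finite_subsets_at_top coprime_pairs)"
    proof (rule Weierstrass_m_test_general)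
      show "(\<lambda>p. ?C * lattice_majorant p) summable_on coprime_pairs"
        by (intro summable_on_cmult_right summable_lattice_majorant)
      show "norm (?f p \<tau>) \<le> ?C * lattice_majorant p"
        if "p \<in> coprime_pairs" "\<tau> \<in> cball \<tau>0 r" for p \<tau>
        using that near[OF that(2)] r eisenstein_term_le[of r \<tau> "cmod \<tau>0 + r" "fst p" "snd p" m] assms
        by (auto split: prod.splits)
    qed
    have "?f p holomorphic_on cball \<tau>0 r" if "p \<in> coprime_pairs" for p
    proof -
      obtain c d where p: "p = (c, d)" by (cases p)
      have "of_int c * \<tau> + of_int d \<noteq> 0" if "\<tau> \<in> cball \<tau>0 r" for \<tau>
        using near[OF that] r \<open>p \<in> coprime_pairs\<close> p
        by (intro lin_form_nonzero) (auto simp: uhp_iff)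
      then show ?thesis unfolding p by (auto intro!: holomorphic_intros)
    qed
    then have "\<forall>\<^sub>F X in finite_subsets_at_top coprime_pairs. (\<lambda>\<tau>. \<Sum>p\<in>X. ?f p \<tau>) holomorphic_on cball \<tau>0 r"
      by (intro eventually_finite_subsets_at_top_weakI holomorphic_on_sum) auto
    then have "\<forall>\<^sub>F X in finite_subsets_at_top coprime_pairs. continuous_on (cball \<tau>0 r) (\<lambda>\<tau>. \<Sum>p\<in>X. ?f p \<tau>)
        \<and> (\<lambda>\<tau>. \<Sum>p\<in>X. ?f p \<tau>) holomorphic_on ball \<tau>0 r"
      by eventually_elim (meson ball_subset_cball holomorphic_on_imp_continuous_on holomorphic_on_subset)
    then have "?s holomorphic_on ball \<tau>0 r"
      by (rule holomorphic_uniform_limit[OF _ unif]) auto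
    with r show "\<exists>e>0. ?s holomorphic_on ball \<tau>0 e" by blast
  qed
  then have "?s holomorphic_on \<H>" by (rule analytic_imp_holomorphic)
  then show ?thesis
    unfolding eisenstein_def[abs_def] by (intro holomorphic_intros) (simp add: split_def)
qed

text \<open>Right multiplication by gamma permutes the coprime rows (u, v), and each term picks up
  the factor J^k.\<close>

lemma eisenstein_modular:
  assumes \<gamma>: "\<gamma> \<in> SL2Z" and \<tau>: "\<tau> \<in> \<H>"
  shows "eisenstein k (moebius \<gamma> \<tau>) = automorphy_factor \<gamma> \<tau> ^ k * eisenstein k \<tau>"
proof -
  define a where "a = \<gamma>$1$1"
  define b where "b = \<gamma>$1$2"
  define c where "c = \<gamma>$2$1"
  define d where "d = \<gamma>$2$2"
  let ?J = "of_int c * \<tau> + of_int d"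
  have det: "a * d - b * c = 1" using \<gamma> by (simp add: SL2Z_iff a_def b_def c_def d_def)
  have J: "automorphy_factor \<gamma> \<tau> = ?J" by (simp add: automorphy_factor_def c_def d_def)
  have J0: "?J \<noteq> 0" using automorphy_nonzero[OF \<gamma> \<tau>] by (simp add: J)
  let ?i = "\<lambda>(u, v). (u * a + v * c, u * b + v * d)"
  let ?j = "\<lambda>(u, v). (u * d - v * c, v * a - u * b)"
  \<comment> \<open>Stated for an arbitrary matrix of determinant 1, since it is applied to gamma
    and to its inverse.\<close>
  have cop: "coprime (u * p + v * q) (u * r + v * s)" if "p * s - r * q = 1" "coprime u v"
    for u v p q r s :: int
  proof (rule coprimeI)
    fix w assume w: "w dvd u * p + v * q" "w dvd u * r + v * s"
    have "(u * p + v * q) * s - (u * r + v * s) * q = u * (p * s - r * q)"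
      "(u * r + v * s) * p - (u * p + v * q) * r = v * (p * s - r * q)" by algebra+
    then have "w dvd u" "w dvd v"
      using w that by (metis dvd_diff dvd_mult2 mult.right_neutral)+
    then show "is_unit w" using that(2) by (meson coprime_common_divisor)
  qed
  have inv: "(u * a + v * c) * d - (u * b + v * d) * c = u"
       "(u * b + v * d) * a - (u * a + v * c) * b = v"
       "(u * d - v * c) * a + (v * a - u * b) * c = u"
       "(u * d - v * c) * b + (v * a - u * b) * d = v" for u v
    using det by algebra+
  have term_eq: "1 / (of_int u * moebius \<gamma> \<tau> + of_int v) ^ k
     = ?J ^ k * (1 / (of_int (u * a + v * c) * \<tau> + of_int (u * b + v * d)) ^ k)" for u v
  proof -
    have "of_int u * moebius \<gamma> \<tau> + of_int v
       = (of_int (u * a + v * c) * \<tau> + of_int (u * b + v * d)) / ?J"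
      unfolding moebius_def J using J0 by (simp add: field_simps a_def b_def c_def d_def)
    then show ?thesis by (simp add: power_divide)
  qed
  have "(\<Sum>\<^sub>\<infinity>(u, v)\<in>coprime_pairs. 1 / (of_int u * moebius \<gamma> \<tau> + of_int v) ^ k)
     = (\<Sum>\<^sub>\<infinity>(u, v)\<in>coprime_pairs. ?J ^ k * (1 / (of_int u * \<tau> + of_int v) ^ k))"
  proof (rule infsum_reindex_bij_witness[of _ ?j ?i])
    fix p assume p: "p \<in> coprime_pairs"
    then show "?i p \<in> coprime_pairs"
      using cop[of a d b c "fst p" "snd p"] det by (auto simp: split_def)
    show "?j p \<in> coprime_pairs"
      using p cop[of d a "-b" "-c" "fst p" "snd p"] det by (auto simp: split_def algebra_simps)
    show "?j (?i p) = p" "?i (?j p) = p" using inv by (auto simp: split_def)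
    show "(case ?i p of (u, v) \<Rightarrow> ?J ^ k * (1 / (of_int u * \<tau> + of_int v) ^ k))
       = (case p of (u, v) \<Rightarrow> 1 / (of_int u * moebius \<gamma> \<tau> + of_int v) ^ k)"
      using term_eq by (auto simp: split_def)
  qed
  also have "\<dots> = ?J ^ k * (\<Sum>\<^sub>\<infinity>(u, v)\<in>coprime_pairs. 1 / (of_int u * \<tau> + of_int v) ^ k)"
    unfolding split_def by (rule infsum_cmult_right')
  finally show ?thesis unfolding eisenstein_def J by simp
qed

text \<open>The pairs (0, 1) and (0, -1) give the constant 1. Off the axes, |Re tau| <= 1/2 and Im
  tau >= 1 imply |c d| Im tau <= |c tau + d|^2 by completing squares and the inequality between
  arithmetic and geometric mean, so a factor 1 / (Im tau)^2 splits off every remaining term.\<close>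

lemma eisenstein_near_cusp:
  assumes "2 \<le> m"
  obtains C where "\<And>\<tau>. 1 \<le> Im \<tau> \<Longrightarrow> \<bar>Re \<tau>\<bar> \<le> 1/2 \<Longrightarrow> cmod (eisenstein (2 * m) \<tau> - 1) \<le> C / (Im \<tau>)\<^sup>2"
proof
  let ?S = "\<Sum>\<^sub>\<infinity>p\<in>coprime_pairs. lattice_majorant p"
  fix \<tau> :: complex assume y: "1 \<le> Im \<tau>" and x: "\<bar>Re \<tau>\<bar> \<le> 1/2"
  let ?f = "\<lambda>(c :: int, d :: int). 1 / (of_int c * \<tau> + of_int d :: complex) ^ (2 * m)"
  let ?A = "{(0, 1), (0, -1 :: int)} :: (int \<times> int) set"
  have \<tau>: "\<tau> \<in> \<H>" using y by (simp add: uhp_iff)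
  have summ: "?f summable_on coprime_pairs"
    by (rule abs_summable_summable[OF eisenstein_abs_summable[OF \<tau> assms]])
  have A: "?A \<subseteq> coprime_pairs" by auto
  have "infsum ?f (coprime_pairs - ?A) = infsum ?f coprime_pairs - infsum ?f ?A"
    by (rule infsum_Diff[OF summ _ A]) simp
  moreover have "infsum ?f ?A = 2" by simp
  ultimately have eq: "eisenstein (2 * m) \<tau> - 1 = 1 / 2 * infsum ?f (coprime_pairs - ?A)"
    unfolding eisenstein_def by (simp add: algebra_simps)
  have le: "norm (?f p) \<le> 1 / (Im \<tau>)\<^sup>2 * lattice_majorant p" if p: "p \<in> coprime_pairs - ?A" for p
  proof -
    obtain c d where cd: "p = (c, d)" by (cases p)
    let ?N = "cmod (of_int c * \<tau> + of_int d)"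
    have cop: "coprime c d" and c0: "c \<noteq> 0" using p cd by auto
    have c1: "1 \<le> \<bar>real_of_int c\<bar>" using c0 by linarith
    have Npos: "0 < ?N" using lin_form_nonzero[OF \<tau>, of c d] c0 by simp
    have ypow: "(Im \<tau>)\<^sup>2 \<le> Im \<tau> ^ (2 * m)" using y assms by (intro power_increasing) auto
    show ?thesis
    proof (cases "d = 0")
      case True
      then have "\<bar>c\<bar> = 1" using cop by simp
      then have "\<bar>real_of_int c\<bar> = 1" by linarith
      then have N: "?N = cmod \<tau>" using True by (simp add: norm_mult)
      have "(Im \<tau>)\<^sup>2 \<le> cmod \<tau> ^ (2 * m)"
        using ypow power_mono[of "Im \<tau>" "cmod \<tau>" "2 * m"] abs_Im_le_cmod[of \<tau>] y by linarith
      then have "1 / cmod \<tau> ^ (2 * m) \<le> 1 / (Im \<tau>)\<^sup>2"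
        using y by (intro divide_left_mono mult_pos_pos zero_less_power) (use y in auto)
      then show ?thesis using True N by (simp add: cd lattice_majorant_def norm_divide norm_power)
    next
      case False
      have d1: "1 \<le> \<bar>real_of_int d\<bar>" using False by linarith
      have N2: "?N\<^sup>2 = (of_int c * Re \<tau> + of_int d)\<^sup>2 + (of_int c)\<^sup>2 * (Im \<tau>)\<^sup>2"
        by (simp add: cmod_power2 power_mult_distrib)
      have "(of_int c * Re \<tau>)\<^sup>2 \<le> (of_int c)\<^sup>2 * (1/2)\<^sup>2"
        unfolding power_mult_distrib
        by (intro mult_left_mono power2_le_iff_abs_le[THEN iffD2]) (use x in auto)
      then have "(of_int c * Re \<tau>)\<^sup>2 \<le> (of_int c)\<^sup>2 * (1/4)" by (simp add: power_divide)
      moreover have "(of_int d)\<^sup>2 / 2 - (of_int c * Re \<tau>)\<^sup>2 \<le> (of_int c * Re \<tau> + of_int d)\<^sup>2"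
      proof -
        have "0 \<le> (2 * (of_int c * Re \<tau>) + of_int d)\<^sup>2" by simp
        then show ?thesis by (simp add: power2_eq_square algebra_simps)
      qed
      moreover have "(of_int c)\<^sup>2 * 1 \<le> (of_int c)\<^sup>2 * (Im \<tau>)\<^sup>2"
        using y by (intro mult_left_mono) auto
      moreover have "0 \<le> (real_of_int c)\<^sup>2" by simp
      moreover have "2 * (\<bar>of_int c\<bar> * \<bar>of_int d\<bar> * Im \<tau>) \<le> (of_int d)\<^sup>2 + (of_int c)\<^sup>2 * (Im \<tau>)\<^sup>2"
      proof -
        have "0 \<le> (\<bar>of_int d\<bar> - \<bar>of_int c\<bar> * Im \<tau>)\<^sup>2" by simp
        then show ?thesis by (simp add: power2_diff power_mult_distrib algebra_simps)
      qed
      ultimately have "\<bar>of_int c\<bar> * \<bar>of_int d\<bar> * Im \<tau> \<le> ?N\<^sup>2"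
        unfolding N2 by linarith
      moreover have "1 \<le> \<bar>real_of_int c\<bar> * \<bar>of_int d\<bar> * Im \<tau>"
        using c1 d1 y by (metis (no_types, opaque_lifting) abs_ge_zero mult_ge1_I)
      ultimately have "1 / ?N ^ (2 * m) \<le> 1 ^ m / (\<bar>of_int c\<bar> * \<bar>of_int d\<bar> * Im \<tau>)\<^sup>2"
        using Npos assms by (intro inverse_power_le_inverse_square) auto
      then show ?thesis using False c0
        by (simp add: cd lattice_majorant_def norm_divide norm_power power_mult_distrib mult_ac)
    qed
  qed
  have sub: "coprime_pairs - ?A \<subseteq> coprime_pairs" by blast
  have maj: "lattice_majorant summable_on (coprime_pairs - ?A)"
    by (rule summable_on_subset_banach[OF summable_lattice_majorant sub])
  have "norm (infsum ?f (coprime_pairs - ?A)) \<le> 1 / (Im \<tau>)\<^sup>2 * infsum lattice_majorant (coprime_pairs - ?A)"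
    by (rule norm_infsum_le[OF has_sum_infsum has_sum_cmult_right[OF has_sum_infsum[OF maj]] le])
       (use summable_on_subset_banach[OF summ sub] in auto)
  also have "\<dots> \<le> 1 / (Im \<tau>)\<^sup>2 * ?S"
    by (intro mult_left_mono infsum_mono2 summable_lattice_majorant maj sub)
       (auto simp: lattice_majorant_def)
  finally show "cmod (eisenstein (2 * m) \<tau> - 1) \<le> (?S / 2) / (Im \<tau>)\<^sup>2"
    unfolding eq by (simp add: norm_mult)
qed

text \<open>The four pairs on the axes contribute 4. For the others |c i + d|^4 = (c^2 + d^2)^2 >= 4
  c^2 d^2, so they add up to at most (pi^2 / 3)^2 / 4 < 4 in modulus. Together with
  \<open>eisenstein_6_ii\<close> this provides a point where \<open>disc\<close> is known to be
  nonzero.\<close>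

lemma eisenstein_4_ii_nonzero: "eisenstein 4 \<i> \<noteq> 0"
proof -
  let ?f = "\<lambda>(c :: int, d :: int). 1 / (of_int c * \<i> + of_int d) ^ 4"
  let ?A = "{(0, 1), (0, -1), (1, 0), (-1, 0)} :: (int \<times> int) set"
  let ?off = "(- {0}) \<times> (- {0}) :: (int \<times> int) set"
  have summ: "?f summable_on coprime_pairs"
    using abs_summable_summable[OF eisenstein_abs_summable[of \<i> 2]] by (simp add: uhp_iff)
  have sub: "coprime_pairs \<inter> ?off \<subseteq> coprime_pairs" by blast
  have "infsum ?f coprime_pairs = infsum ?f ?A + infsum ?f (coprime_pairs \<inter> ?off)"
    by (subst coprime_pairs_split, rule infsum_Un_disjoint)
       (use summable_on_subset_banach[OF summ sub] in auto)
  also have "infsum ?f ?A = 4" by simp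
  finally have eq: "infsum ?f coprime_pairs = 4 + infsum ?f (coprime_pairs \<inter> ?off)" .
  let ?g = "\<lambda>(c :: int, d :: int). 1 / ((of_int c)\<^sup>2 * (of_int d)\<^sup>2) :: real"
  have gs: "?g summable_on ?off" and gi: "infsum ?g ?off = (pi\<^sup>2 / 3)\<^sup>2"
    using has_sum_inverse_squares_lattice by (auto simp: summable_on_def infsumI)
  have gs': "?g summable_on (coprime_pairs \<inter> ?off)"
    by (rule summable_on_subset_banach[OF gs]) blast
  have "norm (infsum ?f (coprime_pairs \<inter> ?off)) \<le> 1/4 * infsum ?g (coprime_pairs \<inter> ?off)"
  proof (rule norm_infsum_le[OF has_sum_infsum has_sum_cmult_right[OF has_sum_infsum[OF gs']]])
    show "?f summable_on (coprime_pairs \<inter> ?off)" by (rule summable_on_subset_banach[OF summ sub])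
    fix p assume "p \<in> coprime_pairs \<inter> ?off"
    then obtain c d where p: "p = (c, d)" "c \<noteq> 0" "d \<noteq> 0" by auto
    define x where "x = (real_of_int c)\<^sup>2"
    define z where "z = (real_of_int d)\<^sup>2"
    have pos: "0 < x" "0 < z" using p by (auto simp: x_def z_def)
    have "(cmod (of_int c * \<i> + of_int d))\<^sup>2 = x + z"
      by (simp add: cmod_power2 x_def z_def)
    then have N: "cmod (of_int c * \<i> + of_int d) ^ 4 = (x + z)\<^sup>2"
      by (metis numeral_Bit0 mult_2 power_even_eq power_mult mult_2_right)
    have "4 * (x * z) \<le> (x + z)\<^sup>2"
      using zero_le_power2[of "x - z"] by (simp add: power2_eq_square algebra_simps)
    then have "1 / (x + z)\<^sup>2 \<le> 1 / (4 * (x * z))"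
      using pos by (intro divide_left_mono mult_pos_pos zero_less_power) auto
    then show "norm (?f p) \<le> 1/4 * ?g p"
      using p N by (simp add: norm_divide norm_power x_def z_def)
  qed
  also have "\<dots> \<le> 1/4 * infsum ?g ?off"
    by (intro mult_left_mono infsum_mono2 gs gs') auto
  also have "\<dots> < 4"
  proof -
    have "pi < 3.2" using pi_approx(2) by simp
    then have "pi * pi < 3.2 * 3.2" by (intro mult_strict_mono) auto
    then have "pi\<^sup>2 / 3 < 4" by (simp add: power2_eq_square)
    then have "(pi\<^sup>2 / 3)\<^sup>2 < 4\<^sup>2" by (intro power_strict_mono) auto
    then show ?thesis unfolding gi by simp
  qed
  finally have lt: "norm (infsum ?f (coprime_pairs \<inter> ?off)) < 4" .
  have "infsum ?f coprime_pairs \<noteq> 0"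
  proof
    assume "infsum ?f coprime_pairs = 0"
    then have "infsum ?f (coprime_pairs \<inter> ?off) = - 4" using eq by (simp add: add_eq_0_iff)
    with lt show False by simp
  qed
  then show ?thesis unfolding eisenstein_def by simp
qed

text \<open>The inversion tau -> -1/tau fixes i with automorphy factor i, and i^6 = -1.\<close>

lemma eisenstein_6_ii: "eisenstein 6 \<i> = 0"
proof -
  have S: "mat2 0 (-1) 1 0 \<in> SL2Z" by (simp add: SL2Z_iff)
  have "automorphy_factor (mat2 0 (-1) 1 0) \<i> = \<i>" by (simp add: automorphy_factor_def)
  moreover from this have "moebius (mat2 0 (-1) 1 0) \<i> = \<i>" by (simp add: moebius_def)
  ultimately have "eisenstein 6 \<i> = \<i> ^ 6 * eisenstein 6 \<i>"
    using eisenstein_modular[OF S, of \<i> 6] by (simp add: uhp_iff)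
  moreover have "\<i> ^ 6 = -1" by (simp add: power_numeral_reduce)
  ultimately show ?thesis by simp
qed

section \<open>Expansions at the cusp\<close>

definition nome :: "complex \<Rightarrow> complex" where
  "nome \<tau> = exp (2 * of_real pi * \<i> * \<tau>)"

lemma norm_nome: "cmod (nome \<tau>) = exp (- (2 * pi * Im \<tau>))"
  by (simp add: nome_def)

lemma nome_nonzero [simp]: "nome \<tau> \<noteq> 0"
  by (simp add: nome_def)

lemma nome_in_ball: "\<tau> \<in> \<H> \<Longrightarrow> nome \<tau> \<in> ball 0 1"
  by (simp add: norm_nome uhp_iff)

lemma norm_nome_less_1_iff: "cmod (nome \<tau>) < 1 \<longleftrightarrow> \<tau> \<in> \<H>"
  by (simp add: norm_nome uhp_iff zero_less_mult_iff)

lemma nome_eq_norm_imp_Im: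
  assumes "cmod (nome \<tau>) = exp (- (2 * pi * y))"
  shows "Im \<tau> = y"
  using assms by (simp add: norm_nome)

lemma nome_surj:
  assumes "q \<in> ball 0 1" "q \<noteq> 0"
  obtains \<tau> where "\<tau> \<in> \<H>" "nome \<tau> = q"
proof
  let ?\<tau> = "Ln q / (2 * of_real pi * \<i>)"
  show q: "nome ?\<tau> = q" using assms by (simp add: nome_def)
  have "cmod (nome ?\<tau>) < 1" using q assms by simp
  then show "?\<tau> \<in> \<H>" by (simp only: norm_nome_less_1_iff)
qed

lemma nome_eq_imp_shift:
  assumes "nome \<tau> = nome \<tau>'"
  obtains n :: int where "\<tau> = \<tau>' + of_int n"
proof -
  obtain n :: int where "2 * of_real pi * \<i> * \<tau> = 2 * of_real pi * \<i> * \<tau>' + (of_int (2 * n) * pi) * \<i>"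
    using assms unfolding nome_def exp_eq by blast
  then have "(2 * of_real pi * \<i>) * \<tau> = (2 * of_real pi * \<i>) * (\<tau>' + of_int n)"
    by (simp add: algebra_simps)
  then show ?thesis using that by simp
qed

lemma has_field_derivative_nome [derivative_intros]:
  "(nome has_field_derivative 2 * of_real pi * \<i> * nome \<tau>) (at \<tau>)"
  unfolding nome_def by (auto intro!: derivative_eq_intros)

lemma periodic_int_shift:
  fixes f :: "complex \<Rightarrow> 'a"
  assumes per: "\<And>\<tau>. \<tau> \<in> \<H> \<Longrightarrow> f (\<tau> + 1) = f \<tau>" and "\<tau> \<in> \<H>"
  shows "f (\<tau> + of_int n) = f \<tau>"
proof -
  have nat: "f (\<tau> + of_nat m) = f \<tau>" if "\<tau> \<in> \<H>" for m :: nat and \<tau>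
  proof (induction m)
    case (Suc m)
    have "f (\<tau> + of_nat m + 1) = f (\<tau> + of_nat m)"
      by (rule per) (use that in \<open>simp add: uhp_iff\<close>)
    then show ?case using Suc by (simp add: algebra_simps)
  qed simp
  show ?thesis
  proof (cases "0 \<le> n")
    case True
    then show ?thesis using nat[of \<tau> "nat n"] assms by simp
  next
    case False
    have "\<tau> + of_int n \<in> \<H>" using assms by (simp add: uhp_iff)
    from nat[OF this, of "nat (- n)"] show ?thesis using False by simp
  qed
qed

text \<open>The limit hypothesis makes the singularity at q = 0 removable. \<open>Ln\<close> is
  discontinuous on its cut, so holomorphy at \<open>q0\<close> is proved with another logarithm, of
  \<open>q / q0\<close>; periodicity of \<open>f\<close> makes the choice of branch
  irrelevant.\<close>

lemma q_expansion:
  assumes hol: "f holomorphic_on \<H>"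
    and per: "\<And>\<tau>. \<tau> \<in> \<H> \<Longrightarrow> f (\<tau> + 1) = f \<tau>"
    and lim: "\<And>e. e > 0 \<Longrightarrow> \<exists>Y. \<forall>\<tau>. Im \<tau> \<ge> Y \<longrightarrow> cmod (f \<tau> - l) < e"
  obtains g where "g holomorphic_on ball 0 1" "g 0 = l" "\<And>\<tau>. \<tau> \<in> \<H> \<Longrightarrow> f \<tau> = g (nome \<tau>)"
proof -
  define g where "g = (\<lambda>q. if q = 0 then l else f (Ln q / (2 * of_real pi * \<i>)))"
  have fg: "f \<tau> = g (nome \<tau>)" if "\<tau> \<in> \<H>" for \<tau>
  proof -
    have "nome (Ln (nome \<tau>) / (2 * of_real pi * \<i>)) = nome \<tau>" by (simp add: nome_def)
    then obtain n :: int where "Ln (nome \<tau>) / (2 * of_real pi * \<i>) = \<tau> + of_int n"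
      by (rule nome_eq_imp_shift)
    then show ?thesis using periodic_int_shift[of f, OF per that] by (simp add: g_def)
  qed
  have "g holomorphic_on ball 0 1 - {0}"
  proof (rule holomorphic_onI)
    fix q0 assume q0: "q0 \<in> ball 0 1 - {0 :: complex}"
    obtain \<tau>0 where \<tau>0: "\<tau>0 \<in> \<H>" "nome \<tau>0 = q0" using q0 by (elim DiffE nome_surj) auto
    \<comment> \<open>On this half disc around \<open>q0\<close> the quotient \<open>q / q0\<close>
      avoids the cut of \<open>Ln\<close>, so \<open>t\<close> is a holomorphic section of
      \<open>nome\<close>.\<close>
    define S where "S = {q \<in> ball 0 1. 0 < Re (q / q0)}"
    define t where "t = (\<lambda>q. \<tau>0 + Ln (q / q0) / (2 * of_real pi * \<i>))"
    have "S = ball 0 1 \<inter> (\<lambda>q. q / q0) -` {z. 0 < Re z}" by (auto simp: S_def)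
    moreover have "open ((\<lambda>q. q / q0) -` {z. 0 < Re z})"
      by (intro continuous_open_vimage open_halfspace_Re_gt continuous_intros) (use q0 in auto)
    ultimately have "open S" by (metis open_Int open_ball)
    have t: "nome (t q) = q" if "q \<in> S" for q
    proof -
      have "q / q0 \<noteq> 0" using that by (auto simp: S_def)
      then have "nome (t q) = nome \<tau>0 * (q / q0)"
        by (simp add: nome_def t_def ring_distribs exp_add)
      then show ?thesis using \<tau>0 q0 by simp
    qed
    have tH: "t q \<in> \<H>" if "q \<in> S" for q
    proof -
      have "cmod (nome (t q)) < 1" using t[OF that] that by (simp add: S_def)
      then show ?thesis by (simp only: norm_nome_less_1_iff)
    qed
    have "t holomorphic_on S"
      unfolding t_def using q0
      by (intro holomorphic_intros) (auto simp: S_def complex_nonpos_Reals_iff)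
    then have "f \<circ> t holomorphic_on S"
      by (rule holomorphic_on_compose_gen[OF _ hol]) (use tH in auto)
    moreover have "(f \<circ> t) q = g q" if "q \<in> S" for q
      using fg[OF tH[OF that]] t[OF that] by simp
    ultimately have "g holomorphic_on S" by (rule holomorphic_transform)
    moreover have "q0 \<in> S" using q0 by (simp add: S_def)
    ultimately have "g field_differentiable at q0"
      using \<open>open S\<close> holomorphic_on_imp_differentiable_at by blast
    then show "g field_differentiable at q0 within ball 0 1 - {0}"
      by (rule field_differentiable_at_within)
  qed
  moreover have "(g \<longlongrightarrow> g 0) (at 0)"
  proof (rule LIM_I)
    fix e :: real assume "0 < e"
    then obtain Y where Y: "\<And>\<tau>. Im \<tau> \<ge> Y \<Longrightarrow> cmod (f \<tau> - l) < e" using lim by blast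
    have "cmod (g q - g 0) < e" if "q \<noteq> 0" "cmod (q - 0) < exp (- (2 * pi * Y))" for q
    proof -
      let ?\<tau> = "Ln q / (2 * of_real pi * \<i>)"
      have "nome ?\<tau> = q" using that by (simp add: nome_def)
      then have "exp (- (2 * pi * Im ?\<tau>)) < exp (- (2 * pi * Y))"
        using that by (metis norm_nome diff_zero)
      then have "2 * pi * Y < 2 * pi * Im ?\<tau>" by simp
      then have "Y \<le> Im ?\<tau>" by simp
      from Y[OF this] show ?thesis using that by (simp add: g_def)
    qed
    then show "\<exists>s>0. \<forall>q. q \<noteq> 0 \<and> norm (q - 0) < s \<longrightarrow> norm (g q - g 0) < e"
      by (intro exI[of _ "exp (- (2 * pi * Y))"]) auto
  qed
  ultimately have "g holomorphic_on ball 0 1"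
    by (intro no_isolated_singularity'[of "{0}" g "ball 0 1"]) (auto intro: tendsto_within_subset)
  moreover have "g 0 = l" by (simp add: g_def)
  ultimately show ?thesis using fg that by blast
qed

lemma holomorphic_factor_zero:
  assumes "g holomorphic_on ball 0 1" "g 0 = 0"
  obtains h where "h holomorphic_on ball 0 1" "h 0 = deriv g 0" "\<And>q. g q = q * h q"
proof
  let ?h = "\<lambda>q. if q = 0 then deriv g 0 else (g q - g 0) / (q - 0)"
  show "?h holomorphic_on ball 0 1"
    by (rule pole_lemma[OF assms(1)]) simp
qed (use assms in auto)

text \<open>The witness \<open>g\<close> of holomorphy at the cusp is a parameter, so that vanishing
  at the cusp can be expressed by values and derivatives of \<open>g\<close> at 0.\<close>

definition modular_form :: "nat \<Rightarrow> (complex \<Rightarrow> complex) \<Rightarrow> (complex \<Rightarrow> complex) \<Rightarrow> bool" where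
  "modular_form k f g \<longleftrightarrow> f holomorphic_on \<H> \<and>
     (\<forall>\<gamma>\<in>SL2Z. \<forall>\<tau>\<in>\<H>. f (moebius \<gamma> \<tau>) = automorphy_factor \<gamma> \<tau> ^ k * f \<tau>) \<and>
     g holomorphic_on ball 0 1 \<and> (\<forall>\<tau>\<in>\<H>. f \<tau> = g (nome \<tau>))"

lemma modular_form_mult:
  "modular_form k f g \<Longrightarrow> modular_form l f' g' \<Longrightarrow>
     modular_form (k + l) (\<lambda>\<tau>. f \<tau> * f' \<tau>) (\<lambda>q. g q * g' q)"
  unfolding modular_form_def by (auto intro!: holomorphic_intros simp: power_add)

lemma modular_form_const: "modular_form 0 (\<lambda>_. c) (\<lambda>_. c)"
  unfolding modular_form_def by auto

lemma modular_form_cmult: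
  "modular_form k f g \<Longrightarrow> modular_form k (\<lambda>\<tau>. c * f \<tau>) (\<lambda>q. c * g q)"
  using modular_form_mult[OF modular_form_const] by fastforce

lemma modular_form_power:
  "modular_form k f g \<Longrightarrow> modular_form (k * n) (\<lambda>\<tau>. f \<tau> ^ n) (\<lambda>q. g q ^ n)"
  by (induction n) (auto intro: modular_form_mult modular_form_const)

lemma modular_form_diff:
  "modular_form k f g \<Longrightarrow> modular_form k f' g' \<Longrightarrow>
     modular_form k (\<lambda>\<tau>. f \<tau> - f' \<tau>) (\<lambda>q. g q - g' q)"
  unfolding modular_form_def by (auto intro!: holomorphic_intros simp: algebra_simps)

text \<open>The estimate near the cusp holds in the strip |Re tau| <= 1/2; periodicity extends it to
  all large heights, as \<open>q_expansion\<close> requires.\<close>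

lemma modular_form_eisenstein:
  assumes "2 \<le> m"
  obtains g where "modular_form (2 * m) (eisenstein (2 * m)) g" "g 0 = 1"
proof -
  let ?E = "eisenstein (2 * m)"
  have per: "?E (\<tau> + 1) = ?E \<tau>" if "\<tau> \<in> \<H>" for \<tau>
  proof -
    have T: "mat2 1 1 0 1 \<in> SL2Z" by (simp add: SL2Z_iff)
    show ?thesis
      using eisenstein_modular[OF T that, of "2 * m"] by (simp add: automorphy_factor_def moebius_def)
  qed
  obtain C where C: "\<And>\<tau>. 1 \<le> Im \<tau> \<Longrightarrow> \<bar>Re \<tau>\<bar> \<le> 1/2 \<Longrightarrow> cmod (?E \<tau> - 1) \<le> C / (Im \<tau>)\<^sup>2"
    using eisenstein_near_cusp[OF assms] by blast
  have bound: "cmod (?E \<tau> - 1) \<le> \<bar>C\<bar> / Im \<tau>" if "1 \<le> Im \<tau>" for \<tau>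
  proof -
    define n where "n = - round (Re \<tau>)"
    have "\<bar>Re (\<tau> + of_int n)\<bar> \<le> 1/2"
      using of_int_round_abs_le[of "Re \<tau>"] by (simp add: n_def abs_minus_commute)
    moreover have "?E (\<tau> + of_int n) = ?E \<tau>"
      by (rule periodic_int_shift[of ?E, OF per]) (use that in \<open>simp_all add: uhp_iff\<close>)
    ultimately have "cmod (?E \<tau> - 1) \<le> C / (Im \<tau>)\<^sup>2" using C[of "\<tau> + of_int n"] that by simp
    also have "\<dots> \<le> \<bar>C\<bar> / Im \<tau>"
      using that self_le_power[of "Im \<tau>" 2] by (intro frac_le) auto
    finally show ?thesis .
  qed
  have lim: "\<exists>Y. \<forall>\<tau>. Im \<tau> \<ge> Y \<longrightarrow> cmod (?E \<tau> - 1) < e" if "e > 0" for e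
  proof (intro exI allI impI)
    fix \<tau> assume Y: "max 1 (\<bar>C\<bar> / e + 1) \<le> Im \<tau>"
    then have "\<bar>C\<bar> / e < Im \<tau>" by simp
    then have "\<bar>C\<bar> < Im \<tau> * e" using that by (simp only: pos_divide_less_eq)
    then have "\<bar>C\<bar> / Im \<tau> < e" using Y by (simp add: pos_divide_less_eq mult.commute)
    then show "cmod (?E \<tau> - 1) < e" using bound[of \<tau>] Y by simp
  qed
  obtain g where "g holomorphic_on ball 0 1" "g 0 = 1" "\<And>\<tau>. \<tau> \<in> \<H> \<Longrightarrow> ?E \<tau> = g (nome \<tau>)"
    using q_expansion[OF eisenstein_holomorphic[OF assms] per lim] by blast
  then show ?thesis
    using that eisenstein_holomorphic[OF assms] eisenstein_modular by (auto simp: modular_form_def)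
qed

section \<open>Cusp forms of small weight\<close>

text \<open>Hecke's bound: \<open>|f|\<^sup>2 y\<^sup>k\<close> is invariant, so it attains its maximum at a point of height
  \<open>y\<^sub>0 \<ge> \<surd>3 / 2\<close>.  Comparing with the line of height \<open>k / (8 \<pi>)\<close>, where \<open>e\<^sup>-\<^sup>8\<^sup>\<pi>\<^sup>y y\<^sup>k\<close> is largest,
  contradicts the maximum principle for \<open>f / q\<^sup>2\<close>.\<close>

lemma modular_form_eq_0:
  assumes mf: "modular_form k f g" and k: "0 < k" "k \<le> 16"
    and g0: "g 0 = 0" "deriv g 0 = 0" and "\<tau> \<in> \<H>"
  shows "f \<tau> = 0"
proof (rule ccontr)
  assume nz: "f \<tau> \<noteq> 0"
  have hol: "f holomorphic_on \<H>" and ghol: "g holomorphic_on ball 0 1"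
    and inv: "\<And>\<gamma> \<tau>. \<gamma> \<in> SL2Z \<Longrightarrow> \<tau> \<in> \<H> \<Longrightarrow> f (moebius \<gamma> \<tau>) = automorphy_factor \<gamma> \<tau> ^ k * f \<tau>"
    and fg: "\<And>\<tau>. \<tau> \<in> \<H> \<Longrightarrow> f \<tau> = g (nome \<tau>)"
    using mf by (auto simp: modular_form_def)
  obtain h1 where h1: "h1 holomorphic_on ball 0 1" "h1 0 = deriv g 0" "\<And>q. g q = q * h1 q"
    using holomorphic_factor_zero[OF ghol g0(1)] by blast
  obtain h where h: "h holomorphic_on ball 0 1" "\<And>q. h1 q = q * h q"
    using holomorphic_factor_zero[OF h1(1)] h1(2) g0(2) by metis
  have fh: "f \<tau> = nome \<tau> ^ 2 * h (nome \<tau>)" if "\<tau> \<in> \<H>" for \<tau>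
    using fg[OF that] h1(3) h(2) by (simp add: power2_eq_square)
  define u where "u = (\<lambda>\<tau>. (cmod (f \<tau>))\<^sup>2 * Im \<tau> ^ k)"
  have u_inv: "u (moebius \<gamma> \<tau>) = u \<tau>" if "\<gamma> \<in> SL2Z" "\<tau> \<in> \<H>" for \<gamma> \<tau>
    using automorphy_nonzero[OF that]
    by (simp add: u_def inv[OF that] Im_moebius[OF that(1)] norm_mult norm_power power_mult_distrib
        power_divide flip: power_mult) (simp add: mult.commute)
  define D where "D = {\<tau>. \<bar>Re \<tau>\<bar> \<le> 1/2 \<and> 3/4 \<le> (Im \<tau>)\<^sup>2 \<and> 0 < Im \<tau>}"
  have toD: "\<exists>\<tau>'\<in>D. u \<tau>' = u \<tau>" if \<tau>: "\<tau> \<in> \<H>" for \<tau>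
  proof -
    obtain \<gamma> where \<gamma>: "\<gamma> \<in> SL2Z" "\<bar>Re (moebius \<gamma> \<tau>)\<bar> \<le> 1/2" "3/4 \<le> (Im (moebius \<gamma> \<tau>))\<^sup>2"
      using fundamental_domain[OF \<tau>] by blast
    moreover have "0 < Im (moebius \<gamma> \<tau>)" using moebius_uhp[OF \<gamma>(1) \<tau>] by (simp add: uhp_iff)
    ultimately have "moebius \<gamma> \<tau> \<in> D" by (simp add: D_def)
    then show ?thesis using u_inv[OF \<gamma>(1) \<tau>] by blast
  qed
  obtain \<tau>1 where \<tau>1: "\<tau>1 \<in> D" "u \<tau>1 = u \<tau>" using toD assms by blast
  have pos: "0 < u \<tau>1" using \<tau>1 nz assms by (simp add: u_def uhp_iff)
  \<comment> \<open>The bound \<open>B\<close> for \<open>h\<close> at heights at least 1 shows that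
    \<open>u\<close> tends to 0 at the cusp, uniformly in the real part.\<close>
  define r where "r = exp (- (2 * pi))"
  have r: "0 < r" "r < 1" by (simp_all add: r_def)
  have "compact (h ` cball 0 r)"
    by (intro compact_continuous_image holomorphic_on_imp_continuous_on holomorphic_on_subset[OF h(1)])
       (use r in auto)
  then obtain B where B: "\<And>q. q \<in> cball 0 r \<Longrightarrow> cmod (h q) \<le> B"
    by (meson compact_imp_bounded bounded_iff imageI)
  have u_le: "u \<tau> \<le> B\<^sup>2 * (Im \<tau> ^ k / exp (Im \<tau>))" if y: "1 \<le> Im \<tau>" for \<tau>
  proof -
    have \<tau>: "\<tau> \<in> \<H>" using y by (simp add: uhp_iff)
    have "nome \<tau> \<in> cball 0 r" using y by (simp add: norm_nome r_def)
    from B[OF this] have "(cmod (h (nome \<tau>)))\<^sup>2 \<le> B\<^sup>2" by (intro power_mono) auto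
    moreover have "(cmod (nome \<tau>)) ^ 4 \<le> exp (- Im \<tau>)"
    proof -
      have "(cmod (nome \<tau>)) ^ 4 = exp (- (8 * pi * Im \<tau>))"
        by (simp add: norm_nome flip: exp_of_nat_mult)
      also have "1 * Im \<tau> \<le> 8 * pi * Im \<tau>" using y pi_gt3 by (intro mult_right_mono) auto
      then have "exp (- (8 * pi * Im \<tau>)) \<le> exp (- Im \<tau>)" by simp
      finally show ?thesis .
    qed
    ultimately have "(cmod (nome \<tau>)) ^ 4 * (cmod (h (nome \<tau>)))\<^sup>2 * Im \<tau> ^ k
        \<le> exp (- Im \<tau>) * B\<^sup>2 * Im \<tau> ^ k"
      using y by (intro mult_mono) auto
    then show ?thesis
      by (simp add: u_def fh[OF \<tau>] norm_mult norm_power power_mult_distrib exp_minus field_simps)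
  qed
  have "((\<lambda>y. B\<^sup>2 * (y ^ k / exp y)) \<longlongrightarrow> B\<^sup>2 * 0) at_top"
    by (intro tendsto_intros tendsto_power_div_exp_0)
  then have "\<forall>\<^sub>F y in at_top. B\<^sup>2 * (y ^ k / exp y) < u \<tau>1"
    using pos by (intro order_tendstoD(2)) auto
  then obtain Y0 where Y0: "\<And>y. Y0 \<le> y \<Longrightarrow> B\<^sup>2 * (y ^ k / exp y) < u \<tau>1"
    by (auto simp: eventually_at_top_linorder)
  \<comment> \<open>Above height \<open>Y\<close> the value \<open>u \<tau>1\<close> is no longer
    reached, so a maximum on the compact part of \<open>D\<close> is a maximum on \<open>D\<close>
    and, by invariance, on the upper half-plane.\<close>
  define Y where "Y = max (max Y0 1) (Im \<tau>1)"
  let ?K = "D \<inter> {\<tau>. Im \<tau> \<le> Y}"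
  have D_half: "1/2 \<le> Im \<tau>" if "\<tau> \<in> D" for \<tau>
  proof (rule ccontr)
    assume "\<not> 1/2 \<le> Im \<tau>"
    then have "(Im \<tau>)\<^sup>2 < (1/2)\<^sup>2" using that by (intro power_strict_mono) (auto simp: D_def)
    then show False using that by (simp add: D_def power_divide)
  qed
  have "?K = {\<tau>. \<bar>Re \<tau>\<bar> \<le> 1/2} \<inter> {\<tau>. 3/4 \<le> (Im \<tau>)\<^sup>2} \<inter> {\<tau>. 1/2 \<le> Im \<tau>} \<inter> {\<tau>. Im \<tau> \<le> Y}"
    using D_half by (auto simp: D_def)
  moreover have "closed \<dots>"
    by (intro closed_Int closed_Collect_le continuous_intros)
  moreover have "bounded ?K"
  proof (rule boundedI)
    fix \<tau> assume "\<tau> \<in> ?K"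
    then have "\<bar>Re \<tau>\<bar> \<le> 1/2" "\<bar>Im \<tau>\<bar> \<le> Y" by (auto simp: D_def)
    then show "norm \<tau> \<le> 1/2 + Y" using cmod_le[of \<tau>] by linarith
  qed
  ultimately have "compact ?K" by (simp add: compact_eq_bounded_closed)
  moreover have "?K \<noteq> {}" using \<tau>1 by (auto simp: Y_def)
  moreover have "continuous_on ?K u"
    unfolding u_def
    by (intro continuous_intros holomorphic_on_imp_continuous_on holomorphic_on_subset[OF hol])
       (auto simp: D_def uhp_iff)
  ultimately obtain \<tau>0 where \<tau>0: "\<tau>0 \<in> ?K" and max: "\<And>\<tau>. \<tau> \<in> ?K \<Longrightarrow> u \<tau> \<le> u \<tau>0"
    using continuous_attains_sup[of ?K u] by blast
  have maxD: "u \<tau> \<le> u \<tau>0" if "\<tau> \<in> D" for \<tau>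
  proof (cases "Im \<tau> \<le> Y")
    case False
    then have "1 \<le> Im \<tau>" "Y0 \<le> Im \<tau>" by (auto simp: Y_def)
    then have "u \<tau> < u \<tau>1" using u_le[of \<tau>] Y0[of "Im \<tau>"] by linarith
    also have "\<dots> \<le> u \<tau>0" using max[of \<tau>1] \<tau>1(1) by (simp add: Y_def)
    finally show ?thesis by simp
  qed (use max that in auto)
  then have maxH: "u \<tau> \<le> u \<tau>0" if "\<tau> \<in> \<H>" for \<tau> using toD[OF that] by (metis maxD)
  have M: "0 < u \<tau>0" using maxD[OF \<tau>1(1)] pos by simp
  have H0: "\<tau>0 \<in> \<H>" using \<tau>0 by (simp add: D_def uhp_iff)
  define y where "y = Im \<tau>0"
  define c where "c = real k / (8 * pi)"
  have c0: "0 < c" using k by (simp add: c_def)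
  have cy: "c < y"
  proof (rule power_less_imp_less_base)
    \<comment> \<open>Here the bound 16 on the weight is used: with pi > 3 it gives \<open>c\<close>
      <= 2/3, below sqrt 3 / 2.\<close>
    have "c \<le> 16 / (8 * 3)"
      unfolding c_def using k pi_gt3 by (intro frac_le) auto
    then have "c\<^sup>2 \<le> (2/3)\<^sup>2" using c0 by (intro power_mono) auto
    also have "\<dots> < 3/4" by (simp add: power2_eq_square)
    also have "\<dots> \<le> y\<^sup>2" using \<tau>0 by (simp add: D_def y_def)
    finally show "c\<^sup>2 < y\<^sup>2" .
    show "0 \<le> y" using H0 by (simp add: y_def uhp_iff)
  qed
  have y0: "0 < y" using c0 cy by simp
  define s where "s = exp (- (2 * pi * c))"
  have s: "0 < s" "s < 1" using c0 by (simp_all add: s_def)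
  define N where "N = sqrt (u \<tau>0 / c ^ k) / s\<^sup>2"
  have "cmod (h (nome \<tau>0)) \<le> N"
  proof (rule maximum_modulus_frontier[of h "cball 0 s"])
    have sub: "cball 0 s \<subseteq> ball (0::complex) 1" using s by auto
    show "h holomorphic_on interior (cball 0 s)"
      using holomorphic_on_subset[OF h(1)] sub interior_subset by blast
    show "continuous_on (closure (cball 0 s)) h"
      using holomorphic_on_imp_continuous_on[OF holomorphic_on_subset[OF h(1) sub]] by simp
    show "nome \<tau>0 \<in> cball 0 s" using cy by (simp add: norm_nome s_def y_def)
    fix z assume "z \<in> frontier (cball (0::complex) s)"
    then have z: "cmod z = s" using s by (simp add: frontier_cball)
    then have "z \<in> ball 0 1" "z \<noteq> 0" using s by auto
    then obtain \<tau> where \<tau>: "\<tau> \<in> \<H>" "nome \<tau> = z" by (rule nome_surj)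
    have Im: "Im \<tau> = c" using z \<tau> by (intro nome_eq_norm_imp_Im) (simp add: s_def)
    have "(cmod (f \<tau>))\<^sup>2 * c ^ k \<le> u \<tau>0" using maxH[OF \<tau>(1)] by (simp add: u_def Im)
    then have "(cmod (f \<tau>))\<^sup>2 \<le> u \<tau>0 / c ^ k" using c0 by (simp add: field_simps)
    then have "cmod (f \<tau>) \<le> sqrt (u \<tau>0 / c ^ k)" using real_le_rsqrt by blast
    then have "s\<^sup>2 * cmod (h z) \<le> sqrt (u \<tau>0 / c ^ k)"
      by (simp add: fh[OF \<tau>(1)] \<tau>(2) norm_mult norm_power z)
    then show "cmod (h z) \<le> N" using s by (simp add: N_def field_simps)
  qed simp
  then have "(cmod (h (nome \<tau>0)))\<^sup>2 \<le> N\<^sup>2" by (intro power_mono) auto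
  also have "\<dots> = u \<tau>0 / (c ^ k * s ^ 4)"
    using M c0 by (simp add: N_def power_divide flip: power_mult)
  finally have 1: "(cmod (h (nome \<tau>0)))\<^sup>2 \<le> u \<tau>0 / (c ^ k * s ^ 4)" .
  define Q where "Q = cmod (nome \<tau>0)"
  have "u \<tau>0 = Q ^ 4 * (cmod (h (nome \<tau>0)))\<^sup>2 * y ^ k"
    by (simp add: u_def fh[OF H0] norm_mult norm_power power_mult_distrib Q_def y_def)
  also have "\<dots> \<le> Q ^ 4 * (u \<tau>0 / (c ^ k * s ^ 4)) * y ^ k"
    using 1 y0 by (intro mult_right_mono mult_left_mono) auto
  finally have "u \<tau>0 * (c ^ k * s ^ 4) \<le> u \<tau>0 * (Q ^ 4 * y ^ k)"
    using c0 s by (simp add: field_simps)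
  then have "c ^ k * s ^ 4 \<le> Q ^ 4 * y ^ k" using M by simp
  moreover have "s ^ 4 = exp (- real k)"
    by (simp add: s_def c_def flip: exp_of_nat_mult)
  moreover have "Q ^ 4 = exp (- (8 * pi * y))"
    by (simp add: Q_def norm_nome y_def flip: exp_of_nat_mult)
  moreover have "8 * pi * y = real k * (y / c)" using k by (simp add: c_def)
  moreover define A where "A = real k * (y / c)"
  ultimately have "c ^ k * exp (- real k) * exp A \<le> exp (- A) * y ^ k * exp A"
    by (intro mult_right_mono) auto
  also have "exp (- A) * y ^ k * exp A = y ^ k"
    by (simp add: exp_minus)
  finally have "c ^ k * exp (- real k) * exp A \<le> y ^ k" .
  moreover have "exp (real k * (y / c - 1)) = exp (- real k) * exp A"
    by (simp add: A_def right_diff_distrib flip: exp_add)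
  ultimately have le: "exp (real k * (y / c - 1)) \<le> (y / c) ^ k"
    using c0 by (simp add: power_divide field_simps)
  \<comment> \<open>With t = \<open>y / c\<close> > 1, \<open>le\<close> says exp(t - 1)^k <= t^k,
    whereas t < exp(t - 1) strictly.\<close>
  have "y / c = 1 + (y / c - 1)" by simp
  also have "\<dots> < exp (y / c - 1)"
  proof -
    have t: "0 < y / c - 1" using c0 cy by (simp add: field_simps)
    then have "1 + (y / c - 1) + (y / c - 1)\<^sup>2 / 2 \<le> exp (y / c - 1)"
      by (intro exp_lower_Taylor_quadratic) auto
    moreover have "0 < (y / c - 1)\<^sup>2" using t by (rule zero_less_power)
    ultimately show ?thesis by linarith
  qed
  finally have "(y / c) ^ k < exp (y / c - 1) ^ k"
    using k c0 y0 by (intro power_strict_mono) auto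
  then show False using le by (simp add: exp_of_nat_mult)
qed

section \<open>Rankin-Cohen brackets\<close>

text \<open>This is d/dtau in the coordinate q = exp(2 pi i tau).\<close>

definition theta :: "(complex \<Rightarrow> complex) \<Rightarrow> complex \<Rightarrow> complex" where
  "theta g = (\<lambda>q. 2 * of_real pi * \<i> * q * deriv g q)"

lemma theta_0 [simp]: "theta g 0 = 0"
  by (simp add: theta_def)

lemma theta_holomorphic: "g holomorphic_on ball 0 1 \<Longrightarrow> theta g holomorphic_on ball 0 1"
  unfolding theta_def by (intro holomorphic_intros) auto

lemma has_field_derivative_compose_nome:
  assumes "g holomorphic_on ball 0 1" "\<tau> \<in> \<H>"
  shows "((\<lambda>\<tau>. g (nome \<tau>)) has_field_derivative theta g (nome \<tau>)) (at \<tau>)"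
proof -
  have "(g has_field_derivative deriv g (nome \<tau>)) (at (nome \<tau>))"
    by (rule holomorphic_derivI[OF assms(1) open_ball nome_in_ball[OF assms(2)]])
  from DERIV_chain2[OF this has_field_derivative_nome] show ?thesis
    by (simp add: theta_def mult_ac)
qed

lemma deriv_compose_nome:
  assumes "g holomorphic_on ball 0 1" "\<And>\<tau>. \<tau> \<in> \<H> \<Longrightarrow> f \<tau> = g (nome \<tau>)" "\<tau> \<in> \<H>"
  shows "deriv f \<tau> = theta g (nome \<tau>)"
  by (rule DERIV_imp_deriv, rule has_field_derivative_transform_within_open[OF
        has_field_derivative_compose_nome[OF assms(1,3)] open_uhp assms(3)]) (simp add: assms(2))

lemma modular_form_holomorphic: "modular_form k f g \<Longrightarrow> f holomorphic_on \<H>"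
  by (simp add: modular_form_def)

lemma modular_form_transform:
  "modular_form k f g \<Longrightarrow> \<gamma> \<in> SL2Z \<Longrightarrow> \<tau> \<in> \<H> \<Longrightarrow> f (moebius \<gamma> \<tau>) = automorphy_factor \<gamma> \<tau> ^ k * f \<tau>"
  by (simp add: modular_form_def)

lemma modular_form_q_holomorphic: "modular_form k f g \<Longrightarrow> g holomorphic_on ball 0 1"
  by (simp add: modular_form_def)

lemma modular_form_q: "modular_form k f g \<Longrightarrow> \<tau> \<in> \<H> \<Longrightarrow> f \<tau> = g (nome \<tau>)"
  by (simp add: modular_form_def)

lemma modular_form_deriv_q: "modular_form k f g \<Longrightarrow> \<tau> \<in> \<H> \<Longrightarrow> deriv f \<tau> = theta g (nome \<tau>)"
  by (rule deriv_compose_nome[of g f]) (auto simp: modular_form_def)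

lemma modular_form_deriv2_q:
  "modular_form k f g \<Longrightarrow> \<tau> \<in> \<H> \<Longrightarrow> deriv (deriv f) \<tau> = theta (theta g) (nome \<tau>)"
  by (rule deriv_compose_nome[of "theta g" "deriv f"])
     (auto intro: theta_holomorphic modular_form_q_holomorphic modular_form_deriv_q)

lemma has_field_derivative_compose_moebius:
  assumes "f holomorphic_on \<H>" "\<gamma> \<in> SL2Z" "\<tau> \<in> \<H>"
  shows "((\<lambda>\<tau>. f (moebius \<gamma> \<tau>)) has_field_derivative
           deriv f (moebius \<gamma> \<tau>) / (automorphy_factor \<gamma> \<tau>)\<^sup>2) (at \<tau>)"
proof -
  have "(f has_field_derivative deriv f (moebius \<gamma> \<tau>)) (at (moebius \<gamma> \<tau>))"
    by (rule holomorphic_derivI[OF assms(1) open_uhp moebius_uhp[OF assms(2,3)]])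
  from DERIV_chain2[OF this has_field_derivative_moebius[OF assms(2,3)]] show ?thesis by simp
qed

text \<open>Differentiate f(gamma tau) = R(tau); the derivative of the Moebius map is J^-2.\<close>

lemma deriv_transform:
  assumes "f holomorphic_on \<H>" "\<gamma> \<in> SL2Z" "\<tau> \<in> \<H>"
    and "\<And>\<tau>. \<tau> \<in> \<H> \<Longrightarrow> f (moebius \<gamma> \<tau>) = R \<tau>"
    and "(R has_field_derivative R') (at \<tau>)"
  shows "deriv f (moebius \<gamma> \<tau>) = (automorphy_factor \<gamma> \<tau>)\<^sup>2 * R'"
proof -
  have "(R has_field_derivative deriv f (moebius \<gamma> \<tau>) / (automorphy_factor \<gamma> \<tau>)\<^sup>2) (at \<tau>)"
    by (rule has_field_derivative_transform_within_open[OF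
          has_field_derivative_compose_moebius[OF assms(1-3)] open_uhp assms(3) assms(4)])
  then have "deriv f (moebius \<gamma> \<tau>) / (automorphy_factor \<gamma> \<tau>)\<^sup>2 = R'"
    using assms(5) DERIV_unique by blast
  then show ?thesis using automorphy_nonzero[OF assms(2,3)] by (simp add: field_simps)
qed

lemma modular_form_deriv_transform:
  assumes mf: "modular_form k f g" and \<gamma>: "\<gamma> \<in> SL2Z" and \<tau>: "\<tau> \<in> \<H>"
  defines "J \<equiv> automorphy_factor \<gamma> \<tau>" and "c \<equiv> of_int (\<gamma>$2$1)"
  shows "deriv f (moebius \<gamma> \<tau>) = J ^ (k + 2) * deriv f \<tau> + of_nat k * c * J ^ (k + 1) * f \<tau>"
proof -
  let ?J = "automorphy_factor \<gamma>"
  have "((\<lambda>\<tau>. ?J \<tau> ^ k * f \<tau>) has_field_derivative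
      ?J \<tau> ^ k * deriv f \<tau> + of_nat k * (c * ?J \<tau> ^ (k - 1)) * f \<tau>) (at \<tau>)"
    using holomorphic_derivI[OF modular_form_holomorphic[OF mf] open_uhp \<tau>]
    unfolding c_def by (auto intro!: derivative_eq_intros simp: mult_ac)
  from deriv_transform[OF modular_form_holomorphic[OF mf] \<gamma> \<tau> modular_form_transform[OF mf \<gamma>] this]
  have "deriv f (moebius \<gamma> \<tau>) = J\<^sup>2 * (J ^ k * deriv f \<tau> + of_nat k * (c * J ^ (k - 1)) * f \<tau>)"
    by (simp add: J_def)
  then show ?thesis
    by (cases k) (simp_all add: algebra_simps power2_eq_square)
qed

lemma modular_form_deriv2_transform:
  assumes mf: "modular_form k f g" and \<gamma>: "\<gamma> \<in> SL2Z" and \<tau>: "\<tau> \<in> \<H>"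
  defines "J \<equiv> automorphy_factor \<gamma> \<tau>" and "c \<equiv> of_int (\<gamma>$2$1)"
  shows "deriv (deriv f) (moebius \<gamma> \<tau>) = J ^ (k + 4) * deriv (deriv f) \<tau>
     + (2 * of_nat k + 2) * c * J ^ (k + 3) * deriv f \<tau> + of_nat k * (of_nat k + 1) * c\<^sup>2 * J ^ (k + 2) * f \<tau>"
proof -
  let ?J = "automorphy_factor \<gamma>"
  have hol: "deriv f holomorphic_on \<H>"
    using holomorphic_deriv[OF modular_form_holomorphic[OF mf] open_uhp] .
  have f: "(f has_field_derivative deriv f \<tau>) (at \<tau>)"
    by (rule holomorphic_derivI[OF modular_form_holomorphic[OF mf] open_uhp \<tau>])
  have f': "(deriv f has_field_derivative deriv (deriv f) \<tau>) (at \<tau>)"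
    by (rule holomorphic_derivI[OF hol open_uhp \<tau>])
  have pow: "((\<lambda>\<tau>. ?J \<tau> ^ (n + 1)) has_field_derivative of_nat (n + 1) * (c * J ^ n)) (at \<tau>)" for n
    using DERIV_power[OF has_field_derivative_automorphy, where n = "n + 1"] by (simp add: c_def J_def)
  note R = DERIV_add[OF DERIV_mult[OF pow[of "k + 1"] f'] DERIV_mult[OF DERIV_cmult[OF pow[of k], of "of_nat k * c"] f]]
  have "deriv (deriv f) (moebius \<gamma> \<tau>) = J\<^sup>2 * (of_nat (k + 1 + 1) * (c * J ^ (k + 1)) * deriv f \<tau>
      + deriv (deriv f) \<tau> * ?J \<tau> ^ (k + 1 + 1) + (of_nat k * c * (of_nat (k + 1) * (c * J ^ k)) * f \<tau>
      + deriv f \<tau> * (of_nat k * c * ?J \<tau> ^ (k + 1))))"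
    unfolding J_def
    by (rule deriv_transform[OF hol \<gamma> \<tau> _ R[unfolded J_def]])
       (simp add: modular_form_deriv_transform[OF mf \<gamma>] c_def)
  moreover have "j\<^sup>2 * ((2 + K) * (x * (j * X)) * F1 + F2 * (j * (j * X))
      + (K * x * ((1 + K) * (x * X)) * F0 + F1 * (K * x * (j * X))))
      = X * j ^ 4 * F2 + (2 * K + 2) * x * (X * j ^ 3) * F1 + K * (K + 1) * x\<^sup>2 * (j * (j * X)) * F0"
    for K x X j F0 F1 F2 :: complex
    by algebra
  ultimately show ?thesis
    unfolding J_def[symmetric] by (simp add: power_add)
qed

text \<open>The derivatives contribute the nonmodular terms k l c J^(k + l + 1) f f' twice, with
  opposite signs. The result vanishes at the cusp because \<open>theta\<close> does.\<close>

lemma modular_form_bracket1: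
  assumes f: "modular_form k f g" and f': "modular_form l f' g'"
  shows "modular_form (k + l + 2)
     (\<lambda>\<tau>. of_nat k * f \<tau> * deriv f' \<tau> - of_nat l * deriv f \<tau> * f' \<tau>)
     (\<lambda>q. of_nat k * g q * theta g' q - of_nat l * theta g q * g' q)"
  unfolding modular_form_def
proof (intro conjI ballI)
  show "(\<lambda>\<tau>. of_nat k * f \<tau> * deriv f' \<tau> - of_nat l * deriv f \<tau> * f' \<tau>) holomorphic_on \<H>"
    by (intro holomorphic_intros modular_form_holomorphic[OF f] modular_form_holomorphic[OF f'] open_uhp)
  show "(\<lambda>q. of_nat k * g q * theta g' q - of_nat l * theta g q * g' q) holomorphic_on ball 0 1"
    by (intro holomorphic_intros theta_holomorphic modular_form_q_holomorphic[OF f]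
          modular_form_q_holomorphic[OF f'])
next
  fix \<gamma> \<tau> assume *: "\<gamma> \<in> SL2Z" "\<tau> \<in> \<H>"
  show "of_nat k * f (moebius \<gamma> \<tau>) * deriv f' (moebius \<gamma> \<tau>) - of_nat l * deriv f (moebius \<gamma> \<tau>) * f' (moebius \<gamma> \<tau>)
     = automorphy_factor \<gamma> \<tau> ^ (k + l + 2) * (of_nat k * f \<tau> * deriv f' \<tau> - of_nat l * deriv f \<tau> * f' \<tau>)"
    unfolding modular_form_transform[OF f *] modular_form_transform[OF f' *]
      modular_form_deriv_transform[OF f *] modular_form_deriv_transform[OF f' *]
    by (simp add: algebra_simps power_add power2_eq_square)
next
  fix \<tau> assume "\<tau> \<in> \<H>"
  then show "of_nat k * f \<tau> * deriv f' \<tau> - of_nat l * deriv f \<tau> * f' \<tau>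
     = of_nat k * g (nome \<tau>) * theta g' (nome \<tau>) - of_nat l * theta g (nome \<tau>) * g' (nome \<tau>)"
    by (simp add: modular_form_q[OF f] modular_form_q[OF f'] modular_form_deriv_q[OF f] modular_form_deriv_q[OF f'])
qed

text \<open>The second Rankin-Cohen bracket of \<open>f\<close> with itself, divided by k + 1. The
  coefficients k and k + 1 are what cancels the terms in c and c^2 of the transformation
  law.\<close>

definition bracket2 :: "nat \<Rightarrow> (complex \<Rightarrow> complex) \<Rightarrow> complex \<Rightarrow> complex" where
  "bracket2 k f \<tau> = of_nat k * f \<tau> * deriv (deriv f) \<tau> - of_nat (k + 1) * (deriv f \<tau>)\<^sup>2"

lemma modular_form_bracket2:
  assumes f: "modular_form k f g"
  shows "modular_form (2 * k + 4) (bracket2 k f)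
     (\<lambda>q. of_nat k * g q * theta (theta g) q - of_nat (k + 1) * (theta g q)\<^sup>2)"
  unfolding modular_form_def
proof (intro conjI ballI)
  show "bracket2 k f holomorphic_on \<H>"
    unfolding bracket2_def[abs_def]
    by (intro holomorphic_intros modular_form_holomorphic[OF f] open_uhp)
  show "(\<lambda>q. of_nat k * g q * theta (theta g) q - of_nat (k + 1) * (theta g q)\<^sup>2) holomorphic_on ball 0 1"
    by (intro holomorphic_intros theta_holomorphic modular_form_q_holomorphic[OF f])
next
  fix \<gamma> \<tau> assume *: "\<gamma> \<in> SL2Z" "\<tau> \<in> \<H>"
  define J where "J = automorphy_factor \<gamma> \<tau>"
  define X where "X = J ^ k"
  have J: "J ^ (k + n) = X * J ^ n" "J ^ (2 * k + n) = X * X * J ^ n" for n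
    by (simp_all add: X_def power_add mult_2)
  have "of_nat k * (X * F0) * (X * J ^ 4 * F2 + (2 * of_nat k + 2) * c * (X * J ^ 3) * F1
          + of_nat k * (of_nat k + 1) * c\<^sup>2 * (X * J\<^sup>2) * F0)
        - (of_nat k + 1) * (X * J\<^sup>2 * F1 + of_nat k * c * (X * J) * F0)\<^sup>2
      = X * X * J ^ 4 * (of_nat k * F0 * F2 - (of_nat k + 1) * F1\<^sup>2)" for F0 F1 F2 c :: complex
    by algebra
  then show "bracket2 k f (moebius \<gamma> \<tau>) = automorphy_factor \<gamma> \<tau> ^ (2 * k + 4) * bracket2 k f \<tau>"
    unfolding bracket2_def modular_form_transform[OF f *] modular_form_deriv_transform[OF f *]
      modular_form_deriv2_transform[OF f *] J_def[symmetric] J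
    by (simp add: X_def add.commute)
next
  fix \<tau> assume "\<tau> \<in> \<H>"
  then show "bracket2 k f \<tau> = of_nat k * g (nome \<tau>) * theta (theta g) (nome \<tau>) - of_nat (k + 1) * (theta g (nome \<tau>))\<^sup>2"
    by (simp add: bracket2_def modular_form_q[OF f] modular_form_deriv_q[OF f] modular_form_deriv2_q[OF f])
qed

section \<open>Orders of vanishing\<close>

text \<open>Compares vanishing orders without defining them: cancel (z - a)^m away from
  \<open>a\<close> and let z tend to \<open>a\<close>.\<close>

lemma order_less_imp_zero:
  fixes a :: complex
  assumes "0 < r" "m < n" "p holomorphic_on ball a r" "s holomorphic_on ball a r"
    and eq: "\<And>z. z \<in> ball a r \<Longrightarrow> (z - a) ^ m * p z = (z - a) ^ n * s z"
  shows "p a = 0"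
proof -
  have p: "p z = (z - a) ^ (n - m) * s z" if "z \<in> ball a r - {a}" for z
  proof -
    have "(z - a) ^ m * p z = (z - a) ^ m * ((z - a) ^ (n - m) * s z)"
      using eq[of z] that assms(2) by (simp flip: power_add mult.assoc)
    then show ?thesis using that by simp
  qed
  have "(p \<longlongrightarrow> p a) (at a)"
    using holomorphic_on_imp_continuous_on[OF assms(3)] assms(1)
    by (simp add: continuous_on_eq_continuous_at isCont_def)
  moreover have "((\<lambda>z. (z - a) ^ (n - m) * s z) \<longlongrightarrow> (a - a) ^ (n - m) * s a) (at a)"
    using holomorphic_on_imp_continuous_on[OF assms(4)] assms(1)
    by (intro tendsto_intros) (simp add: continuous_on_eq_continuous_at isCont_def)
  then have "(p \<longlongrightarrow> (a - a) ^ (n - m) * s a) (at a)"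
    by (rule Lim_transform_within_open[of _ _ _ _ "ball a r"]) (use assms(1) p in auto)
  ultimately have "p a = (a - a) ^ (n - m) * s a" using LIM_unique by blast
  then show ?thesis using assms(2) by simp
qed

text \<open>Applying (z - a) d/dz instead of d/dz keeps the power (z - a)^n and multiplies the
  leading coefficient by \<open>n\<close>, so no exponent n - 1 appears.\<close>

lemma deriv_factor:
  fixes a :: complex
  assumes "u holomorphic_on ball a r" and f: "\<And>z. z \<in> ball a r \<Longrightarrow> f z = (z - a) ^ n * u z"
  obtains v where "v holomorphic_on ball a r" "v a = of_nat n * u a"
    "\<And>z. z \<in> ball a r \<Longrightarrow> (z - a) * deriv f z = (z - a) ^ n * v z"
proof
  let ?v = "\<lambda>z. of_nat n * u z + (z - a) * deriv u z"
  show "?v holomorphic_on ball a r" by (intro holomorphic_intros assms) auto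
  show "?v a = of_nat n * u a" by simp
  fix z assume z: "z \<in> ball a r"
  have "((\<lambda>z. (z - a) ^ n * u z) has_field_derivative
      (z - a) ^ n * deriv u z + of_nat n * (z - a) ^ (n - 1) * u z) (at z)"
    by (auto intro!: derivative_eq_intros holomorphic_derivI[OF assms(1) open_ball z])
  then have "(f has_field_derivative
      (z - a) ^ n * deriv u z + of_nat n * (z - a) ^ (n - 1) * u z) (at z)"
    by (rule has_field_derivative_transform_within_open[OF _ open_ball z]) (use f in auto)
  then have "deriv f z = (z - a) ^ n * deriv u z + of_nat n * (z - a) ^ (n - 1) * u z"
    by (rule DERIV_imp_deriv)
  moreover have "(z - a) * (x * p + of_nat n * (z - a) ^ (n - 1) * y) = x * (of_nat n * y + (z - a) * p)"
    if "x = (z - a) ^ n" for x p y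
  proof (cases n)
    case (Suc m)
    define P where "P = (z - a) ^ m"
    have "(z - a) * ((z - a) * P * p + (1 + of_nat m) * P * y) = (z - a) * P * ((1 + of_nat m) * y + (z - a) * p)"
      by algebra
    then show ?thesis using that Suc by (simp add: P_def)
  qed (use that in simp)
  ultimately show "(z - a) * deriv f z = (z - a) ^ n * ?v z" by simp
qed

text \<open>The leading coefficient is (k n (n - 1) - (k + 1) n^2) u(a)^2 = -n (k + n) u(a)^2, which
  is not zero: the bracket has order exactly 2 n - 2. The factor (z - a)^2 avoids subtraction in the
  exponent.\<close>

lemma bracket2_factor:
  fixes a :: complex
  assumes f: "f holomorphic_on ball a r" and "0 < r" and u: "u holomorphic_on ball a r"
    and fu: "\<And>z. z \<in> ball a r \<Longrightarrow> f z = (z - a) ^ n * u z"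
    and "0 < n" "u a \<noteq> 0"
  obtains w where "w holomorphic_on ball a r" "w a \<noteq> 0"
    "\<And>z. z \<in> ball a r \<Longrightarrow> (z - a)\<^sup>2 * bracket2 k f z = (z - a) ^ (2 * n) * w z"
proof -
  obtain v where v: "v holomorphic_on ball a r" "v a = of_nat n * u a"
    "\<And>z. z \<in> ball a r \<Longrightarrow> (z - a) * deriv f z = (z - a) ^ n * v z"
    using deriv_factor[OF u fu] by blast
  obtain x where x: "x holomorphic_on ball a r" "x a = of_nat n * v a"
    "\<And>z. z \<in> ball a r \<Longrightarrow> (z - a) * deriv (\<lambda>z. (z - a) * deriv f z) z = (z - a) ^ n * x z"
    using deriv_factor[OF v(1) v(3)] by blast
  have f2: "(z - a)\<^sup>2 * deriv (deriv f) z = (z - a) ^ n * (x z - v z)" if z: "z \<in> ball a r" for z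
  proof -
    have "((\<lambda>z. (z - a) * deriv f z) has_field_derivative (z - a) * deriv (deriv f) z + deriv f z) (at z)"
      by (auto intro!: derivative_eq_intros holomorphic_derivI[OF holomorphic_deriv[OF f open_ball] open_ball z])
    then have "deriv (\<lambda>z. (z - a) * deriv f z) z = (z - a) * deriv (deriv f) z + deriv f z"
      by (rule DERIV_imp_deriv)
    note X = x(3)[OF z, unfolded this] and V = v(3)[OF z]
    have "(z - a)\<^sup>2 * deriv (deriv f) z = (z - a) * ((z - a) * deriv (deriv f) z + deriv f z) - (z - a) * deriv f z"
      by algebra
    then show ?thesis unfolding X V by (simp add: right_diff_distrib)
  qed
  let ?w = "\<lambda>z. of_nat k * u z * (x z - v z) - of_nat (k + 1) * (v z)\<^sup>2"
  show ?thesis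
  proof
    show "?w holomorphic_on ball a r" by (intro holomorphic_intros u v x)
    have "?w a = - (of_nat (n * (k + n)) * (u a)\<^sup>2)"
      by (simp add: x v algebra_simps power2_eq_square)
    also have "\<dots> \<noteq> 0" using assms by (simp del: of_nat_mult of_nat_add)
    finally show "?w a \<noteq> 0" .
    fix z assume z: "z \<in> ball a r"
    have "(z - a)\<^sup>2 * bracket2 k f z
       = of_nat k * f z * ((z - a)\<^sup>2 * deriv (deriv f) z) - of_nat (k + 1) * ((z - a) * deriv f z)\<^sup>2"
      unfolding bracket2_def power_mult_distrib by algebra
    also have "\<dots> = (z - a) ^ (2 * n) * ?w z"
      unfolding f2[OF z] v(3)[OF z] fu[OF z]
      by (simp add: power_mult_distrib power_mult mult.commute[of 2 n]) algebra
    finally show "(z - a)\<^sup>2 * bracket2 k f z = (z - a) ^ (2 * n) * ?w z" .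
  qed
qed

section \<open>The discriminant\<close>

abbreviation E4 :: "complex \<Rightarrow> complex" where "E4 \<equiv> eisenstein 4"
abbreviation E6 :: "complex \<Rightarrow> complex" where "E6 \<equiv> eisenstein 6"

definition e4 :: "complex \<Rightarrow> complex" where
  "e4 = (SOME g. modular_form 4 E4 g \<and> g 0 = 1)"

definition e6 :: "complex \<Rightarrow> complex" where
  "e6 = (SOME g. modular_form 6 E6 g \<and> g 0 = 1)"

lemma modular_form_E4: "modular_form 4 E4 e4" and e4_0 [simp]: "e4 0 = 1"
proof -
  have "\<exists>g. modular_form 4 E4 g \<and> g 0 = 1"
    using modular_form_eisenstein[of 2] by auto
  from someI_ex[OF this] show "modular_form 4 E4 e4" "e4 0 = 1" unfolding e4_def by blast+
qed

lemma modular_form_E6: "modular_form 6 E6 e6" and e6_0 [simp]: "e6 0 = 1"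
proof -
  have "\<exists>g. modular_form 6 E6 g \<and> g 0 = 1"
    using modular_form_eisenstein[of 3] by auto
  from someI_ex[OF this] show "modular_form 6 E6 e6" "e6 0 = 1" unfolding e6_def by blast+
qed

lemmas E4_holomorphic = modular_form_holomorphic[OF modular_form_E4]
lemmas E6_holomorphic = modular_form_holomorphic[OF modular_form_E6]
lemmas e4_holomorphic = modular_form_q_holomorphic[OF modular_form_E4]
lemmas e6_holomorphic = modular_form_q_holomorphic[OF modular_form_E6]

text \<open>This is 1728 times the usual discriminant q prod (1 - q^n)^24.\<close>

definition disc :: "complex \<Rightarrow> complex" where
  "disc \<tau> = E4 \<tau> ^ 3 - E6 \<tau> ^ 2"

lemma modular_form_disc: "modular_form 12 disc (\<lambda>q. e4 q ^ 3 - e6 q ^ 2)"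
proof -
  have "modular_form 12 (\<lambda>\<tau>. E4 \<tau> ^ 3) (\<lambda>q. e4 q ^ 3)" "modular_form 12 (\<lambda>\<tau>. E6 \<tau> ^ 2) (\<lambda>q. e6 q ^ 2)"
    using modular_form_power[OF modular_form_E4, of 3] modular_form_power[OF modular_form_E6, of 2] by simp_all
  from modular_form_diff[OF this] show ?thesis by (simp add: disc_def[abs_def])
qed

lemmas disc_holomorphic = modular_form_holomorphic[OF modular_form_disc]

definition disc_unit :: "complex \<Rightarrow> complex" where
  "disc_unit = (SOME u. u holomorphic_on ball 0 1 \<and> (\<forall>q. e4 q ^ 3 - e6 q ^ 2 = q * u q))"

lemma disc_unit_holomorphic: "disc_unit holomorphic_on ball 0 1"
  and disc_unit_eq: "e4 q ^ 3 - e6 q ^ 2 = q * disc_unit q"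
proof -
  have "(\<lambda>q. e4 q ^ 3 - e6 q ^ 2) holomorphic_on ball 0 1"
    using modular_form_disc by (rule modular_form_q_holomorphic)
  from holomorphic_factor_zero[OF this]
  obtain u where "u holomorphic_on ball 0 1" "\<And>q. e4 q ^ 3 - e6 q ^ 2 = q * u q"
    by (metis (no_types, lifting) diff_self e4_0 e6_0 power_one)
  then have "\<exists>u. u holomorphic_on ball 0 1 \<and> (\<forall>q. e4 q ^ 3 - e6 q ^ 2 = q * u q)"
    by blast
  then have "disc_unit holomorphic_on ball 0 1 \<and> (\<forall>q. e4 q ^ 3 - e6 q ^ 2 = q * disc_unit q)"
    unfolding disc_unit_def by (rule someI_ex)
  then show "disc_unit holomorphic_on ball 0 1" "e4 q ^ 3 - e6 q ^ 2 = q * disc_unit q"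
    by blast+
qed

lemma modular_form_disc': "modular_form 12 disc (\<lambda>q. q * disc_unit q)"
  using modular_form_disc by (simp add: disc_unit_eq)

lemma disc_eq: "\<tau> \<in> \<H> \<Longrightarrow> disc \<tau> = nome \<tau> * disc_unit (nome \<tau>)"
  by (rule modular_form_q[OF modular_form_disc'])

lemma deriv_times_id:
  assumes "u holomorphic_on ball 0 1"
  shows "deriv (\<lambda>q :: complex. q * u q) 0 = u 0"
proof -
  have "(u has_field_derivative deriv u 0) (at 0)"
    by (rule holomorphic_derivI[OF assms open_ball]) simp
  then have "((\<lambda>q :: complex. q * u q) has_field_derivative u 0) (at 0)"
    by (auto intro!: derivative_eq_intros)
  then show ?thesis by (rule DERIV_imp_deriv)
qed

lemma ii_in_uhp: "\<i> \<in> \<H>"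
  by (simp add: uhp_iff)

text \<open>Otherwise \<open>disc\<close> would vanish doubly at the cusp and hence identically by
  \<open>modular_form_eq_0\<close>, but its value at i is E4(i)^3.\<close>

lemma disc_unit_0: "disc_unit 0 \<noteq> 0"
proof
  assume "disc_unit 0 = 0"
  then have "disc \<i> = 0"
    using deriv_times_id[OF disc_unit_holomorphic]
    by (intro modular_form_eq_0[OF modular_form_disc']) (auto simp: ii_in_uhp)
  then show False by (simp add: disc_def eisenstein_6_ii eisenstein_4_ii_nonzero)
qed

text \<open>Choosing c to cancel the coefficients of q leaves a form with a double zero at the cusp,
  to which \<open>modular_form_eq_0\<close> applies.\<close>

lemma cusp_form_proportional:
  assumes f: "modular_form k f (\<lambda>q. q * a q)" and f': "modular_form k f' (\<lambda>q. q * b q)"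
    and hol: "a holomorphic_on ball 0 1" "b holomorphic_on ball 0 1"
    and "b 0 \<noteq> 0" "0 < k" "k \<le> 16"
  shows "\<exists>c. \<forall>\<tau>\<in>\<H>. f \<tau> = c * f' \<tau>"
proof (intro exI ballI)
  fix \<tau> assume "\<tau> \<in> \<H>"
  let ?c = "a 0 / b 0"
  let ?d = "\<lambda>q. a q - ?c * b q"
  have "?d holomorphic_on ball 0 1"
    by (intro holomorphic_intros hol)
  moreover have "modular_form k (\<lambda>\<tau>. f \<tau> - ?c * f' \<tau>) (\<lambda>q. q * ?d q)"
    using modular_form_diff[OF f modular_form_cmult[OF f', of ?c]] by (simp add: algebra_simps)
  moreover have "?d 0 = 0" using assms(5) by simp
  ultimately have "f \<tau> - ?c * f' \<tau> = 0"
    using deriv_times_id[of ?d] assms(6,7) \<open>\<tau> \<in> \<H>\<close>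
    by (intro modular_form_eq_0[where f = "\<lambda>\<tau>. f \<tau> - ?c * f' \<tau>" and g = "\<lambda>q. q * ?d q" and k = k]) simp_all
  then show "f \<tau> = ?c * f' \<tau>" by simp
qed

lemma weight_12_cusp_form:
  assumes "modular_form 12 f g" "g 0 = 0"
  shows "\<exists>c. \<forall>\<tau>\<in>\<H>. f \<tau> = c * disc \<tau>"
proof -
  obtain a where a: "a holomorphic_on ball 0 1" "\<And>q. g q = q * a q"
    using holomorphic_factor_zero[OF modular_form_q_holomorphic[OF assms(1)] assms(2)] by blast
  then have "modular_form 12 f (\<lambda>q. q * a q)" using assms(1) by (simp flip: a(2))
  from cusp_form_proportional[OF this modular_form_disc' a(1) disc_unit_holomorphic disc_unit_0]
  show ?thesis by simp
qed

lemma weight_16_cusp_form: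
  assumes "modular_form 16 f g" "g 0 = 0"
  shows "\<exists>c. \<forall>\<tau>\<in>\<H>. f \<tau> = c * (disc \<tau> * E4 \<tau>)"
proof -
  obtain a where a: "a holomorphic_on ball 0 1" "\<And>q. g q = q * a q"
    using holomorphic_factor_zero[OF modular_form_q_holomorphic[OF assms(1)] assms(2)] by blast
  then have 1: "modular_form 16 f (\<lambda>q. q * a q)" using assms(1) by (simp flip: a(2))
  have 2: "modular_form 16 (\<lambda>\<tau>. disc \<tau> * E4 \<tau>) (\<lambda>q. q * (disc_unit q * e4 q))"
    using modular_form_mult[OF modular_form_disc' modular_form_E4] by (simp add: mult.assoc)
  have 3: "(\<lambda>q. disc_unit q * e4 q) holomorphic_on ball 0 1"
    by (intro holomorphic_intros disc_unit_holomorphic e4_holomorphic)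
  from cusp_form_proportional[OF 1 2 a(1) 3] disc_unit_0 show ?thesis by simp
qed

lemma local_factor:
  assumes "f holomorphic_on \<H>" "a \<in> \<H>" "f a = 0" "b \<in> \<H>" "f b \<noteq> 0"
  obtains u r n where "0 < n" "0 < r" "ball a r \<subseteq> \<H>" "u holomorphic_on ball a r" "u a \<noteq> 0"
    "\<And>z. z \<in> ball a r \<Longrightarrow> f z = (z - a) ^ n * u z"
proof -
  have "\<not> f constant_on \<H>"
  proof
    assume "f constant_on \<H>"
    then obtain y where "\<forall>x\<in>\<H>. f x = y" unfolding constant_on_def by blast
    then have "f a = y" "f b = y" using assms(2,4) by blast+
    then show False using assms(3,5) by simp
  qed
  from holomorphic_factor_zero_nonconstant[OF assms(1) open_uhp connected_uhp assms(2,3) this]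
  obtain g r n where "0 < n" "0 < r" "ball a r \<subseteq> \<H>" "g holomorphic_on ball a r"
    "\<And>w. w \<in> ball a r \<Longrightarrow> f w = (w - a) ^ n * g w" "\<And>w. w \<in> ball a r \<Longrightarrow> g w \<noteq> 0"
    by metis
  moreover from this(2,6) have "g a \<noteq> 0" by simp
  ultimately show ?thesis by (intro that)
qed

lemma E6_not_identically_zero: "\<exists>\<tau>\<in>\<H>. E6 \<tau> \<noteq> 0"
proof (rule ccontr)
  assume "\<not> (\<exists>\<tau>\<in>\<H>. E6 \<tau> \<noteq> 0)"
  then have zero: "E6 \<tau> = 0" if "\<tau> \<in> \<H>" for \<tau> using that by blast
  have zero': "e6 q = 0" if "q \<in> ball 0 1" "q \<noteq> 0" for q
  proof -
    obtain \<tau> where "\<tau> \<in> \<H>" "nome \<tau> = q" using \<open>q \<in> ball 0 1\<close> \<open>q \<noteq> 0\<close> by (rule nome_surj)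
    then show ?thesis using zero modular_form_q[OF modular_form_E6, of \<tau>] by simp
  qed
  have "(e6 \<longlongrightarrow> 0) (at 0)"
    by (rule Lim_transform_within_open[of "\<lambda>_. 0" _ _ _ "ball 0 1"]) (use zero' in auto)
  moreover have "isCont e6 0"
    using holomorphic_on_imp_continuous_on[OF e6_holomorphic]
    by (simp add: continuous_on_eq_continuous_at)
  then have "(e6 \<longlongrightarrow> e6 0) (at 0)" by (simp only: isCont_def)
  ultimately have "e6 0 = 0" using LIM_unique by blast
  then show False by simp
qed

text \<open>The brackets \<open>[E\<^sub>4, E\<^sub>4]\<^sub>2\<close> and \<open>[E\<^sub>6, E\<^sub>6]\<^sub>2\<close> are multiples of \<open>\<Delta>\<close> and \<open>\<Delta> E\<^sub>4\<close>.  At a common zero,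
  where \<open>E\<^sub>4\<close>, \<open>E\<^sub>6\<close> have orders \<open>m\<close>, \<open>n\<close>, these brackets have the exact orders \<open>2 m - 2\<close> and
  \<open>2 n - 2\<close>; so \<open>2 n = 3 m\<close>, and \<open>\<Delta> = E\<^sub>4\<^sup>3 - E\<^sub>6\<^sup>2\<close> would vanish to an order \<open>> 2 m - 2\<close>.\<close>

lemma E4_E6_no_common_zero:
  assumes a: "a \<in> \<H>" and z4: "E4 a = 0" and z6: "E6 a = 0"
  shows False
proof -
  have 12: "modular_form 12 (bracket2 4 E4)
      (\<lambda>q. of_nat 4 * e4 q * theta (theta e4) q - of_nat (4 + 1) * (theta e4 q)\<^sup>2)"
    using modular_form_bracket2[OF modular_form_E4] by simp
  obtain c where c: "\<And>\<tau>. \<tau> \<in> \<H> \<Longrightarrow> bracket2 4 E4 \<tau> = c * disc \<tau>"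
    using weight_12_cusp_form[OF 12] by auto
  have 16: "modular_form 16 (bracket2 6 E6)
      (\<lambda>q. of_nat 6 * e6 q * theta (theta e6) q - of_nat (6 + 1) * (theta e6 q)\<^sup>2)"
    using modular_form_bracket2[OF modular_form_E6] by simp
  obtain d where d: "\<And>\<tau>. \<tau> \<in> \<H> \<Longrightarrow> bracket2 6 E6 \<tau> = d * (disc \<tau> * E4 \<tau>)"
    using weight_16_cusp_form[OF 16] by auto
  obtain u r1 m where u: "0 < m" "0 < r1" "ball a r1 \<subseteq> \<H>" "u holomorphic_on ball a r1" "u a \<noteq> 0"
    "\<And>z. z \<in> ball a r1 \<Longrightarrow> E4 z = (z - a) ^ m * u z"
    using local_factor[OF E4_holomorphic a z4 ii_in_uhp eisenstein_4_ii_nonzero] by metis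
  obtain b where "b \<in> \<H>" "E6 b \<noteq> 0" using E6_not_identically_zero by blast
  from local_factor[OF E6_holomorphic a z6 this]
  obtain v r2 n where v: "0 < n" "0 < r2" "ball a r2 \<subseteq> \<H>" "v holomorphic_on ball a r2" "v a \<noteq> 0"
    "\<And>z. z \<in> ball a r2 \<Longrightarrow> E6 z = (z - a) ^ n * v z"
    by metis
  define r where "r = min r1 r2"
  have r: "0 < r" "ball a r \<subseteq> ball a r1" "ball a r \<subseteq> ball a r2" using u v by (auto simp: r_def)
  have rH: "z \<in> \<H>" if "z \<in> ball a r" for z using that r u by blast
  note hol = holomorphic_on_subset[OF u(4) r(2)] holomorphic_on_subset[OF v(4) r(3)]
  have h4: "E4 holomorphic_on ball a r" and h6: "E6 holomorphic_on ball a r"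
    using holomorphic_on_subset[OF E4_holomorphic] holomorphic_on_subset[OF E6_holomorphic] rH by blast+
  have fac: "E4 z = (z - a) ^ m * u z" "E6 z = (z - a) ^ n * v z" if "z \<in> ball a r" for z
    using that r u v by blast+
  obtain w1 where w1: "w1 holomorphic_on ball a r" "w1 a \<noteq> 0"
    "\<And>z. z \<in> ball a r \<Longrightarrow> (z - a)\<^sup>2 * bracket2 4 E4 z = (z - a) ^ (2 * m) * w1 z"
    using bracket2_factor[OF h4 r(1) hol(1) fac(1) u(1,5), of 4] by metis
  obtain w2 where w2: "w2 holomorphic_on ball a r" "w2 a \<noteq> 0"
    "\<And>z. z \<in> ball a r \<Longrightarrow> (z - a)\<^sup>2 * bracket2 6 E6 z = (z - a) ^ (2 * n) * w2 z"
    using bracket2_factor[OF h6 r(1) hol(2) fac(2) v(1,5), of 6] by metis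
  have eq1: "(z - a) ^ (2 * m) * w1 z = c * ((z - a)\<^sup>2 * disc z)" if "z \<in> ball a r" for z
    using w1(3)[OF that] c[OF rH[OF that]] by (simp add: mult_ac)
  have eq2: "(z - a) ^ (2 * n) * w2 z = d * ((z - a)\<^sup>2 * disc z) * ((z - a) ^ m * u z)" if "z \<in> ball a r" for z
    using w2(3)[OF that] d[OF rH[OF that]] fac(1)[OF that] by (simp add: mult_ac)
  have "c \<noteq> 0"
  proof
    assume "c = 0"
    then have "w1 a = 0"
      using eq1 by (intro order_less_imp_zero[OF r(1), of "2 * m" "2 * m + 1" w1 a "\<lambda>_. 0"] w1) auto
    then show False using w1 by simp
  qed
  have "d \<noteq> 0"
  proof
    assume "d = 0"
    then have "w2 a = 0"
      using eq2 by (intro order_less_imp_zero[OF r(1), of "2 * n" "2 * n + 1" w2 a "\<lambda>_. 0"] w2) auto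
    then show False using w2 by simp
  qed
  let ?p = "\<lambda>z. d * u z * w1 z" and ?s = "\<lambda>z. c * w2 z"
  \<comment> \<open>Combining \<open>eq1\<close> and \<open>eq2\<close> eliminates
    \<open>disc\<close>, whose order at \<open>a\<close> is not known at this point.\<close>
  have eq: "(z - a) ^ (3 * m) * ?p z = (z - a) ^ (2 * n) * ?s z" if z: "z \<in> ball a r" for z
  proof -
    have "(z - a) ^ (3 * m) * ?p z = d * ((z - a) ^ m * u z) * ((z - a) ^ (2 * m) * w1 z)"
      by (simp add: mult_ac flip: power_add)
    also have "\<dots> = c * ((z - a) ^ (2 * n) * w2 z)"
      unfolding eq1[OF z] eq2[OF z] by (simp add: mult_ac)
    finally show ?thesis by (simp add: mult_ac)
  qed
  have hol': "?p holomorphic_on ball a r" "?s holomorphic_on ball a r"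
    by (intro holomorphic_intros hol w1 w2)+
  have ps: "?p a \<noteq> 0" "?s a \<noteq> 0" using \<open>c \<noteq> 0\<close> \<open>d \<noteq> 0\<close> u w1 w2 by auto
  have "3 * m = 2 * n"
    using order_less_imp_zero[OF r(1) _ hol'] order_less_imp_zero[OF r(1) _ hol'(2,1)] eq ps
    by (metis linorder_neqE_nat)
  have "(z - a) ^ (2 * m) * w1 z = (z - a) ^ (3 * m + 2) * (c * (u z ^ 3 - v z ^ 2))"
    if z: "z \<in> ball a r" for z
  proof -
    have "disc z = (z - a) ^ (3 * m) * u z ^ 3 - (z - a) ^ (2 * n) * v z ^ 2"
      unfolding disc_def fac[OF z] by (simp add: power_mult_distrib mult.commute flip: power_mult)
    then have "disc z = (z - a) ^ (3 * m) * (u z ^ 3 - v z ^ 2)"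
      unfolding \<open>3 * m = 2 * n\<close> by (simp add: right_diff_distrib)
    then show ?thesis
      unfolding eq1[OF z] by (simp add: power_add power2_eq_square mult_ac)
  qed
  then have "w1 a = 0"
    by (intro order_less_imp_zero[OF r(1), of "2 * m" "3 * m + 2" w1 a "\<lambda>z. c * (u z ^ 3 - v z ^ 2)"] w1)
       (auto intro!: holomorphic_intros hol)
  then show False using w1 by simp
qed

text \<open>Since [E6, E4]_1 is a constant multiple of \<open>disc\<close>, both \<open>E6\<close>
  and \<open>E4\<close> times the derivative of \<open>disc\<close> are holomorphic multiples of
  \<open>disc\<close>. At a zero of \<open>disc\<close> its derivative has smaller order, so
  \<open>E6\<close> and \<open>E4\<close> would both vanish there.\<close>

lemma disc_nonzero:
  assumes a: "a \<in> \<H>"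
  shows "disc a \<noteq> 0"
proof
  assume 0: "disc a = 0"
  have 12: "modular_form 12 (\<lambda>\<tau>. 6 * E6 \<tau> * deriv E4 \<tau> - 4 * deriv E6 \<tau> * E4 \<tau>)
      (\<lambda>q. of_nat 6 * e6 q * theta e4 q - of_nat 4 * theta e6 q * e4 q)"
    using modular_form_bracket1[OF modular_form_E6 modular_form_E4] by simp
  obtain c where c: "\<And>\<tau>. \<tau> \<in> \<H> \<Longrightarrow> 6 * E6 \<tau> * deriv E4 \<tau> - 4 * deriv E6 \<tau> * E4 \<tau> = c * disc \<tau>"
    using weight_12_cusp_form[OF 12] by auto
  have d4: "deriv E4 holomorphic_on \<H>" and d6: "deriv E6 holomorphic_on \<H>"
    by (intro holomorphic_deriv E4_holomorphic E6_holomorphic open_uhp)+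
  have disc': "deriv disc z = 3 * E4 z ^ 2 * deriv E4 z - 2 * E6 z * deriv E6 z" if z: "z \<in> \<H>" for z
  proof -
    have "(disc has_field_derivative 3 * E4 z ^ 2 * deriv E4 z - 2 * E6 z * deriv E6 z) (at z)"
      unfolding disc_def[abs_def]
      by (auto intro!: derivative_eq_intros holomorphic_derivI[OF E4_holomorphic open_uhp z]
          holomorphic_derivI[OF E6_holomorphic open_uhp z])
    then show ?thesis by (rule DERIV_imp_deriv)
  qed
  have eq6: "E6 z * deriv disc z = (2 * deriv E6 z + c / 2 * E4 z ^ 2) * disc z"
    and eq4: "E4 z * deriv disc z = (3 * deriv E4 z + c / 2 * E6 z) * disc z" if z: "z \<in> \<H>" for z
  proof -
    have c': "c / 2 * disc z = 3 * E6 z * deriv E4 z - 2 * deriv E6 z * E4 z"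
      using c[OF z] by (simp add: field_simps)
    have "(2 * deriv E6 z + c / 2 * E4 z ^ 2) * disc z = 2 * deriv E6 z * disc z + E4 z ^ 2 * (c / 2 * disc z)"
      by (simp add: ring_distribs)
    also have "\<dots> = E6 z * deriv disc z"
      unfolding c' disc'[OF z] unfolding disc_def by algebra
    finally show "E6 z * deriv disc z = (2 * deriv E6 z + c / 2 * E4 z ^ 2) * disc z" ..
    have "(3 * deriv E4 z + c / 2 * E6 z) * disc z = 3 * deriv E4 z * disc z + E6 z * (c / 2 * disc z)"
      by (simp add: ring_distribs)
    also have "\<dots> = E4 z * deriv disc z"
      unfolding c' disc'[OF z] unfolding disc_def by algebra
    finally show "E4 z * deriv disc z = (3 * deriv E4 z + c / 2 * E6 z) * disc z" ..
  qed
  have "disc \<i> \<noteq> 0" by (simp add: disc_def eisenstein_6_ii eisenstein_4_ii_nonzero)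
  from local_factor[OF disc_holomorphic a 0 ii_in_uhp this]
  obtain g r n where g: "0 < n" "0 < r" "ball a r \<subseteq> \<H>" "g holomorphic_on ball a r" "g a \<noteq> 0"
    "\<And>z. z \<in> ball a r \<Longrightarrow> disc z = (z - a) ^ n * g z"
    by metis
  obtain v where v: "v holomorphic_on ball a r" "v a = of_nat n * g a"
    "\<And>z. z \<in> ball a r \<Longrightarrow> (z - a) * deriv disc z = (z - a) ^ n * v z"
    using deriv_factor[OF g(4,6)] by metis
  have key: "A a = 0" if A: "A holomorphic_on \<H>" and B: "B holomorphic_on \<H>"
    and AB: "\<And>z. z \<in> \<H> \<Longrightarrow> A z * deriv disc z = B z * disc z" for A B
  proof -
    have "(\<lambda>z. A z * v z) a = 0"
    proof (rule order_less_imp_zero[OF g(2), of n "n + 1" _ a "\<lambda>z. B z * g z"])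
      show "(\<lambda>z. A z * v z) holomorphic_on ball a r" "(\<lambda>z. B z * g z) holomorphic_on ball a r"
        by (intro holomorphic_intros v g holomorphic_on_subset[OF A] holomorphic_on_subset[OF B])+
      fix z assume z: "z \<in> ball a r"
      have "(z - a) ^ n * (A z * v z) = A z * ((z - a) * deriv disc z)"
        unfolding v(3)[OF z] by (simp add: mult_ac)
      also have "\<dots> = (z - a) * (B z * disc z)"
        using AB[of z] g(3) z by (simp add: mult.left_commute subset_iff)
      also have "\<dots> = (z - a) ^ (n + 1) * (B z * g z)"
        unfolding g(6)[OF z] by (simp add: mult_ac)
      finally show "(z - a) ^ n * (A z * v z) = (z - a) ^ (n + 1) * (B z * g z)" .
    qed simp
    then show ?thesis using v(2) g by simp
  qed
  have "E6 a = 0"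
    by (rule key[OF E6_holomorphic _ eq6])
       (intro holomorphic_intros d6 E4_holomorphic)
  moreover have "E4 a = 0"
    by (rule key[OF E4_holomorphic _ eq4])
       (intro holomorphic_intros d4 E6_holomorphic)
  ultimately show False using E4_E6_no_common_zero a by blast
qed

lemma disc_unit_nonzero:
  assumes "q \<in> ball 0 1"
  shows "disc_unit q \<noteq> 0"
proof (cases "q = 0")
  case False
  with assms obtain \<tau> where "\<tau> \<in> \<H>" "nome \<tau> = q" by (rule nome_surj)
  then show ?thesis using disc_nonzero[of \<tau>] disc_eq[of \<tau>] by auto
qed (simp add: disc_unit_0)

section \<open>The matrix exponential\<close>

abbreviation matpow :: "complex^'n^'n \<Rightarrow> nat \<Rightarrow> complex^'n^'n" where
  "matpow A m \<equiv> ((**) A ^^ m) (mat 1)"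

lemma matrix_mult_component: "(A ** B) $ i $ j = (\<Sum>k\<in>UNIV. A $ i $ k * B $ k $ j)"
  by (simp add: matrix_matrix_mult_def)

lemma matpow_Suc_component:
  "matpow A (Suc m) $ i $ j = (\<Sum>k\<in>UNIV. A $ i $ k * matpow A m $ k $ j)"
  by (simp add: matrix_mult_component)

lemma mat_times_component:
  fixes A :: "complex^'n^'m"
  shows "(mat t ** A) $ i $ j = t * A $ i $ j"
  by (simp add: matrix_matrix_mult_def mat_def if_distrib if_distribR cong: if_cong)

lemma matpow_scaled_component:
  "matpow (mat t ** A) m $ i $ j = t ^ m * matpow A m $ i $ j"
proof (induction m arbitrary: i)
  case (Suc m)
  show ?case
    unfolding matpow_Suc_component Suc mat_times_component
    by (simp add: sum_distrib_left mult_ac)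
qed simp

lemma norm_matpow_component_le:
  "norm (matpow A m $ i $ j) \<le> (1 + (\<Sum>i\<in>UNIV. \<Sum>k\<in>UNIV. norm (A $ i $ k))) ^ m" (is "_ \<le> ?B ^ m")
proof (induction m arbitrary: i)
  case 0
  show ?case by (simp add: mat_def)
next
  case (Suc m)
  have row: "(\<Sum>k\<in>UNIV. norm (A $ i $ k)) \<le> (\<Sum>i\<in>UNIV. \<Sum>k\<in>UNIV. norm (A $ i $ k))"
    by (rule member_le_sum[where f = "\<lambda>i. \<Sum>k\<in>UNIV. norm (A $ i $ k)"]) (auto intro: sum_nonneg)
  have "norm (matpow A (Suc m) $ i $ j) = norm (\<Sum>k\<in>UNIV. A $ i $ k * matpow A m $ k $ j)"
    by (simp only: matpow_Suc_component)
  also have "\<dots> \<le> (\<Sum>k\<in>UNIV. norm (A $ i $ k) * ?B ^ m)"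
    by (intro order_trans[OF norm_sum] sum_mono) (auto simp: norm_mult intro!: mult_left_mono Suc)
  also have "\<dots> = (\<Sum>k\<in>UNIV. norm (A $ i $ k)) * ?B ^ m" by (simp add: sum_distrib_right)
  also have "\<dots> \<le> ?B * ?B ^ m"
    using row by (intro mult_right_mono zero_le_power) (auto intro!: add_nonneg_nonneg sum_nonneg)
  finally show ?case by simp
qed

lemma summable_matpow_component: "summable (\<lambda>m. matpow A m $ i $ j / fact m * t ^ m)"
proof (rule summable_comparison_test[OF _ summable_exp])
  define B where "B = 1 + (\<Sum>i\<in>UNIV. \<Sum>k\<in>UNIV. norm (A $ i $ k))"
  have "norm (matpow A m $ i $ j) \<le> B ^ m" for m
    unfolding B_def by (rule norm_matpow_component_le)
  then have "norm (matpow A m $ i $ j) * (norm t ^ m / fact m) \<le> B ^ m * (norm t ^ m / fact m)" for m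
    by (intro mult_right_mono) auto
  then have "norm (matpow A m $ i $ j / fact m * t ^ m) \<le> inverse (fact m) * (B * norm t) ^ m" for m
    by (simp add: norm_mult norm_divide norm_power power_mult_distrib field_simps)
  then show "\<exists>N. \<forall>n\<ge>N. norm (matpow A n $ i $ j / fact n * t ^ n) \<le> inverse (fact n) * (B * norm t) ^ n"
    by blast
qed

lemma sums_vecI:
  fixes X :: "nat \<Rightarrow> 'a::real_normed_vector^'n"
  assumes "\<And>i. (\<lambda>m. X m $ i) sums (s $ i)"
  shows "X sums s"
  unfolding sums_def by (rule vec_tendstoI) (use assms in \<open>simp add: sums_def\<close>)

lemma sums_vec_nth: "X sums s \<Longrightarrow> (\<lambda>m. X m $ i) sums (s $ i)"
  for X :: "nat \<Rightarrow> 'a::real_normed_vector^'n"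
  unfolding sums_def by (drule tendsto_vec_nth[of _ _ _ i]) simp

text \<open>Each entry becomes a scalar power series in \<open>t\<close>, which can be
  differentiated termwise.\<close>

lemma mat_exp_component:
  "mat_exp (mat t ** A) $ i $ j = (\<Sum>m. matpow A m $ i $ j / fact m * t ^ m)"
proof -
  have "(\<lambda>m. (1 / fact m) *\<^sub>R matpow (mat t ** A) m) sums
      (\<chi> i j. \<Sum>m. matpow A m $ i $ j / fact m * t ^ m)"
  proof (intro sums_vecI)
    fix i j
    have "(\<lambda>m. matpow A m $ i $ j / fact m * t ^ m) sums (\<Sum>m. matpow A m $ i $ j / fact m * t ^ m)"
      by (rule summable_sums[OF summable_matpow_component])
    then show "(\<lambda>m. ((1 / fact m) *\<^sub>R matpow (mat t ** A) m) $ i $ j) sums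
       (\<chi> i j. \<Sum>m. matpow A m $ i $ j / fact m * t ^ m) $ i $ j"
      by (simp add: matpow_scaled_component scaleR_conv_of_real[where ?'a = complex] mult_ac)
  qed
  then show ?thesis unfolding mat_exp_def by (simp add: sums_iff)
qed

lemma has_field_derivative_mat_exp:
  "((\<lambda>t. mat_exp (mat t ** A) $ i $ j) has_field_derivative (A ** mat_exp (mat t ** A)) $ i $ j) (at t)"
proof -
  let ?c = "\<lambda>i m. matpow A m $ i $ j / fact m"
  have "((\<lambda>t. \<Sum>m. ?c i m * t ^ m) has_field_derivative (\<Sum>m. diffs (?c i) m * t ^ m)) (at t)"
    by (rule termdiffs_strong_converges_everywhere[OF summable_matpow_component])
  moreover have "(\<Sum>m. diffs (?c i) m * t ^ m) = (A ** mat_exp (mat t ** A)) $ i $ j"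
  proof -
    have "diffs (?c i) m * t ^ m = (\<Sum>k\<in>UNIV. A $ i $ k * (?c k m * t ^ m))" for m
    proof -
      have "diffs (?c i) m = matpow A (Suc m) $ i $ j / fact m"
        by (simp add: diffs_def divide_simps del: funpow.simps of_nat_Suc)
      also have "\<dots> = (\<Sum>k\<in>UNIV. A $ i $ k * ?c k m)"
        by (simp only: matpow_Suc_component sum_divide_distrib times_divide_eq_right)
      finally show ?thesis by (simp add: sum_distrib_right mult.assoc)
    qed
    moreover have "(\<lambda>m. \<Sum>k\<in>UNIV. A $ i $ k * (?c k m * t ^ m)) sums (\<Sum>k\<in>UNIV. A $ i $ k * mat_exp (mat t ** A) $ k $ j)"
      unfolding mat_exp_component
      by (intro sums_sum sums_mult summable_sums summable_matpow_component)
    ultimately show ?thesis by (simp add: sums_iff matrix_matrix_mult_def)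
  qed
  ultimately show ?thesis unfolding mat_exp_component by simp
qed

definition exponent_factor :: "complex^'n^'n \<Rightarrow> complex \<Rightarrow> complex^'n^'n" where
  "exponent_factor L z = mat_exp (mat (- (2 * of_real pi * \<i> * z)) ** L)"

lemma has_field_derivative_exponent_factor:
  "((\<lambda>z. exponent_factor L z $ i $ j) has_field_derivative
      - (2 * of_real pi * \<i>) * (L ** exponent_factor L z) $ i $ j) (at z)"
proof -
  have "((\<lambda>z. - (2 * of_real pi * \<i> * z)) has_field_derivative - (2 * of_real pi * \<i>)) (at z)"
    by (auto intro!: derivative_eq_intros)
  from DERIV_chain2[OF has_field_derivative_mat_exp this] show ?thesis
    unfolding exponent_factor_def by (simp add: mult.commute)
qed

section \<open>Vector-valued modular forms\<close>

definition vec_holomorphic :: "(complex \<Rightarrow> complex^'n) \<Rightarrow> complex set \<Rightarrow> bool" where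
  "vec_holomorphic F S \<longleftrightarrow> (\<forall>i. (\<lambda>z. F z $ i) holomorphic_on S)"

definition transforms :: "(int^2^2 \<Rightarrow> complex^'n^'n) \<Rightarrow> int \<Rightarrow> (complex \<Rightarrow> complex^'n) \<Rightarrow> bool" where
  "transforms \<rho> k F \<longleftrightarrow> (\<forall>\<gamma>\<in>SL2Z. \<forall>z\<in>\<H>.
     F (moebius \<gamma> z) = (automorphy_factor \<gamma> z powi k) *s (\<rho> \<gamma> *v F z))"

definition has_q_expansion :: "complex^'n^'n \<Rightarrow> (complex \<Rightarrow> complex^'n) \<Rightarrow> (complex \<Rightarrow> complex^'n) \<Rightarrow> bool" where
  "has_q_expansion L F h \<longleftrightarrow> vec_holomorphic h (ball 0 1) \<and>
     (\<forall>z\<in>\<H>. exponent_factor L z *v F z = h (nome z))"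

text \<open>Replaces q-series by holomorphic functions on the unit disc. Convergence of the series
  at every point of the upper half-plane covers the punctured disc by surjectivity of
  \<open>nome\<close>; the converse is the Taylor expansion at 0.\<close>

lemma vvmf_weight_iff:
  "F \<in> vvmf_weight \<rho> L k \<longleftrightarrow> vec_holomorphic F \<H> \<and> transforms \<rho> k F \<and> (\<exists>h. has_q_expansion L F h)"
proof -
  have "(\<exists>a. \<forall>z\<in>\<H>. (\<lambda>m. (nome z ^ m) *s a m) sums (exponent_factor L z *v F z)) \<longleftrightarrow>
     (\<exists>h. has_q_expansion L F h)"
  proof
    assume "\<exists>a. \<forall>z\<in>\<H>. (\<lambda>m. (nome z ^ m) *s a m) sums (exponent_factor L z *v F z)"
    then obtain a where a: "\<And>z. z \<in> \<H> \<Longrightarrow> (\<lambda>m. (nome z ^ m) *s a m) sums (exponent_factor L z *v F z)"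
      by blast
    then have comp: "(\<lambda>m. a m $ i * nome z ^ m) sums (exponent_factor L z *v F z) $ i" if "z \<in> \<H>" for z i
      using sums_vec_nth[OF a[OF that], of i] by (simp add: mult.commute)
    define h where "h = (\<lambda>q. \<chi> i. \<Sum>m. a m $ i * q ^ m)"
    have summ: "summable (\<lambda>m. a m $ i * q ^ m)" if q: "q \<in> ball 0 1" for q i
    proof (cases "q = 0")
      case False
      with q obtain z where "z \<in> \<H>" "nome z = q" by (rule nome_surj)
      then show ?thesis using comp[of z i] by (auto simp: summable_def)
    qed simp
    have "(\<lambda>q. h q $ i) holomorphic_on ball 0 1" for i
    proof (rule power_series_holomorphic)
      fix q :: complex assume "q \<in> ball 0 1"
      from summable_sums[OF summ[OF this, of i]]
      show "(\<lambda>m. a m $ i * (q - 0) ^ m) sums (h q $ i)" by (simp add: h_def)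
    qed
    moreover have "exponent_factor L z *v F z = h (nome z)" if "z \<in> \<H>" for z
      using comp[OF that] by (simp add: vec_eq_iff h_def sums_iff)
    ultimately show "\<exists>h. has_q_expansion L F h"
      by (auto simp: has_q_expansion_def vec_holomorphic_def)
  next
    assume "\<exists>h. has_q_expansion L F h"
    then obtain h where h: "\<And>i. (\<lambda>q. h q $ i) holomorphic_on ball 0 1"
      "\<And>z. z \<in> \<H> \<Longrightarrow> exponent_factor L z *v F z = h (nome z)"
      by (auto simp: has_q_expansion_def vec_holomorphic_def)
    define a where "a = (\<lambda>m. \<chi> i. (deriv ^^ m) (\<lambda>q. h q $ i) 0 / fact m)"
    have "(\<lambda>m. (nome z ^ m) *s a m) sums (exponent_factor L z *v F z)" if "z \<in> \<H>" for z
    proof (rule sums_vecI)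
      fix i
      show "(\<lambda>m. (nome z ^ m *s a m) $ i) sums (exponent_factor L z *v F z) $ i"
        using holomorphic_power_series[OF h(1) nome_in_ball[OF that], of i]
        by (simp add: h(2)[OF that] a_def mult.commute)
    qed
    then show "\<exists>a. \<forall>z\<in>\<H>. (\<lambda>m. (nome z ^ m) *s a m) sums (exponent_factor L z *v F z)" by blast
  qed
  then show ?thesis
    unfolding vvmf_weight_def vec_holomorphic_def transforms_def exponent_factor_def nome_def
    by simp
qed

lemma matrix_vector_mult_smult: "A *v (c *s x) = c *s (A *v x)" for A :: "complex^'n^'m"
  by (simp add: vec_eq_iff matrix_vector_mult_def sum_distrib_left mult_ac)

lemma matrix_vector_mult_sum: "A *v (\<Sum>i\<in>I. f i) = (\<Sum>i\<in>I. A *v f i)" for A :: "complex^'n^'m"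
  by (induction I rule: infinite_finite_induct) (auto simp: matrix_vector_right_distrib)

lemma vector_smult_sum: "c *s (\<Sum>i\<in>I. f i) = (\<Sum>i\<in>I. c *s f i)" for f :: "'a \<Rightarrow> complex^'n"
  by (simp add: vec_eq_iff sum_distrib_left)

lemma vec_holomorphic_smult:
  "f holomorphic_on S \<Longrightarrow> vec_holomorphic F S \<Longrightarrow> vec_holomorphic (\<lambda>z. f z *s F z) S"
  by (auto simp: vec_holomorphic_def intro!: holomorphic_intros)

lemma vec_holomorphic_sum:
  "(\<And>i. i \<in> I \<Longrightarrow> vec_holomorphic (F i) S) \<Longrightarrow> vec_holomorphic (\<lambda>z. \<Sum>i\<in>I. F i z) S"
  by (auto simp: vec_holomorphic_def intro!: holomorphic_intros)

lemma transforms_smult: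
  assumes "\<And>\<gamma> z. \<gamma> \<in> SL2Z \<Longrightarrow> z \<in> \<H> \<Longrightarrow> f (moebius \<gamma> z) = automorphy_factor \<gamma> z powi n * f z"
    and "transforms \<rho> k F"
  shows "transforms \<rho> (k + n) (\<lambda>z. f z *s F z)"
  using assms automorphy_nonzero unfolding transforms_def
  by (auto simp: power_int_add matrix_vector_mult_smult vector_smult_assoc mult_ac)

lemma transforms_sum:
  "(\<And>i. i \<in> I \<Longrightarrow> transforms \<rho> k (F i)) \<Longrightarrow> transforms \<rho> k (\<lambda>z. \<Sum>i\<in>I. F i z)"
  by (simp add: transforms_def matrix_vector_mult_sum vector_smult_sum)

lemma has_q_expansion_smult:
  assumes "g holomorphic_on ball 0 1" "\<And>z. z \<in> \<H> \<Longrightarrow> f z = g (nome z)" "has_q_expansion L F h"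
  shows "has_q_expansion L (\<lambda>z. f z *s F z) (\<lambda>q. g q *s h q)"
  using assms by (auto simp: has_q_expansion_def matrix_vector_mult_smult intro: vec_holomorphic_smult)

lemma has_q_expansion_sum:
  "(\<And>i. i \<in> I \<Longrightarrow> has_q_expansion L (F i) (h i)) \<Longrightarrow>
     has_q_expansion L (\<lambda>z. \<Sum>i\<in>I. F i z) (\<lambda>q. \<Sum>i\<in>I. h i q)"
  by (auto simp: has_q_expansion_def matrix_vector_mult_sum intro: vec_holomorphic_sum)

lemma vvmf_weight_smult_modular_form:
  assumes "modular_form n f g" "F \<in> vvmf_weight \<rho> L k"
  shows "(\<lambda>z. f z *s F z) \<in> vvmf_weight \<rho> L (k + int n)"
proof -
  obtain h where "has_q_expansion L F h" using assms(2) by (auto simp: vvmf_weight_iff)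
  then have "has_q_expansion L (\<lambda>z. f z *s F z) (\<lambda>q. g q *s h q)"
    using assms(1) by (intro has_q_expansion_smult) (auto simp: modular_form_def)
  moreover have "transforms \<rho> (k + int n) (\<lambda>z. f z *s F z)"
    using assms by (intro transforms_smult) (auto simp: modular_form_def vvmf_weight_iff)
  ultimately show ?thesis
    using assms by (auto simp: vvmf_weight_iff modular_form_def intro: vec_holomorphic_smult)
qed

lemma vvmf_weight_sum:
  assumes "\<And>i. i \<in> I \<Longrightarrow> F i \<in> vvmf_weight \<rho> L k"
  shows "(\<lambda>z. \<Sum>i\<in>I. F i z) \<in> vvmf_weight \<rho> L k"
proof -
  have "\<forall>i\<in>I. \<exists>h. has_q_expansion L (F i) h" using assms by (auto simp: vvmf_weight_iff)
  then obtain h where "\<And>i. i \<in> I \<Longrightarrow> has_q_expansion L (F i) (h i)" by metis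
  then have "has_q_expansion L (\<lambda>z. \<Sum>i\<in>I. F i z) (\<lambda>q. \<Sum>i\<in>I. h i q)"
    by (rule has_q_expansion_sum)
  then show ?thesis
    using assms by (auto simp: vvmf_weight_iff intro: vec_holomorphic_sum transforms_sum)
qed

lemma vvmf_weight_smult: "F \<in> vvmf_weight \<rho> L k \<Longrightarrow> (\<lambda>z. c *s F z) \<in> vvmf_weight \<rho> L k"
  using vvmf_weight_smult_modular_form[OF modular_form_const[of c]] by simp

lemma vvmf_weight_in_vvmf: "F \<in> vvmf_weight \<rho> L k \<Longrightarrow> F \<in> vvmf \<rho> L"
  unfolding vvmf_def by (intro CollectI exI[of _ "{k}"] exI[of _ "\<lambda>_. F"]) simp

text \<open>\<open>disc\<close> has no zero in the upper half-plane, and its simple zero at the cusp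
  is absorbed by \<open>h 0 = 0\<close>.\<close>

lemma vvmf_weight_divide_disc:
  assumes F: "F \<in> vvmf_weight \<rho> L k" and h: "has_q_expansion L F h" "h 0 = 0"
  shows "(\<lambda>z. inverse (disc z) *s F z) \<in> vvmf_weight \<rho> L (k - 12)"
  unfolding vvmf_weight_iff
proof (intro conjI)
  show "vec_holomorphic (\<lambda>z. inverse (disc z) *s F z) \<H>"
    using F disc_nonzero by (intro vec_holomorphic_smult holomorphic_intros disc_holomorphic)
       (auto simp: vvmf_weight_iff)
  have "transforms \<rho> (k + (- 12)) (\<lambda>z. inverse (disc z) *s F z)"
    using F by (intro transforms_smult)
      (auto simp: vvmf_weight_iff modular_form_transform[OF modular_form_disc] power_int_minus
         inverse_mult_distrib power_inverse)
  then show "transforms \<rho> (k - 12) (\<lambda>z. inverse (disc z) *s F z)" by simp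
  have "\<forall>i. \<exists>m. m holomorphic_on ball 0 1 \<and> (\<forall>q. h q $ i = q * m q)"
  proof
    fix i
    have "(\<lambda>q. h q $ i) holomorphic_on ball 0 1" "h 0 $ i = 0"
      using h by (auto simp: has_q_expansion_def vec_holomorphic_def)
    then show "\<exists>m. m holomorphic_on ball 0 1 \<and> (\<forall>q. h q $ i = q * m q)"
      using holomorphic_factor_zero[of "\<lambda>q. h q $ i"] by metis
  qed
  then obtain m where m: "\<And>i. m i holomorphic_on ball 0 1" "\<And>i q. h q $ i = q * m i q" by metis
  have "has_q_expansion L (\<lambda>z. inverse (disc z) *s F z) (\<lambda>q. \<chi> i. m i q / disc_unit q)"
    unfolding has_q_expansion_def
  proof (intro conjI ballI)
    show "vec_holomorphic (\<lambda>q. \<chi> i. m i q / disc_unit q) (ball 0 1)"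
      unfolding vec_holomorphic_def using disc_unit_nonzero
      by (auto intro!: holomorphic_intros m disc_unit_holomorphic)
    fix z assume z: "z \<in> \<H>"
    have "exponent_factor L z *v F z = h (nome z)" using h z by (auto simp: has_q_expansion_def)
    then show "exponent_factor L z *v (inverse (disc z) *s F z) = (\<chi> i. m i (nome z) / disc_unit (nome z))"
      by (simp add: matrix_vector_mult_smult vec_eq_iff m(2) disc_eq[OF z] field_simps)
  qed
  then show "\<exists>h. has_q_expansion L (\<lambda>z. inverse (disc z) *s F z) h" by blast
qed

subsection \<open>The modular derivative\<close>

text \<open>Equals 2 pi i times the quasimodular Eisenstein series of weight 2, here obtained
  without summing a conditionally convergent series.\<close>

definition disc_logderiv :: "complex \<Rightarrow> complex" where
  "disc_logderiv z = deriv disc z / disc z"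

definition disc_logderiv_q :: "complex \<Rightarrow> complex" where
  "disc_logderiv_q q = 2 * of_real pi * \<i> * (1 + q * deriv disc_unit q / disc_unit q)"

lemma disc_logderiv_holomorphic: "disc_logderiv holomorphic_on \<H>"
  unfolding disc_logderiv_def[abs_def] using disc_nonzero
  by (intro holomorphic_intros disc_holomorphic open_uhp) auto

lemma disc_logderiv_q_holomorphic: "disc_logderiv_q holomorphic_on ball 0 1"
  unfolding disc_logderiv_q_def[abs_def] using disc_unit_nonzero
  by (intro holomorphic_intros disc_unit_holomorphic) auto

lemma disc_logderiv_q_0: "disc_logderiv_q 0 = 2 * of_real pi * \<i>"
  by (simp add: disc_logderiv_q_def)

lemma disc_logderiv_eq:
  assumes "z \<in> \<H>"
  shows "disc_logderiv z = disc_logderiv_q (nome z)"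
proof -
  let ?q = "nome z"
  have "(disc_unit has_field_derivative deriv disc_unit ?q) (at ?q)"
    by (rule holomorphic_derivI[OF disc_unit_holomorphic open_ball nome_in_ball[OF assms]])
  then have "((\<lambda>q. q * disc_unit q) has_field_derivative disc_unit ?q + ?q * deriv disc_unit ?q) (at ?q)"
    by (auto intro!: derivative_eq_intros)
  then have "theta (\<lambda>q. q * disc_unit q) ?q = 2 * of_real pi * \<i> * ?q * (disc_unit ?q + ?q * deriv disc_unit ?q)"
    unfolding theta_def by (simp add: DERIV_imp_deriv)
  then show ?thesis
    using disc_unit_nonzero[OF nome_in_ball[OF assms]]
    by (simp add: disc_logderiv_def disc_logderiv_q_def disc_eq[OF assms]
        modular_form_deriv_q[OF modular_form_disc' assms] field_simps)
qed

lemma disc_logderiv_transform: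
  assumes "\<gamma> \<in> SL2Z" "z \<in> \<H>"
  shows "disc_logderiv (moebius \<gamma> z) = (automorphy_factor \<gamma> z)\<^sup>2 * disc_logderiv z
     + 12 * of_int (\<gamma>$2$1) * automorphy_factor \<gamma> z"
  unfolding disc_logderiv_def modular_form_transform[OF modular_form_disc assms]
    modular_form_deriv_transform[OF modular_form_disc assms]
  using automorphy_nonzero[OF assms] disc_nonzero[OF assms(2)]
  by (simp add: field_simps power_numeral_reduce)

text \<open>2 pi i times the Serre derivative, taken componentwise.\<close>

definition modular_deriv :: "int \<Rightarrow> (complex \<Rightarrow> complex^'n) \<Rightarrow> complex \<Rightarrow> complex^'n" where
  "modular_deriv k F z = (\<chi> i. deriv (\<lambda>z. F z $ i) z - of_int k / 12 * disc_logderiv z * F z $ i)"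

lemma vec_holomorphic_modular_deriv:
  "vec_holomorphic F \<H> \<Longrightarrow> vec_holomorphic (modular_deriv k F) \<H>"
  unfolding vec_holomorphic_def modular_deriv_def
  by (auto intro!: holomorphic_intros disc_logderiv_holomorphic open_uhp)

text \<open>Differentiating J^k produces the extra term k c J^(k + 1) rho(gamma) F; the term 12 c J
  in the law of \<open>disc_logderiv\<close>, multiplied by k / 12, removes it. As rho(gamma) is
  constant, it commutes with the derivative.\<close>

lemma transforms_modular_deriv:
  assumes hol: "vec_holomorphic F \<H>" and tr: "transforms \<rho> k F"
  shows "transforms \<rho> (k + 2) (modular_deriv k F)"
  unfolding transforms_def
proof (intro ballI)
  fix \<gamma> z assume \<gamma>: "\<gamma> \<in> SL2Z" and z: "z \<in> \<H>"
  let ?J = "automorphy_factor \<gamma>"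
  define J where "J = ?J z"
  define c where "c = (of_int (\<gamma>$2$1) :: complex)"
  have J0: "J \<noteq> 0" unfolding J_def by (rule automorphy_nonzero[OF \<gamma> z])
  have holi: "(\<lambda>z. F z $ i) holomorphic_on \<H>" for i using hol by (simp add: vec_holomorphic_def)
  have F: "F (moebius \<gamma> z) = (?J z powi k) *s (\<rho> \<gamma> *v F z)" if "z \<in> \<H>" for z
    using tr \<gamma> that by (simp add: transforms_def)
  show "modular_deriv k F (moebius \<gamma> z) = (?J z powi (k + 2)) *s (\<rho> \<gamma> *v modular_deriv k F z)"
  proof (subst vec_eq_iff, rule allI)
    fix i
    let ?s = "\<lambda>z. \<Sum>j\<in>UNIV. \<rho> \<gamma> $ i $ j * F z $ j"
    let ?s' = "\<Sum>j\<in>UNIV. \<rho> \<gamma> $ i $ j * deriv (\<lambda>z. F z $ j) z"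
    have comp: "F (moebius \<gamma> z) $ i = ?J z powi k * ?s z" if "z \<in> \<H>" for z
      unfolding F[OF that] by (simp add: matrix_vector_mult_def)
    have "((\<lambda>z. ?J z powi k) has_field_derivative of_int k * J powi (k - 1) * c) (at z)"
      unfolding J_def c_def
      by (rule DERIV_power_int[OF has_field_derivative_automorphy]) (use J0 J_def in simp)
    moreover have "(?s has_field_derivative ?s') (at z)"
      by (intro DERIV_sum DERIV_cmult holomorphic_derivI[OF holi open_uhp z])
    ultimately have "((\<lambda>z. ?J z powi k * ?s z) has_field_derivative
        of_int k * J powi (k - 1) * c * ?s z + ?s' * J powi k) (at z)"
      unfolding J_def by (rule DERIV_mult)
    from deriv_transform[OF holi \<gamma> z comp this]
    have d: "deriv (\<lambda>z. F z $ i) (moebius \<gamma> z)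
       = J\<^sup>2 * (of_int k * J powi (k - 1) * c * ?s z + ?s' * J powi k)"
      by (simp add: J_def)
    have p: "J\<^sup>2 * J powi (k - 1) = J * J powi k" "J powi (k + 2) = J\<^sup>2 * J powi k"
      using J0 by (simp_all add: power_int_diff power_int_add power2_eq_square)
    have "modular_deriv k F (moebius \<gamma> z) $ i
       = of_int k * (J\<^sup>2 * J powi (k - 1)) * c * ?s z + J\<^sup>2 * J powi k * ?s'
         - of_int k / 12 * (J\<^sup>2 * disc_logderiv z + 12 * c * J) * (J powi k * ?s z)"
      unfolding modular_deriv_def vec_lambda_beta d comp[OF z] disc_logderiv_transform[OF \<gamma> z]
        J_def[symmetric] c_def[symmetric]
      by (simp add: algebra_simps)
    also have "\<dots> = J\<^sup>2 * J powi k * (?s' - of_int k / 12 * disc_logderiv z * ?s z)"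
      unfolding p(1) by (simp add: field_simps)
    also have "?s' - of_int k / 12 * disc_logderiv z * ?s z = (\<rho> \<gamma> *v modular_deriv k F z) $ i"
      unfolding matrix_vector_mult_def modular_deriv_def
      by (simp add: sum_subtractf sum_distrib_left algebra_simps)
    finally show "modular_deriv k F (moebius \<gamma> z) $ i
       = ((?J z powi (k + 2)) *s (\<rho> \<gamma> *v modular_deriv k F z)) $ i"
      by (simp add: p(2) flip: J_def)
  qed
qed

text \<open>By the product rule exp(-2 pi i L z) F' = h' + 2 pi i L h. This is how L enters: at q =
  0 the expression reduces to 2 pi i (L - k / 12) h(0).\<close>

lemma has_q_expansion_modular_deriv:
  assumes hol: "vec_holomorphic F \<H>" and h: "has_q_expansion L F h"
  shows "has_q_expansion L (modular_deriv k F)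
     (\<lambda>q. \<chi> i. theta (\<lambda>q. h q $ i) q + 2 * of_real pi * \<i> * (L *v h q) $ i
        - of_int k / 12 * disc_logderiv_q q * h q $ i)"
  unfolding has_q_expansion_def
proof (intro conjI ballI)
  have hi: "(\<lambda>q. h q $ i) holomorphic_on ball 0 1" for i
    using h by (simp add: has_q_expansion_def vec_holomorphic_def)
  have Fi: "(\<lambda>z. F z $ i) holomorphic_on \<H>" for i using hol by (simp add: vec_holomorphic_def)
  show "vec_holomorphic (\<lambda>q. \<chi> i. theta (\<lambda>q. h q $ i) q + 2 * of_real pi * \<i> * (L *v h q) $ i
        - of_int k / 12 * disc_logderiv_q q * h q $ i) (ball 0 1)"
    unfolding vec_holomorphic_def matrix_vector_mult_def
    by (auto intro!: holomorphic_intros theta_holomorphic hi disc_logderiv_q_holomorphic)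
  fix z assume z: "z \<in> \<H>"
  let ?E = "exponent_factor L"
  let ?F' = "\<chi> i. deriv (\<lambda>z. F z $ i) z"
  have EF: "?E z *v F z = h (nome z)" if "z \<in> \<H>" for z
    using h that by (simp add: has_q_expansion_def)
  have E': "(?E z *v ?F') $ i = theta (\<lambda>q. h q $ i) (nome z) + 2 * of_real pi * \<i> * (L *v h (nome z)) $ i" for i
  proof -
    have "((\<lambda>z. \<Sum>j\<in>UNIV. ?E z $ i $ j * F z $ j) has_field_derivative
       (\<Sum>j\<in>UNIV. - (2 * of_real pi * \<i>) * (L ** ?E z) $ i $ j * F z $ j
          + deriv (\<lambda>z. F z $ j) z * ?E z $ i $ j)) (at z)"
      by (intro DERIV_sum DERIV_mult has_field_derivative_exponent_factor
            holomorphic_derivI[OF Fi open_uhp z])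
    then have "((\<lambda>z. h (nome z) $ i) has_field_derivative
       (\<Sum>j\<in>UNIV. - (2 * of_real pi * \<i>) * (L ** ?E z) $ i $ j * F z $ j
          + deriv (\<lambda>z. F z $ j) z * ?E z $ i $ j)) (at z)"
      by (rule has_field_derivative_transform_within_open[OF _ open_uhp z])
         (simp add: matrix_vector_mult_def flip: EF)
    from DERIV_unique[OF this has_field_derivative_compose_nome[OF hi z]]
    have "theta (\<lambda>q. h q $ i) (nome z)
       = - (2 * of_real pi * \<i>) * ((L ** ?E z) *v F z) $ i + (?E z *v ?F') $ i"
      by (simp add: matrix_vector_mult_def sum_subtractf sum_negf sum_distrib_left mult_ac)
    moreover have "(L ** ?E z) *v F z = L *v h (nome z)"
      by (simp add: EF[OF z] flip: matrix_vector_mul_assoc)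
    ultimately show ?thesis by simp
  qed
  have "modular_deriv k F z = ?F' - (of_int k / 12 * disc_logderiv z) *s F z"
    by (simp add: modular_deriv_def vec_eq_iff)
  then have "?E z *v modular_deriv k F z
     = ?E z *v ?F' - (of_int k / 12 * disc_logderiv z) *s h (nome z)"
    by (simp add: matrix_vector_mult_diff_distrib matrix_vector_mult_smult EF[OF z])
  then show "?E z *v modular_deriv k F z = (\<chi> i. theta (\<lambda>q. h q $ i) (nome z)
       + 2 * of_real pi * \<i> * (L *v h (nome z)) $ i
        - of_int k / 12 * disc_logderiv_q (nome z) * h (nome z) $ i)"
    by (simp add: vec_eq_iff E' disc_logderiv_eq[OF z])
qed

lemma modular_deriv_in_vvmf_weight:
  assumes "F \<in> vvmf_weight \<rho> L k"
  shows "modular_deriv k F \<in> vvmf_weight \<rho> L (k + 2)"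
  using assms vec_holomorphic_modular_deriv transforms_modular_deriv has_q_expansion_modular_deriv
  unfolding vvmf_weight_iff by blast

lemma modular_deriv_sum:
  assumes "\<And>i. i \<in> I \<Longrightarrow> vec_holomorphic (F i) \<H>" "z \<in> \<H>"
  shows "modular_deriv k (\<lambda>z. \<Sum>i\<in>I. c i *s F i z) z = (\<Sum>i\<in>I. c i *s modular_deriv k (F i) z)"
proof (subst vec_eq_iff, rule allI)
  fix j
  have "((\<lambda>z. \<Sum>i\<in>I. c i * F i z $ j) has_field_derivative (\<Sum>i\<in>I. c i * deriv (\<lambda>z. F i z $ j) z)) (at z)"
    using assms by (intro DERIV_sum DERIV_cmult holomorphic_derivI[OF _ open_uhp])
      (auto simp: vec_holomorphic_def)
  then have "deriv (\<lambda>z. \<Sum>i\<in>I. c i * F i z $ j) z = (\<Sum>i\<in>I. c i * deriv (\<lambda>z. F i z $ j) z)"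
    by (rule DERIV_imp_deriv)
  then show "modular_deriv k (\<lambda>z. \<Sum>i\<in>I. c i *s F i z) z $ j = (\<Sum>i\<in>I. c i *s modular_deriv k (F i) z) $ j"
    by (simp add: modular_deriv_def right_diff_distrib sum_subtractf sum_distrib_left mult_ac)
qed

section \<open>Homogeneous elements of the level one ring\<close>

text \<open>With polynomials, outer variable \<open>E6\<close> and inner variable \<open>E4\<close>,
  ring operations on level one forms become polynomial arithmetic, with no bookkeeping of double
  sums.\<close>

lemma level_one_ring_iff_poly:
  "f \<in> level_one_ring \<longleftrightarrow>
     (\<exists>p :: complex poly poly. \<forall>z\<in>\<H>. f z = poly (poly p [:E6 z:]) (E4 z))"
proof
  assume "f \<in> level_one_ring"
  then obtain N a where f: "\<And>z. z \<in> \<H> \<Longrightarrow> f z = (\<Sum>i\<le>N. \<Sum>j\<le>N. a i j * E4 z ^ i * E6 z ^ j)"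
    unfolding level_one_ring_def by blast
  have "poly (poly (\<Sum>i\<le>N. \<Sum>j\<le>N. monom (monom (a i j) i) j) [:y:]) x
      = (\<Sum>i\<le>N. \<Sum>j\<le>N. a i j * x ^ i * y ^ j)" for x y
    by (simp add: poly_sum poly_monom)
  then show "\<exists>p :: complex poly poly. \<forall>z\<in>\<H>. f z = poly (poly p [:E6 z:]) (E4 z)"
    by (intro exI[of _ "\<Sum>i\<le>N. \<Sum>j\<le>N. monom (monom (a i j) i) j"]) (simp add: f)
next
  assume "\<exists>p :: complex poly poly. \<forall>z\<in>\<H>. f z = poly (poly p [:E6 z:]) (E4 z)"
  then obtain p :: "complex poly poly" where
    f: "\<And>z. z \<in> \<H> \<Longrightarrow> f z = poly (poly p [:E6 z:]) (E4 z)" by blast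
  define N where "N = max (degree p) (Max ((\<lambda>j. degree (coeff p j)) ` {..degree p}))"
  have deg: "degree (coeff p j) \<le> N" if "j \<le> degree p" for j
    using that unfolding N_def by (intro max.coboundedI2 Max_ge) auto
  have poly_le: "poly r x = (\<Sum>i\<le>N. coeff r i * x ^ i)" if "degree r \<le> N" for r :: "complex poly" and x
    unfolding poly_altdef using that by (intro sum.mono_neutral_left) (auto simp: coeff_eq_0)
  have "poly (poly p [:y:]) x = (\<Sum>i\<le>N. \<Sum>j\<le>N. coeff (coeff p j) i * x ^ i * y ^ j)" for x y :: complex
  proof -
    have "poly (poly p [:y:]) x = (\<Sum>j\<le>degree p. poly (coeff p j) x * y ^ j)"
      by (subst poly_altdef[of p]) (simp add: poly_sum)
    also have "\<dots> = (\<Sum>j\<le>degree p. \<Sum>i\<le>N. coeff (coeff p j) i * x ^ i * y ^ j)"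
      by (intro sum.cong refl) (simp add: poly_le[OF deg] sum_distrib_right)
    also have "\<dots> = (\<Sum>j\<le>N. \<Sum>i\<le>N. coeff (coeff p j) i * x ^ i * y ^ j)"
      by (rule sum.mono_neutral_left) (auto simp: N_def coeff_eq_0)
    also have "\<dots> = (\<Sum>i\<le>N. \<Sum>j\<le>N. coeff (coeff p j) i * x ^ i * y ^ j)"
      by (rule sum.swap)
    finally show ?thesis .
  qed
  with f show "f \<in> level_one_ring"
    unfolding level_one_ring_def by (intro CollectI exI[of _ N] exI[of _ "\<lambda>i j. coeff (coeff p j) i"]) simp
qed

lemma level_one_ring_q:
  assumes "f \<in> level_one_ring"
  obtains g where "g holomorphic_on ball 0 1" "\<And>z. z \<in> \<H> \<Longrightarrow> f z = g (nome z)"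
proof -
  obtain N a where f: "\<And>z. z \<in> \<H> \<Longrightarrow> f z = (\<Sum>i\<le>N. \<Sum>j\<le>N. a i j * E4 z ^ i * E6 z ^ j)"
    using assms unfolding level_one_ring_def by blast
  show ?thesis
  proof
    show "(\<lambda>q. \<Sum>i\<le>N. \<Sum>j\<le>N. a i j * e4 q ^ i * e6 q ^ j) holomorphic_on ball 0 1"
      by (intro holomorphic_intros e4_holomorphic e6_holomorphic)
  qed (simp add: f modular_form_q[OF modular_form_E4] modular_form_q[OF modular_form_E6])
qed

lemma level_one_ring_holomorphic:
  assumes "f \<in> level_one_ring"
  shows "f holomorphic_on \<H>"
proof -
  obtain N a where f: "\<And>z. z \<in> \<H> \<Longrightarrow> f z = (\<Sum>i\<le>N. \<Sum>j\<le>N. a i j * E4 z ^ i * E6 z ^ j)"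
    using assms unfolding level_one_ring_def by blast
  have "(\<lambda>z. \<Sum>i\<le>N. \<Sum>j\<le>N. a i j * E4 z ^ i * E6 z ^ j) holomorphic_on \<H>"
    by (intro holomorphic_intros E4_holomorphic E6_holomorphic)
  then show ?thesis by (rule holomorphic_transform) (simp add: f)
qed

definition weight_part :: "int \<Rightarrow> nat \<Rightarrow> (nat \<Rightarrow> nat \<Rightarrow> complex) \<Rightarrow> complex \<Rightarrow> complex" where
  "weight_part w N a z = (\<Sum>i\<le>N. \<Sum>j\<le>N.
     (if 4 * int i + 6 * int j = w then a i j else 0) * E4 z ^ i * E6 z ^ j)"

definition level_one_weight :: "int \<Rightarrow> (complex \<Rightarrow> complex) set" where
  "level_one_weight w = {f. \<exists>N a. \<forall>z\<in>\<H>. f z = weight_part w N a z}"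

lemma level_one_weight_in_ring: "f \<in> level_one_weight w \<Longrightarrow> f \<in> level_one_ring"
proof -
  assume "f \<in> level_one_weight w"
  then obtain N a where "\<forall>z\<in>\<H>. f z = weight_part w N a z"
    unfolding level_one_weight_def by blast
  then show ?thesis
    unfolding level_one_ring_def weight_part_def
    by (intro CollectI exI[of _ N] exI[of _ "\<lambda>i j. if 4 * int i + 6 * int j = w then a i j else 0"])
qed

lemma weight_part_transform:
  assumes "\<gamma> \<in> SL2Z" "z \<in> \<H>"
  shows "weight_part w N a (moebius \<gamma> z) = automorphy_factor \<gamma> z powi w * weight_part w N a z"
proof -
  define J where "J = automorphy_factor \<gamma> z"
  have eq: "(if 4 * int i + 6 * int j = w then a i j else 0) * (J ^ 4 * E4 z) ^ i * (J ^ 6 * E6 z) ^ j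
     = J powi w * ((if 4 * int i + 6 * int j = w then a i j else 0) * E4 z ^ i * E6 z ^ j)" for i j
  proof (cases "4 * int i + 6 * int j = w")
    case True
    then have "w = int (4 * i + 6 * j)" by simp
    then have "J powi w = J ^ (4 * i + 6 * j)" by (simp only: power_int_of_nat)
    then show ?thesis by (simp add: True power_mult_distrib power_add power_mult)
  qed simp
  show ?thesis
    unfolding weight_part_def modular_form_transform[OF modular_form_E4 assms]
      modular_form_transform[OF modular_form_E6 assms] sum_distrib_left J_def[symmetric]
    by (intro sum.cong refl) (rule eq)
qed

text \<open>4 i + 6 j takes neither negative values nor the value 2. This is the source of all
  forced zeros in the matrix of the modular derivative.\<close>

lemma level_one_weight_empty:
  assumes "f \<in> level_one_weight w" "w < 0 \<or> w = 2" "z \<in> \<H>"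
  shows "f z = 0"
proof -
  have "4 * int i + 6 * int j \<noteq> w" for i j using assms(2) by presburger
  then show ?thesis using assms by (auto simp: level_one_weight_def weight_part_def)
qed

lemma level_one_weight_0:
  assumes "f \<in> level_one_weight 0"
  obtains c where "\<And>z. z \<in> \<H> \<Longrightarrow> f z = c"
proof -
  obtain N a where f: "\<And>z. z \<in> \<H> \<Longrightarrow> f z = weight_part 0 N a z"
    using assms unfolding level_one_weight_def by blast
  have "(if 4 * int i + 6 * int j = 0 then a i j else 0) * E4 z ^ i * E6 z ^ j
      = (if j = 0 then if i = 0 then a 0 0 else 0 else 0)" for i j z
    by auto
  then have "weight_part 0 N a z = a 0 0" for z
    unfolding weight_part_def by (simp add: sum.delta)
  then show ?thesis using that[of "a 0 0"] f by simp
qed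

lemma level_one_weight_4:
  assumes "f \<in> level_one_weight 4"
  obtains c where "\<And>z. z \<in> \<H> \<Longrightarrow> f z = c * E4 z"
proof -
  obtain N a where f: "\<And>z. z \<in> \<H> \<Longrightarrow> f z = weight_part 4 N a z"
    using assms unfolding level_one_weight_def by blast
  have "4 * int i + 6 * int j = 4 \<longleftrightarrow> j = 0 \<and> i = 1" for i j by presburger
  then have "(if 4 * int i + 6 * int j = 4 then a i j else 0) * E4 z ^ i * E6 z ^ j
      = (if j = 0 then if i = 1 then a 1 0 * E4 z else 0 else 0)" for i j z
    by auto
  then have "weight_part 4 N a z = (if 1 \<le> N then a 1 0 else 0) * E4 z" for z
    unfolding weight_part_def by (simp add: sum.delta)
  then show ?thesis using that[of "if 1 \<le> N then a 1 0 else 0"] f by simp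
qed

section \<open>The sum of the weight spaces is direct\<close>

text \<open>Shifting exponents by the least one turns the sum into a polynomial with infinitely many
  roots.\<close>

lemma power_int_sum_eq_0:
  fixes c :: "int \<Rightarrow> complex"
  assumes K: "finite K" and X: "infinite X" "0 \<notin> X"
    and zero: "\<And>x. x \<in> X \<Longrightarrow> (\<Sum>v\<in>K. x powi v * c v) = 0" and v: "v \<in> K"
  shows "c v = 0"
proof -
  define n where "n = (\<lambda>v. nat (v - Min K))"
  define P where "P = (\<Sum>v\<in>K. monom (c v) (n v))"
  have n: "int (n v) = v - Min K" if "v \<in> K" for v using K that by (simp add: n_def)
  have "poly P x = 0" if x: "x \<in> X" for x
  proof -
    have x0: "x \<noteq> 0" using x X by auto
    have "x powi v = x powi Min K * x ^ n v" if "v \<in> K" for v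
    proof -
      have "x powi v = x powi (Min K + int (n v))" using n[OF that] by simp
      also have "\<dots> = x powi Min K * x ^ n v" using x0 by (simp add: power_int_add)
      finally show ?thesis .
    qed
    then have "(\<Sum>v\<in>K. x powi v * c v) = x powi Min K * poly P x"
      by (simp add: P_def poly_sum poly_monom sum_distrib_left mult_ac)
    then show ?thesis using zero[OF x] x0 by simp
  qed
  then have "X \<subseteq> {x. poly P x = 0}" by blast
  then have "P = 0" using poly_roots_finite X(1) finite_subset by blast
  moreover have "coeff P (n v) = (\<Sum>u\<in>K. if u = v then c u else 0)"
    unfolding P_def coeff_sum
  proof (intro sum.cong refl)
    fix u assume "u \<in> K"
    then have "n u = n v \<longleftrightarrow> u = v" using n[OF v] n[of u] by auto
    then show "coeff (monom (c u) (n u)) (n v) = (if u = v then c u else 0)" by simp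
  qed
  ultimately show ?thesis using K v by simp
qed

lemma representation_kernel:
  assumes "representation \<rho>" "\<gamma> \<in> SL2Z" "\<rho> \<gamma> *v x = 0"
  shows "x = 0"
  using assms unfolding representation_def invertible_left_inverse matrix_left_invertible_ker by blast

text \<open>Evaluate at gamma z with bottom row (1, d) and cancel the invertible rho(gamma): the
  factor z + d takes infinitely many values, so \<open>power_int_sum_eq_0\<close> applies to each
  component.\<close>

lemma transforms_sum_eq_0:
  assumes rep: "representation \<rho>" and K: "finite K"
    and tr: "\<And>v. v \<in> K \<Longrightarrow> transforms \<rho> v (g v)"
    and zero: "\<And>z. z \<in> \<H> \<Longrightarrow> (\<Sum>v\<in>K. g v z) = 0"
    and v: "v \<in> K" and z: "z \<in> \<H>"
  shows "g v z = 0"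
proof (subst vec_eq_iff, rule allI)
  fix i
  let ?X = "range (\<lambda>d :: int. z + of_int d)"
  have "(\<Sum>v\<in>K. x powi v * g v z $ i) = 0" if x: "x \<in> ?X" for x
  proof -
    obtain d :: int where d: "x = z + of_int d" using x by blast
    let ?\<gamma> = "mat2 0 (-1) 1 d"
    have SL: "?\<gamma> \<in> SL2Z" by (simp add: SL2Z_iff)
    have J: "automorphy_factor ?\<gamma> z = x" by (simp add: automorphy_factor_def d)
    have "\<rho> ?\<gamma> *v (\<Sum>v\<in>K. x powi v *s g v z) = (\<Sum>v\<in>K. g v (moebius ?\<gamma> z))"
      unfolding matrix_vector_mult_sum matrix_vector_mult_smult
      using tr SL z by (intro sum.cong refl) (simp add: transforms_def J)
    also have "\<dots> = 0" by (rule zero[OF moebius_uhp[OF SL z]])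
    finally have "(\<Sum>v\<in>K. x powi v *s g v z) = 0" by (rule representation_kernel[OF rep SL])
    then have "(\<Sum>v\<in>K. x powi v *s g v z) $ i = 0" by simp
    then show ?thesis by simp
  qed
  moreover have "infinite ?X"
    by (simp add: finite_image_iff inj_on_def infinite_UNIV_int)
  moreover have "0 \<notin> ?X"
  proof
    assume "0 \<in> ?X"
    then obtain d :: int where "0 = z + of_int d" by blast
    then have "Im (z + of_int d) = 0" by simp
    then show False using z by (simp add: uhp_iff)
  qed
  ultimately have "g v z $ i = 0"
    by (intro power_int_sum_eq_0[OF K _ _ _ v, of ?X "\<lambda>v. g v z $ i"])
  then show "g v z $ i = 0 $ i" by simp
qed

section \<open>Homogeneous coefficients with respect to a basis\<close>

lemma basis_weight: "homogeneous_free_basis \<rho> L k F \<Longrightarrow> F i \<in> vvmf_weight \<rho> L (k i)"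
  by (simp add: homogeneous_free_basis_def)

lemma basis_span:
  assumes "homogeneous_free_basis \<rho> L k F" "G \<in> vvmf_weight \<rho> L w"
  shows "\<exists>f. (\<forall>i. f i \<in> level_one_ring) \<and> (\<forall>z\<in>\<H>. G z = (\<Sum>i\<in>UNIV. f i z *s F i z))"
proof -
  have "\<forall>G\<in>vvmf \<rho> L. \<exists>f. (\<forall>i. f i \<in> level_one_ring) \<and> (\<forall>z\<in>\<H>. G z = (\<Sum>i\<in>UNIV. f i z *s F i z))"
    using assms(1) unfolding homogeneous_free_basis_def by (elim conjE)
  from bspec[OF this vvmf_weight_in_vvmf[OF assms(2)]] show ?thesis .
qed

text \<open>Sort the monomials of arbitrary coefficients by weight. Since G is itself homogeneous
  and the weight spaces are independent, the part of weight \<open>w\<close> alone represents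
  G.\<close>

lemma homogeneous_coefficients:
  fixes F :: "'m::finite \<Rightarrow> complex \<Rightarrow> complex^'n"
  assumes rep: "representation \<rho>" and basis: "homogeneous_free_basis \<rho> L k F"
    and G: "G \<in> vvmf_weight \<rho> L w"
  obtains f where "\<And>i. f i \<in> level_one_weight (w - k i)"
    "\<And>z. z \<in> \<H> \<Longrightarrow> G z = (\<Sum>i\<in>UNIV. f i z *s F i z)"
proof -
  note F = basis_weight[OF basis]
  obtain f where "(\<forall>i. f i \<in> level_one_ring) \<and> (\<forall>z\<in>\<H>. G z = (\<Sum>i\<in>UNIV. f i z *s F i z))"
    using basis_span[OF basis G] ..
  then have f: "\<And>i. f i \<in> level_one_ring"
    "\<And>z. z \<in> \<H> \<Longrightarrow> G z = (\<Sum>i\<in>UNIV. f i z *s F i z)"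
    by simp_all
  have "\<forall>i. \<exists>N a. \<forall>z\<in>\<H>. f i z = (\<Sum>p\<le>N. \<Sum>r\<le>N. a p r * E4 z ^ p * E6 z ^ r)"
    using f(1) by (simp add: level_one_ring_def)
  from choice[OF this] obtain N
    where "\<forall>i. \<exists>a. \<forall>z\<in>\<H>. f i z = (\<Sum>p\<le>N i. \<Sum>r\<le>N i. a p r * E4 z ^ p * E6 z ^ r)" ..
  from choice[OF this] obtain a
    where "\<forall>i. \<forall>z\<in>\<H>. f i z = (\<Sum>p\<le>N i. \<Sum>r\<le>N i. a i p r * E4 z ^ p * E6 z ^ r)" ..
  then have fi: "f i z = (\<Sum>p\<le>N i. \<Sum>r\<le>N i. a i p r * E4 z ^ p * E6 z ^ r)"
    if "z \<in> \<H>" for i z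
    using that by simp
  \<comment> \<open>All weights that occur; \<open>w\<close> is inserted because it might not occur
    among them.\<close>
  define K where "K = insert w (\<Union>i. \<Union>p\<le>N i. \<Union>r\<le>N i. {4 * int p + 6 * int r + k i})"
  have K: "finite K" "w \<in> K" by (auto simp: K_def)
  have part: "(\<Sum>v\<in>K. weight_part (v - k i) (N i) (a i) z) = f i z" if z: "z \<in> \<H>" for i z
  proof -
    have "(\<Sum>v\<in>K. (if 4 * int p + 6 * int r = v - k i then a i p r else 0)) = a i p r"
      if "p \<le> N i" "r \<le> N i" for p r
    proof -
      have "4 * int p + 6 * int r + k i \<in> K" using that by (auto simp: K_def)
      moreover have "4 * int p + 6 * int r = v - k i \<longleftrightarrow> v = 4 * int p + 6 * int r + k i" for v
        by auto
      ultimately show ?thesis using K(1) by (simp add: sum.delta)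
    qed
    then have "(\<Sum>v\<in>K. (if 4 * int p + 6 * int r = v - k i then a i p r else 0) * E4 z ^ p * E6 z ^ r)
       = a i p r * E4 z ^ p * E6 z ^ r" if "p \<le> N i" "r \<le> N i" for p r
      using that by (simp flip: sum_distrib_right)
    then show ?thesis
      unfolding weight_part_def fi[OF z]
      by (subst sum.swap, intro sum.cong refl, subst sum.swap) simp
  qed
  let ?g = "\<lambda>v z. (\<Sum>i\<in>UNIV. weight_part (v - k i) (N i) (a i) z *s F i z)"
  have trg: "transforms \<rho> v (?g v)" for v
  proof (rule transforms_sum)
    fix i
    have "transforms \<rho> (k i + (v - k i)) (\<lambda>z. weight_part (v - k i) (N i) (a i) z *s F i z)"
      using F[of i] by (intro transforms_smult weight_part_transform) (auto simp: vvmf_weight_iff)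
    then show "transforms \<rho> v (\<lambda>z. weight_part (v - k i) (N i) (a i) z *s F i z)" by simp
  qed
  have sumg: "(\<Sum>v\<in>K. ?g v z) = G z" if z: "z \<in> \<H>" for z
  proof -
    have "(\<Sum>v\<in>K. ?g v z) = (\<Sum>i\<in>UNIV. (\<Sum>v\<in>K. weight_part (v - k i) (N i) (a i) z) *s F i z)"
      by (subst sum.swap) (simp add: vec_eq_iff sum_distrib_right)
    then show ?thesis by (simp add: part[OF z] f(2)[OF z])
  qed
  \<comment> \<open>Moving G into the component of weight \<open>w\<close> gives a vanishing sum of
    forms of distinct weights.\<close>
  let ?h = "\<lambda>v z. ?g v z - (if v = w then 1 else 0) *s G z"
  have trh: "transforms \<rho> v (?h v)" for v
    using trg[of v] G unfolding vvmf_weight_iff transforms_def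
    by (cases "v = w") (simp_all add: matrix_vector_mult_diff_distrib vector_ssub_ldistrib)
  have "?h w z = 0" if z: "z \<in> \<H>" for z
  proof (rule transforms_sum_eq_0[OF rep K(1) trh _ K(2) z])
    fix z assume z: "z \<in> \<H>"
    have "(\<Sum>v\<in>K. (if v = w then 1 else 0) *s G z) = (\<Sum>v\<in>K. (if v = w then G z else 0))"
      by (intro sum.cong refl) auto
    then show "(\<Sum>v\<in>K. ?h v z) = 0"
      using K by (simp add: sum_subtractf sumg[OF z])
  qed
  then have "G z = (\<Sum>i\<in>UNIV. weight_part (w - k i) (N i) (a i) z *s F i z)" if "z \<in> \<H>" for z
    using that by simp
  moreover have "weight_part (w - k i) (N i) (a i) \<in> level_one_weight (w - k i)" for i
    unfolding level_one_weight_def by blast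
  ultimately show ?thesis by (rule that[rotated])
qed

section \<open>Systems stable under the modular derivative\<close>

lemma sum_delta_mult:
  fixes x :: "'b \<Rightarrow> 'a::semiring_0"
  assumes "finite I" "i \<in> I"
  shows "(\<Sum>j\<in>I. (if j = i then a else 0) * x j) = a * x i"
proof -
  have "(\<Sum>j\<in>I. (if j = i then a else 0) * x j) = (\<Sum>j\<in>I. if j = i then a * x j else 0)"
    by (intro sum.cong refl) auto
  then show ?thesis using assms by simp
qed

text \<open>By induction every higher derivative of \<open>h i\<close> is a combination of the
  \<open>h j\<close> with holomorphic coefficients. All of them vanish at \<open>a\<close>, and the
  identity theorem finishes.\<close>

lemma linear_system_eq_0:
  fixes h :: "'b \<Rightarrow> complex \<Rightarrow> complex"
  assumes I: "finite I" and hol: "\<And>i. i \<in> I \<Longrightarrow> h i holomorphic_on \<H>"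
    and C: "\<And>i j. i \<in> I \<Longrightarrow> j \<in> I \<Longrightarrow> C i j holomorphic_on \<H>"
    and sys: "\<And>i z. i \<in> I \<Longrightarrow> z \<in> \<H> \<Longrightarrow> deriv (h i) z = (\<Sum>j\<in>I. C i j z * h j z)"
    and a: "a \<in> \<H>" "\<And>i. i \<in> I \<Longrightarrow> h i a = 0" and i: "i \<in> I" and z: "z \<in> \<H>"
  shows "h i z = 0"
proof -
  have "\<exists>D. (\<forall>i\<in>I. \<forall>j\<in>I. D i j holomorphic_on \<H>) \<and>
     (\<forall>i\<in>I. \<forall>z\<in>\<H>. (deriv ^^ n) (h i) z = (\<Sum>j\<in>I. D i j z * h j z))" for n
  proof (induction n)
    case 0
    have "h i z = (\<Sum>j\<in>I. (if j = i then 1 else 0) * h j z)" if "i \<in> I" for i z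
      using sum_delta_mult[OF I that, of 1 "\<lambda>j. h j z"] by simp
    then show ?case by (intro exI[of _ "\<lambda>i j z. if j = i then 1 else 0"]) auto
  next
    case (Suc n)
    then obtain D where "(\<forall>i\<in>I. \<forall>j\<in>I. D i j holomorphic_on \<H>) \<and>
        (\<forall>i\<in>I. \<forall>z\<in>\<H>. (deriv ^^ n) (h i) z = (\<Sum>j\<in>I. D i j z * h j z))" ..
    then have D: "\<And>i j. i \<in> I \<Longrightarrow> j \<in> I \<Longrightarrow> D i j holomorphic_on \<H>"
      "\<And>i z. i \<in> I \<Longrightarrow> z \<in> \<H> \<Longrightarrow> (deriv ^^ n) (h i) z = (\<Sum>j\<in>I. D i j z * h j z)"
      by simp_all
    let ?D = "\<lambda>i j z. deriv (D i j) z + (\<Sum>l\<in>I. D i l z * C l j z)"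
    have "(deriv ^^ Suc n) (h i) z = (\<Sum>j\<in>I. ?D i j z * h j z)" if i: "i \<in> I" and z: "z \<in> \<H>" for i z
    proof -
      have "((\<lambda>z. \<Sum>j\<in>I. D i j z * h j z) has_field_derivative
          (\<Sum>j\<in>I. deriv (D i j) z * h j z + deriv (h j) z * D i j z)) (at z)"
        by (intro DERIV_sum DERIV_mult holomorphic_derivI[OF D(1)[OF i] open_uhp z]
              holomorphic_derivI[OF hol open_uhp z])
      then have "((deriv ^^ n) (h i) has_field_derivative
          (\<Sum>j\<in>I. deriv (D i j) z * h j z + deriv (h j) z * D i j z)) (at z)"
        by (rule has_field_derivative_transform_within_open[OF _ open_uhp z]) (simp add: D(2)[OF i])
      then have "(deriv ^^ Suc n) (h i) z = (\<Sum>j\<in>I. deriv (D i j) z * h j z + deriv (h j) z * D i j z)"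
        by (simp add: DERIV_imp_deriv)
      also have "\<dots> = (\<Sum>j\<in>I. deriv (D i j) z * h j z) + (\<Sum>l\<in>I. \<Sum>j\<in>I. D i l z * C l j z * h j z)"
        unfolding sum.distrib
        by (intro arg_cong2[where f = "(+)"] refl sum.cong) (simp add: sys[OF _ z] sum_distrib_left mult_ac)
      also have "(\<Sum>l\<in>I. \<Sum>j\<in>I. D i l z * C l j z * h j z) = (\<Sum>j\<in>I. (\<Sum>l\<in>I. D i l z * C l j z) * h j z)"
        by (subst sum.swap) (simp add: sum_distrib_right)
      finally show ?thesis by (simp add: sum.distrib distrib_right)
    qed
    moreover have "?D i j holomorphic_on \<H>" if "i \<in> I" "j \<in> I" for i j
      using that by (intro holomorphic_intros D C open_uhp)
    ultimately show ?case by (intro exI[of _ ?D]) blast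
  qed
  then have "(deriv ^^ n) (h i) a = 0" for n
  proof -
    obtain D where "(deriv ^^ n) (h i) a = (\<Sum>j\<in>I. D i j a * h j a)"
      using \<open>\<exists>D. (\<forall>i\<in>I. \<forall>j\<in>I. D i j holomorphic_on \<H>) \<and>
         (\<forall>i\<in>I. \<forall>z\<in>\<H>. (deriv ^^ n) (h i) z = (\<Sum>j\<in>I. D i j z * h j z))\<close> i a(1) by blast
    then show ?thesis using a(2) by simp
  qed
  then show ?thesis
    using holomorphic_fun_eq_0_on_connected[OF hol[OF i] open_uhp connected_uhp _ a(1) z] by blast
qed

text \<open>A linear map that fixes \<open>x\<close> and kills a maximal independent subset of
  \<open>S\<close>. A coordinate of its image then serves as a functional separating
  \<open>x\<close> from the span, which reduces vector statements to scalar equations.\<close>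

lemma separating_matrix:
  fixes x :: "complex^'n"
  assumes "x \<notin> vec.span S"
  obtains M :: "complex^'n^'n" where "\<And>y. y \<in> S \<Longrightarrow> M *v y = 0" "M *v x \<noteq> 0"
proof -
  obtain B where B: "B \<subseteq> S" "vec.independent B" "S \<subseteq> vec.span B"
    using vec.maximal_independent_subset by blast
  have x: "x \<notin> vec.span B" using B(1) assms vec.span_mono by blast
  then have ind: "vec.independent (insert x B)" using B(2) by (rule vec.independent_insertI)
  obtain g where g: "Vector_Spaces.linear (*s) (*s) g"
    "\<And>y. y \<in> insert x B \<Longrightarrow> g y = (if y = x then x else 0)"
    using vec.linear_independent_extend[OF ind, of "\<lambda>y. if y = x then x else 0"] by blast
  have M: "matrix g *v y = g y" for y by (rule matrix_works[OF g(1)])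
  have "x \<noteq> 0" using x vec.span_zero by blast
  then have "matrix g *v x \<noteq> 0" using g(2)[of x] by (simp add: M)
  moreover have "matrix g *v y = 0" if "y \<in> S" for y
  proof -
    have "y \<in> vec.span B" using that B(3) by blast
    then show ?thesis
    proof (rule vec.span_induct)
      show "vec.subspace {y. matrix g *v y = 0}"
        by (auto simp: vec.subspace_def matrix_vector_right_distrib matrix_vector_mult_smult)
      fix b assume "b \<in> B"
      moreover from this have "b \<noteq> x" using x vec.span_base by blast
      ultimately show "matrix g *v b = 0" using g(2)[of b] by (simp add: M)
    qed
  qed
  ultimately show ?thesis using that by blast
qed

text \<open>By uniqueness for linear differential equations, the values of the \<open>G\<^sub>i\<close> at one point span a
  space containing all their values; this space is invariant under \<open>\<rho>\<close>.\<close>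

lemma stable_system_eq_0:
  fixes \<rho> :: "int^2^2 \<Rightarrow> complex^'n^'n" and G :: "'b \<Rightarrow> complex \<Rightarrow> complex^'n"
  assumes irr: "irreducible_representation \<rho>" and I: "finite I" "card I < CARD('n)"
    and G: "\<And>i. i \<in> I \<Longrightarrow> G i \<in> vvmf_weight \<rho> L (w i)"
    and B: "\<And>i j. i \<in> I \<Longrightarrow> j \<in> I \<Longrightarrow> B i j holomorphic_on \<H>"
    and sys: "\<And>i z. i \<in> I \<Longrightarrow> z \<in> \<H> \<Longrightarrow>
       modular_deriv (w i) (G i) z = (\<Sum>j\<in>I. B i j z *s G j z)"
    and i: "i \<in> I" and z: "z \<in> \<H>"
  shows "G i z = 0"
proof -
  let ?S = "(\<lambda>i. G i \<i>) ` I"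
  let ?W = "vec.span ?S"
  have Ghol: "(\<lambda>z. G i z $ d) holomorphic_on \<H>" if "i \<in> I" for i d
    using G[OF that] by (auto simp: vvmf_weight_iff vec_holomorphic_def)
  have val: "G i z \<in> ?W" if i: "i \<in> I" and z: "z \<in> \<H>" for i z
  proof (rule ccontr)
    assume "G i z \<notin> ?W"
    then obtain M :: "complex^'n^'n" where M: "\<And>y. y \<in> ?S \<Longrightarrow> M *v y = 0" "M *v G i z \<noteq> 0"
      using separating_matrix by blast
    obtain c where c: "(M *v G i z) $ c \<noteq> 0" using M(2) by (auto simp: vec_eq_iff)
    let ?h = "\<lambda>i z. (M *v G i z) $ c"
    \<comment> \<open>The added diagonal term converts the modular derivative back into
      d/dz.\<close>
    let ?C = "\<lambda>i j z. B i j z + (if j = i then of_int (w i) / 12 * disc_logderiv z else 0)"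
    have hol: "?h i holomorphic_on \<H>" if "i \<in> I" for i
      unfolding matrix_vector_mult_def using Ghol[OF that] by (auto intro!: holomorphic_intros)
    have Chol: "?C i j holomorphic_on \<H>" if "i \<in> I" "j \<in> I" for i j
      using B[OF that] disc_logderiv_holomorphic by (cases "j = i") (auto intro!: holomorphic_intros)
    have sysC: "deriv (?h i) z = (\<Sum>j\<in>I. ?C i j z * ?h j z)" if i: "i \<in> I" and z: "z \<in> \<H>" for i z
    proof -
      have "(?h i has_field_derivative (\<Sum>d\<in>UNIV. M $ c $ d * deriv (\<lambda>z. G i z $ d) z)) (at z)"
        unfolding matrix_vector_mult_def vec_lambda_beta
        by (intro DERIV_sum DERIV_cmult holomorphic_derivI[OF Ghol[OF i] open_uhp z])
      then have "deriv (?h i) z = (\<Sum>d\<in>UNIV. M $ c $ d * deriv (\<lambda>z. G i z $ d) z)"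
        by (rule DERIV_imp_deriv)
      also have "\<dots> = (M *v (modular_deriv (w i) (G i) z + (of_int (w i) / 12 * disc_logderiv z) *s G i z)) $ c"
        by (simp add: matrix_vector_mult_def modular_deriv_def)
      also have "\<dots> = (\<Sum>j\<in>I. B i j z * ?h j z) + of_int (w i) / 12 * disc_logderiv z * ?h i z"
        by (simp add: matrix_vector_right_distrib matrix_vector_mult_smult sys[OF i z] matrix_vector_mult_sum)
      also have "of_int (w i) / 12 * disc_logderiv z * ?h i z
          = (\<Sum>j\<in>I. (if j = i then of_int (w i) / 12 * disc_logderiv z else 0) * ?h j z)"
        by (rule sum_delta_mult[OF I(1) i, symmetric])
      finally show ?thesis by (simp add: sum.distrib distrib_right)
    qed
    have at_ii: "?h j \<i> = 0" if "j \<in> I" for j using M(1) that by simp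
    have "?h i z = 0"
    proof (rule linear_system_eq_0[where I = I and h = ?h and C = ?C and a = \<i> and i = i])
      show "?h i holomorphic_on \<H>" if "i \<in> I" for i by (rule hol[OF that])
      show "?C i j holomorphic_on \<H>" if "i \<in> I" "j \<in> I" for i j by (rule Chol[OF that])
      show "deriv (?h i) z = (\<Sum>j\<in>I. ?C i j z * ?h j z)" if "i \<in> I" "z \<in> \<H>" for i z
        by (rule sysC[OF that])
    qed (use I(1) i z ii_in_uhp at_ii in blast)+
    with c show False by simp
  qed
  have inv: "\<rho> \<gamma> *v x \<in> ?W" if \<gamma>: "\<gamma> \<in> SL2Z" and x: "x \<in> ?W" for \<gamma> x
    using x
  proof (rule vec.span_induct)
    show "vec.subspace {x. \<rho> \<gamma> *v x \<in> ?W}"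
      by (auto simp: vec.subspace_def matrix_vector_right_distrib matrix_vector_mult_smult
            vec.span_zero vec.span_add vec.span_scale)
    fix y assume "y \<in> ?S"
    then obtain j where j: "j \<in> I" "y = G j \<i>" by blast
    have "G j (moebius \<gamma> \<i>) = (automorphy_factor \<gamma> \<i> powi w j) *s (\<rho> \<gamma> *v y)"
      using G[OF j(1)] \<gamma> ii_in_uhp j(2) by (simp add: vvmf_weight_iff transforms_def)
    then have "\<rho> \<gamma> *v y = inverse (automorphy_factor \<gamma> \<i> powi w j) *s G j (moebius \<gamma> \<i>)"
      using automorphy_nonzero[OF \<gamma> ii_in_uhp] by (simp add: vector_smult_assoc)
    then show "\<rho> \<gamma> *v y \<in> ?W"
      using val[OF j(1) moebius_uhp[OF \<gamma> ii_in_uhp]] by (simp add: vec.span_scale)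
  qed
  have "vec.dim ?W \<le> card ?S" using I(1) by (simp add: vec.dim_span vec.dim_le_card')
  also have "\<dots> < CARD('n)" using I card_image_le le_less_trans by blast
  finally have "?W \<noteq> UNIV" using vec_dim_card by (metis less_irrefl)
  then have "?W = {0}"
    using irr inv vec.subspace_span unfolding irreducible_representation_def by blast
  then show ?thesis using val[OF i z] by blast
qed

lemma stable_1:
  fixes \<rho> :: "int^2^2 \<Rightarrow> complex^'n^'n"
  assumes "irreducible_representation \<rho>" "1 < CARD('n)" "G \<in> vvmf_weight \<rho> L w"
    "\<And>z. z \<in> \<H> \<Longrightarrow> modular_deriv w G z = 0" "z \<in> \<H>"
  shows "G z = 0"
  by (rule stable_system_eq_0[where I = "{()}" and G = "\<lambda>_. G" and w = "\<lambda>_. w" and B = "\<lambda>_ _ _. 0"])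
     (use assms in auto)

text \<open>The coefficients are listed row by row. The forms need not be distinct: a family of two
  is handled by repeating one of them.\<close>

lemma stable_3:
  fixes \<rho> :: "int^2^2 \<Rightarrow> complex^'n^'n"
  assumes "irreducible_representation \<rho>" "3 < CARD('n)"
    and G: "G0 \<in> vvmf_weight \<rho> L w0" "G1 \<in> vvmf_weight \<rho> L w1" "G2 \<in> vvmf_weight \<rho> L w2"
    and b: "baa holomorphic_on \<H>" "bab holomorphic_on \<H>" "bac holomorphic_on \<H>"
      "bba holomorphic_on \<H>" "bbb holomorphic_on \<H>" "bbc holomorphic_on \<H>"
      "bca holomorphic_on \<H>" "bcb holomorphic_on \<H>" "bcc holomorphic_on \<H>"
    and sys: "\<And>z. z \<in> \<H> \<Longrightarrow> modular_deriv w0 G0 z = baa z *s G0 z + bab z *s G1 z + bac z *s G2 z"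
      "\<And>z. z \<in> \<H> \<Longrightarrow> modular_deriv w1 G1 z = bba z *s G0 z + bbb z *s G1 z + bbc z *s G2 z"
      "\<And>z. z \<in> \<H> \<Longrightarrow> modular_deriv w2 G2 z = bca z *s G0 z + bcb z *s G1 z + bcc z *s G2 z"
    and "z \<in> \<H>"
  shows "G0 z = 0"
proof -
  let ?G = "\<lambda>n :: nat. if n = 0 then G0 else if n = 1 then G1 else G2"
  let ?w = "\<lambda>n :: nat. if n = 0 then w0 else if n = 1 then w1 else w2"
  let ?B = "\<lambda>i j :: nat. if i = 0 then (if j = 0 then baa else if j = 1 then bab else bac)
     else if i = 1 then (if j = 0 then bba else if j = 1 then bbb else bbc)
     else (if j = 0 then bca else if j = 1 then bcb else bcc)"
  have "?G 0 z = 0"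
  proof (rule stable_system_eq_0[where I = "{0, 1, 2}" and w = ?w and B = ?B and G = ?G and i = 0])
    fix i z assume "i \<in> {0, 1, 2 :: nat}" "z \<in> \<H>"
    then show "modular_deriv (?w i) (?G i) z = (\<Sum>j\<in>{0, 1, 2}. ?B i j z *s ?G j z)"
      using sys by (auto simp: add.assoc)
  qed (use assms in auto)
  then show ?thesis by simp
qed

section \<open>Homogeneous free bases\<close>

text \<open>\<open>nome\<close> never takes the value 0, so identities on the upper half-plane reach
  the cusp only by continuity.\<close>

lemma holomorphic_eq_at_cusp:
  assumes "f holomorphic_on ball 0 1" "g holomorphic_on ball 0 1"
    and eq: "\<And>z. z \<in> \<H> \<Longrightarrow> f (nome z) = g (nome z)"
  shows "f 0 = g 0"
proof -
  have "isCont f 0" "isCont g 0"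
    using holomorphic_on_imp_continuous_on[OF assms(1)] holomorphic_on_imp_continuous_on[OF assms(2)]
    by (simp_all add: continuous_on_eq_continuous_at)
  then have f: "(f \<longlongrightarrow> f 0) (at 0)" and g: "(g \<longlongrightarrow> g 0) (at 0)" by (simp_all only: isCont_def)
  have "f q = g q" if "q \<in> ball 0 1" "q \<noteq> 0" for q
    using nome_surj[OF that] eq by metis
  then have "(g \<longlongrightarrow> f 0) (at 0)"
    by (intro Lim_transform_within_open[OF f open_ball, of 0 1]) auto
  then show ?thesis using g LIM_unique by blast
qed

lemma even_ge_4_imp_4_6:
  fixes n :: nat
  assumes "even n" "4 \<le> n"
  obtains a b where "n = 4 * a + 6 * b"
proof (cases "n mod 4 = 0")
  case True
  then have "n = 4 * (n div 4) + 6 * 0" by presburger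
  then show ?thesis by (rule that)
next
  case False
  then have "n = 4 * ((n - 6) div 4) + 6 * 1" using assms by presburger
  then show ?thesis by (rule that)
qed

context
  fixes \<rho> :: "int^2^2 \<Rightarrow> complex^'n^'n" and L :: "complex^'n^'n"
    and k :: "'m::finite \<Rightarrow> int" and F :: "'m \<Rightarrow> complex \<Rightarrow> complex^'n"
  assumes basis: "homogeneous_free_basis \<rho> L k F"
begin

lemma basis_free:
  assumes "\<And>i. f i \<in> level_one_ring" "\<And>z. z \<in> \<H> \<Longrightarrow> (\<Sum>i\<in>UNIV. f i z *s F i z) = 0" "z \<in> \<H>"
  shows "f i z = 0"
proof -
  have "\<forall>f. (\<forall>i. f i \<in> level_one_ring) \<and> (\<forall>z\<in>\<H>. (\<Sum>i\<in>UNIV. f i z *s F i z) = 0) \<longrightarrow>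
        (\<forall>i. \<forall>z\<in>\<H>. f i z = 0)"
    using basis unfolding homogeneous_free_basis_def by (elim conjE)
  from spec[OF this, of f] show ?thesis using assms by simp
qed

lemma basis_constants_independent:
  assumes "\<And>z. z \<in> \<H> \<Longrightarrow> (\<Sum>i\<in>UNIV. c i *s F i z) = 0"
  shows "c i = 0"
proof -
  have "(\<lambda>_. c i) \<in> level_one_ring" for i
    unfolding level_one_ring_iff_poly by (intro exI[of _ "[:[:c i:]:]"]) simp
  from basis_free[of "\<lambda>i _. c i", OF this assms ii_in_uhp] show ?thesis .
qed

lemma basis_nonzero: "\<exists>z\<in>\<H>. F i z \<noteq> 0"
proof (rule ccontr)
  assume "\<not> (\<exists>z\<in>\<H>. F i z \<noteq> 0)"
  then have "(\<Sum>j\<in>UNIV. (if j = i then 1 else 0) *s F j z) = 0" if "z \<in> \<H>" for z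
    using that by (intro sum.neutral) auto
  from basis_constants_independent[OF this, of i] show False by simp
qed

text \<open>-I fixes every point, so F = (-1)^(k i + e) F, and \<open>F i\<close> is nonzero
  somewhere.\<close>

lemma basis_parity:
  assumes "\<rho> (- mat 1) = mat ((-1) ^ e)"
  shows "even (k i + int e)"
proof -
  obtain z where z: "z \<in> \<H>" "F i z \<noteq> 0" using basis_nonzero by blast
  have SL: "- mat 1 \<in> SL2Z" by (simp add: SL2Z_iff mat_def)
  have J: "automorphy_factor (- mat 1) z = -1" by (simp add: automorphy_factor_def mat_def)
  then have m: "moebius (- mat 1) z = z" by (simp add: moebius_def mat_def)
  have "F i (moebius (- mat 1) z) = ((-1) powi k i) *s (mat ((-1) ^ e) *v F i z)"
    using basis_weight[OF basis, of i] SL z(1) assms J by (auto simp: vvmf_weight_iff transforms_def)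
  then have eq: "F i z = ((-1) powi k i) *s (mat ((-1) ^ e) *v F i z)" by (simp add: m)
  have mat: "mat c *v x = c *s x" for c :: complex and x :: "complex^'n"
    by (simp add: vec_eq_iff matrix_vector_mult_def mat_def if_distrib if_distribR cong: if_cong)
  obtain d where d: "F i z $ d \<noteq> 0" using z(2) by (auto simp: vec_eq_iff)
  have "F i z $ d = (-1) powi k i * ((-1) ^ e * F i z $ d)"
    by (subst eq) (simp add: mat)
  then have "(-1) powi k i * (-1) ^ e = (1 :: complex)" using d by simp
  then show ?thesis
    by (cases "even (k i)"; cases "even e") (auto simp: power_int_minus_left)
qed

text \<open>Otherwise a combination with coefficients \<open>c\<^sub>i E\<^sub>4\<^sup>a E\<^sub>6\<^sup>b\<close> of a common weight would be
  divisible by \<open>\<Delta>\<close>, hence so would be its coefficients.\<close>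

lemma cusp_values_independent:
  assumes parity: "\<And>i j. even (k i - k j)"
    and h: "\<And>i. has_q_expansion L (F i) (h i)"
    and zero: "(\<Sum>i\<in>UNIV. c i *s h i 0) = 0"
  shows "c i = 0"
proof -
  \<comment> \<open>The offset 4 makes every \<open>K - k i\<close> an even number at least 4, hence
    of the form 4 a + 6 b; a difference of 2 would not be.\<close>
  define K where "K = Max (range k) + 4"
  have K: "k i + 4 \<le> K" "even (K - k i)" for i
  proof -
    show "k i + 4 \<le> K" by (simp add: K_def)
    have "Max (range k) \<in> range k" by (intro Max_in) auto
    then obtain j where "Max (range k) = k j" by (rule imageE)
    then have "K = k j + 4" by (simp only: K_def)
    then show "even (K - k i)" using parity[of j i] by simp
  qed
  have "\<exists>a b. K - k i = int (4 * a + 6 * b)" for i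
  proof -
    have "even (nat (K - k i))" "4 \<le> nat (K - k i)" using K[of i] by (auto simp: even_nat_iff)
    then obtain a b where "nat (K - k i) = 4 * a + 6 * b" by (rule even_ge_4_imp_4_6)
    then have "K - k i = int (4 * a + 6 * b)" using K(1)[of i] by linarith
    then show ?thesis by blast
  qed
  then obtain a b where ab: "\<And>i. K - k i = int (4 * a i + 6 * b i)" by metis
  define f where "f = (\<lambda>i z. c i * (E4 z ^ a i * E6 z ^ b i))"
  define g where "g = (\<lambda>i q. c i * (e4 q ^ a i * e6 q ^ b i))"
  have mf: "modular_form (4 * a i + 6 * b i) (f i) (g i)" for i
    unfolding f_def g_def
    by (intro modular_form_cmult modular_form_mult modular_form_power modular_form_E4 modular_form_E6)
  have fF: "(\<lambda>z. f i z *s F i z) \<in> vvmf_weight \<rho> L K" for i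
  proof -
    have "k i + int (4 * a i + 6 * b i) = K" using ab[of i] by linarith
    with vvmf_weight_smult_modular_form[OF mf[of i] basis_weight[OF basis, of i]] show ?thesis by (simp only:)
  qed
  let ?G = "\<lambda>z. \<Sum>i\<in>UNIV. f i z *s F i z"
  have G: "?G \<in> vvmf_weight \<rho> L K" by (intro vvmf_weight_sum fF)
  have Gh: "has_q_expansion L ?G (\<lambda>q. \<Sum>i\<in>UNIV. g i q *s h i q)"
    using mf h by (intro has_q_expansion_sum has_q_expansion_smult) (auto simp: modular_form_def)
  have G0: "(\<Sum>i\<in>UNIV. g i 0 *s h i 0) = 0" using zero by (simp add: g_def)
  from basis_span[OF basis vvmf_weight_divide_disc[OF G Gh G0]]
  obtain r where "(\<forall>i. r i \<in> level_one_ring) \<and>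
      (\<forall>z\<in>\<H>. inverse (disc z) *s ?G z = (\<Sum>i\<in>UNIV. r i z *s F i z))" ..
  then have r: "\<And>i. r i \<in> level_one_ring"
    "\<And>z. z \<in> \<H> \<Longrightarrow> inverse (disc z) *s ?G z = (\<Sum>i\<in>UNIV. r i z *s F i z)"
    by simp_all
  have "f i z - disc z * r i z = 0" if "z \<in> \<H>" for z
  proof (rule basis_free[of "\<lambda>i z. f i z - disc z * r i z", OF _ _ that])
    fix i
    obtain p :: "complex poly poly" where p: "\<And>z. z \<in> \<H> \<Longrightarrow> r i z = poly (poly p [:E6 z:]) (E4 z)"
      using r(1)[of i] unfolding level_one_ring_iff_poly by blast
    show "(\<lambda>z. f i z - disc z * r i z) \<in> level_one_ring"
      unfolding level_one_ring_iff_poly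
      by (intro exI[of _ "monom (monom (c i) (a i)) (b i) - ([:monom 1 3:] - monom 1 2) * p"])
         (simp add: p f_def disc_def poly_monom)
  next
    fix z assume z: "z \<in> \<H>"
    have "?G z = disc z *s (inverse (disc z) *s ?G z)"
      using disc_nonzero[OF z] by (simp add: vector_smult_assoc)
    also have "\<dots> = (\<Sum>i\<in>UNIV. (disc z * r i z) *s F i z)"
      unfolding r(2)[OF z] by (simp add: vector_smult_sum vector_smult_assoc)
    finally show "(\<Sum>i\<in>UNIV. (f i z - disc z * r i z) *s F i z) = 0"
      by (simp add: vector_sub_rdistrib sum_subtractf)
  qed
  then have f: "f i z = disc z * r i z" if "z \<in> \<H>" for z using that by simp
  obtain s where s: "s holomorphic_on ball 0 1" "\<And>z. z \<in> \<H> \<Longrightarrow> r i z = s (nome z)"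
    using level_one_ring_q[OF r(1)[of i]] by blast
  \<comment> \<open>\<open>E4\<close> and \<open>E6\<close> have constant term 1, so the left side
    is \<open>c i\<close>; the factor 0 on the right is the zero of \<open>disc\<close> at the
    cusp.\<close>
  have "g i 0 = 0 * disc_unit 0 * s 0"
  proof (rule holomorphic_eq_at_cusp)
    show "g i holomorphic_on ball 0 1" by (rule modular_form_q_holomorphic[OF mf])
    show "(\<lambda>q. q * disc_unit q * s q) holomorphic_on ball 0 1"
      by (intro holomorphic_intros disc_unit_holomorphic s)
    show "g i (nome z) = nome z * disc_unit (nome z) * s (nome z)" if "z \<in> \<H>" for z
      using f[OF that] modular_form_q[OF mf that, of i] disc_eq[OF that] s(2)[OF that] by simp
  qed
  then show ?thesis by (simp add: g_def)
qed

lemma basis_derivative: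
  assumes "representation \<rho>"
  shows "\<exists>A. (\<forall>i j. A i j \<in> level_one_weight (k i + 2 - k j)) \<and>
    (\<forall>i. \<forall>z\<in>\<H>. modular_deriv (k i) (F i) z = (\<Sum>j\<in>UNIV. A i j z *s F j z))"
proof -
  have "\<forall>i. \<exists>f. (\<forall>j. f j \<in> level_one_weight (k i + 2 - k j)) \<and>
      (\<forall>z\<in>\<H>. modular_deriv (k i) (F i) z = (\<Sum>j\<in>UNIV. f j z *s F j z))"
  proof
    fix i
    show "\<exists>f. (\<forall>j. f j \<in> level_one_weight (k i + 2 - k j)) \<and>
      (\<forall>z\<in>\<H>. modular_deriv (k i) (F i) z = (\<Sum>j\<in>UNIV. f j z *s F j z))"
      by (rule homogeneous_coefficients[OF assms basis modular_deriv_in_vvmf_weight[OF basis_weight[OF basis, of i]]])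
         (intro exI conjI allI ballI)
  qed
  from choice[OF this] show ?thesis by blast
qed

end

section \<open>The trace of the exponents\<close>

text \<open>At \<open>q = 0\<close> the modular derivative acts as \<open>2 \<pi> i (L - k / 12)\<close>, while its matrix in the basis has
  zero diagonal because there are no forms of weight 2.\<close>

lemma sum_weights_eq_trace:
  fixes \<rho> :: "int^2^2 \<Rightarrow> complex^'n^'n" and k :: "'n \<Rightarrow> int"
  assumes rep: "representation \<rho>" and basis: "homogeneous_free_basis \<rho> L k F"
    and parity: "\<And>i j. even (k i - k j)"
  shows "of_int (\<Sum>i\<in>UNIV. k i) = 12 * trace L"
proof -
  have "\<forall>i. \<exists>h. has_q_expansion L (F i) h"
    using basis_weight[OF basis] by (auto simp: vvmf_weight_iff)
  from choice[OF this] obtain h where h: "\<And>i. has_q_expansion L (F i) (h i)" by blast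
  have hol: "vec_holomorphic (F i) \<H>" for i
    using basis_weight[OF basis, of i] by (simp add: vvmf_weight_iff)
  have hh: "(\<lambda>q. h i q $ d) holomorphic_on ball 0 1" for i d
    using h[of i] by (simp add: has_q_expansion_def vec_holomorphic_def)
  obtain A where "(\<forall>i j. A i j \<in> level_one_weight (k i + 2 - k j)) \<and>
    (\<forall>i. \<forall>z\<in>\<H>. modular_deriv (k i) (F i) z = (\<Sum>j\<in>UNIV. A i j z *s F j z))"
    using basis_derivative[OF basis rep] ..
  then have A: "\<And>i j. A i j \<in> level_one_weight (k i + 2 - k j)"
    "\<And>i z. z \<in> \<H> \<Longrightarrow> modular_deriv (k i) (F i) z = (\<Sum>j\<in>UNIV. A i j z *s F j z)"
    by simp_all
  have "\<forall>p. \<exists>g. g holomorphic_on ball 0 1 \<and> (\<forall>z\<in>\<H>. A (fst p) (snd p) z = g (nome z))"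
    using level_one_ring_q[OF level_one_weight_in_ring[OF A(1)]] by metis
  from choice[OF this] obtain g' where
    g': "\<forall>p. g' p holomorphic_on ball 0 1 \<and> (\<forall>z\<in>\<H>. A (fst p) (snd p) z = g' p (nome z))" ..
  define g where "g = (\<lambda>i j. g' (i, j))"
  have g: "g i j holomorphic_on ball 0 1" "\<And>z. z \<in> \<H> \<Longrightarrow> A i j z = g i j (nome z)" for i j
    using g'[THEN spec, of "(i, j)"] by (simp_all add: g_def)
  have diag: "g i i 0 = 0" for i
  proof (rule holomorphic_eq_at_cusp[of _ "\<lambda>_. 0"])
    show "g i i (nome z) = 0" if "z \<in> \<H>" for z
      using level_one_weight_empty[OF A(1)[of i i] _ that] g(2)[OF that, of i i] by simp
  qed (auto intro: g)
  have at_0: "2 * of_real pi * \<i> * (L *v h i 0) $ d - of_int (k i) / 12 * (2 * of_real pi * \<i>) * h i 0 $ d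
      = (\<Sum>j\<in>UNIV. g i j 0 * h j 0 $ d)" for i d
  proof -
    let ?l = "\<lambda>q. theta (\<lambda>q. h i q $ d) q + 2 * of_real pi * \<i> * (L *v h i q) $ d
        - of_int (k i) / 12 * disc_logderiv_q q * h i q $ d"
    let ?r = "\<lambda>q. \<Sum>j\<in>UNIV. g i j q * h j q $ d"
    have "?l 0 = ?r 0"
    proof (rule holomorphic_eq_at_cusp)
      show "?l holomorphic_on ball 0 1"
        unfolding matrix_vector_mult_def
        by (auto intro!: holomorphic_intros theta_holomorphic hh disc_logderiv_q_holomorphic)
      show "?r holomorphic_on ball 0 1" by (intro holomorphic_intros g hh)
      fix z assume z: "z \<in> \<H>"
      have "exponent_factor L z *v modular_deriv (k i) (F i) z = (\<Sum>j\<in>UNIV. g i j (nome z) *s h j (nome z))"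
        unfolding A(2)[OF z] matrix_vector_mult_sum matrix_vector_mult_smult g(2)[OF z]
        using h z by (simp add: has_q_expansion_def)
      moreover have "exponent_factor L z *v modular_deriv (k i) (F i) z
         = (\<chi> d. theta (\<lambda>q. h i q $ d) (nome z) + 2 * of_real pi * \<i> * (L *v h i (nome z)) $ d
              - of_int (k i) / 12 * disc_logderiv_q (nome z) * h i (nome z) $ d)"
        using has_q_expansion_modular_deriv[OF hol[of i] h[of i], of "k i"] z by (simp add: has_q_expansion_def)
      ultimately show "?l (nome z) = ?r (nome z)"
        by (simp add: vec_eq_iff)
    qed
    then show ?thesis by (simp add: disc_logderiv_q_0)
  qed
  \<comment> \<open>The columns of \<open>P\<close> are the constant terms h_i(0). They are
    independent, so \<open>L ** P = P ** N\<close> makes L similar to \<open>N\<close>, whose trace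
    is the sum of the k_i / 12.\<close>
  define P :: "complex^'n^'n" where "P = (\<chi> d i. h i 0 $ d)"
  define N :: "complex^'n^'n" where
    "N = (\<chi> j i. (if j = i then of_int (k i) / 12 else 0) + g i j 0 / (2 * of_real pi * \<i>))"
  have "(L ** P) $ d $ i = (P ** N) $ d $ i" for d i
  proof -
    have "(L ** P) $ d $ i = (L *v h i 0) $ d"
      by (simp add: matrix_mult_component matrix_vector_mult_def P_def)
    also have "\<dots> = of_int (k i) / 12 * h i 0 $ d + (\<Sum>j\<in>UNIV. g i j 0 * h j 0 $ d) / (2 * of_real pi * \<i>)"
      using at_0[of i d] by (simp add: field_simps)
    also have "of_int (k i) / 12 * h i 0 $ d = (\<Sum>j\<in>UNIV. (if j = i then of_int (k i) / 12 else 0) * h j 0 $ d)"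
      by (rule sum_delta_mult[symmetric]) auto
    also have "\<dots> + (\<Sum>j\<in>UNIV. g i j 0 * h j 0 $ d) / (2 * of_real pi * \<i>) = (P ** N) $ d $ i"
      by (simp add: matrix_mult_component P_def N_def sum_divide_distrib distrib_left sum.distrib mult_ac)
    finally show ?thesis .
  qed
  then have LP: "L ** P = P ** N" by (simp add: vec_eq_iff)
  have "P *v x = 0 \<longrightarrow> x = 0" for x
  proof
    assume "P *v x = 0"
    then have "(\<Sum>i\<in>UNIV. x $ i *s h i 0) = 0"
      by (simp add: vec_eq_iff matrix_vector_mult_def P_def mult.commute)
    from cusp_values_independent[OF basis parity h this] show "x = 0" by (simp add: vec_eq_iff)
  qed
  then obtain Q where QP: "Q ** P = mat 1" using matrix_left_invertible_ker by blast
  then have PQ: "P ** Q = mat 1" by (rule matrix_left_right_inverse1)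
  have "trace L = trace (L ** P ** Q)" by (simp add: PQ flip: matrix_mul_assoc)
  also have "\<dots> = trace (P ** N ** Q)" by (simp add: LP)
  also have "\<dots> = trace (Q ** (P ** N))" by (rule trace_mul_sym)
  also have "\<dots> = trace N" by (simp add: matrix_mul_assoc QP)
  also have "\<dots> = (\<Sum>i\<in>UNIV. of_int (k i) / 12)" by (simp add: trace_def N_def diag)
  also have "\<dots> = of_int (\<Sum>i\<in>UNIV. k i) / 12" by (simp add: sum_divide_distrib)
  finally have tr: "trace L = of_int (\<Sum>i\<in>UNIV. k i) / 12" .
  show ?thesis unfolding tr by simp
qed

section \<open>The weights\<close>

text \<open>\<open>A\<close> is the matrix of the modular derivative in the basis. The weights of
  its entries decide which vanish, are constant, or are multiples of \<open>E4\<close>.\<close>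

locale rank_4_basis =
  fixes \<rho> :: "int^2^2 \<Rightarrow> complex^4^4" and L :: "complex^4^4"
    and k :: "4 \<Rightarrow> int" and F :: "4 \<Rightarrow> complex \<Rightarrow> complex^4"
    and A :: "4 \<Rightarrow> 4 \<Rightarrow> complex \<Rightarrow> complex"
  assumes irr: "irreducible_representation \<rho>" and basis: "homogeneous_free_basis \<rho> L k F"
    and A_weight: "A i j \<in> level_one_weight (k i + 2 - k j)"
    and deriv_F: "z \<in> \<H> \<Longrightarrow> modular_deriv (k i) (F i) z = (\<Sum>j\<in>UNIV. A i j z *s F j z)"
begin

section \<open>Entries of the matrix of the modular derivative, and gaps between the weights\<close>

lemma A_holomorphic: "A i j holomorphic_on \<H>"
  by (rule level_one_ring_holomorphic[OF level_one_weight_in_ring[OF A_weight]])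

lemma A_eq_0:
  assumes "k i + 2 < k j \<or> k i = k j" "z \<in> \<H>"
  shows "A i j z = 0"
  by (rule level_one_weight_empty[OF A_weight[of i j] _ assms(2)]) (use assms(1) in auto)

lemma A_const:
  assumes "k j = k i + 2"
  shows "\<exists>c. \<forall>z\<in>\<H>. A i j z = c"
proof -
  have "A i j \<in> level_one_weight 0" using A_weight[of i j] assms by simp
  then show ?thesis by (rule level_one_weight_0) blast
qed

lemma A_E4:
  assumes "k i = k j + 2"
  shows "\<exists>c. \<forall>z\<in>\<H>. A i j z = c * E4 z"
proof -
  have "A i j \<in> level_one_weight 4" using A_weight[of i j] assms by simp
  then show ?thesis by (rule level_one_weight_4) blast
qed

lemma holomorphic_vec: "vec_holomorphic (F i) \<H>"
  using basis_weight[OF basis, of i] by (simp add: vvmf_weight_iff)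

lemma combination_weight:
  assumes "\<forall>i\<in>I. k i = w"
  shows "(\<lambda>z. \<Sum>i\<in>I. c i *s F i z) \<in> vvmf_weight \<rho> L w"
  using vvmf_weight_smult[OF basis_weight[OF basis]] assms by (intro vvmf_weight_sum) metis

lemma combination_deriv:
  assumes "\<forall>i\<in>I. k i = w" "z \<in> \<H>"
  shows "modular_deriv w (\<lambda>z. \<Sum>i\<in>I. c i *s F i z) z = (\<Sum>i\<in>I. c i *s (\<Sum>j\<in>UNIV. A i j z *s F j z))"
  unfolding modular_deriv_sum[OF holomorphic_vec assms(2)]
  using assms deriv_F by (intro sum.cong refl) metis

lemma combination_nonzero:
  assumes "\<And>z. z \<in> \<H> \<Longrightarrow> (\<Sum>i\<in>I. c i *s F i z) = 0" "i \<in> I"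
  shows "c i = 0"
proof -
  have "(\<Sum>i\<in>UNIV. (if i \<in> I then c i else 0) *s F i z) = 0" if "z \<in> \<H>" for z
  proof -
    have "(\<Sum>i\<in>UNIV. (if i \<in> I then c i else 0) *s F i z) = (\<Sum>i\<in>I. c i *s F i z)"
      by (rule sum.mono_neutral_cong_right) auto
    then show ?thesis using assms(1)[OF that] by simp
  qed
  from basis_constants_independent[OF basis this, of i] show ?thesis using assms(2) by simp
qed

lemma F_nonzero: "(\<And>z. z \<in> \<H> \<Longrightarrow> F i z = 0) \<Longrightarrow> False"
  using basis_nonzero[OF basis, of i] by blast

text \<open>If every weight outside \<open>I\<close> exceeded every weight in \<open>I\<close> by
  more than 2, the coefficients leading out of \<open>I\<close> would have negative weight. The
  \<open>F i\<close> with i in \<open>I\<close> would then form a stable family of fewer than 4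
  forms.\<close>

lemma gap:
  assumes i: "i \<in> I" and m: "m \<notin> I"
  shows "\<exists>i\<in>I. \<exists>j. j \<notin> I \<and> k j \<le> k i + 2"
proof (rule ccontr)
  assume "\<not> (\<exists>i\<in>I. \<exists>j. j \<notin> I \<and> k j \<le> k i + 2)"
  then have far: "k i + 2 < k j" if "i \<in> I" "j \<notin> I" for i j using that by force
  have "F i z = 0" if z: "z \<in> \<H>" for z
  proof (rule stable_system_eq_0[where I = I and B = A, OF irr _ _ basis_weight[OF basis] A_holomorphic _ i z])
    show "card I < CARD(4)" using m by (intro psubset_card_mono) auto
    fix i z assume i: "i \<in> I" and z: "z \<in> \<H>"
    show "modular_deriv (k i) (F i) z = (\<Sum>j\<in>I. A i j z *s F j z)"
      unfolding deriv_F[OF z] using far[OF i] A_eq_0[OF _ z]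
      by (intro sum.mono_neutral_right) auto
  qed simp
  then show False by (rule F_nonzero)
qed

text \<open>Two independent forms of equal weight with derivatives on one line C X have a nonzero
  combination with derivative 0, which \<open>stable_1\<close> forbids.\<close>

lemma not_two_in_one:
  assumes "k x = k y" "x \<noteq> y"
    and "\<And>z. z \<in> \<H> \<Longrightarrow> modular_deriv (k x) (F x) z = a *s X z"
    and "\<And>z. z \<in> \<H> \<Longrightarrow> modular_deriv (k x) (F y) z = b *s X z"
  shows False
proof -
  obtain c d where cd: "c * a + d * b = 0" "c \<noteq> 0 \<or> d \<noteq> 0"
  proof (cases "a = 0 \<and> b = 0")
    case True
    then show ?thesis using that[of 1 0] by simp
  next
    case False
    then show ?thesis using that[of b "- a"] by auto
  qed
  define e where "e = (\<lambda>i. if i = x then c else d)"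
  let ?G = "\<lambda>z. \<Sum>i\<in>{x, y}. e i *s F i z"
  have w: "\<forall>i\<in>{x, y}. k i = k x" using assms(1) by auto
  have "modular_deriv (k x) ?G z = 0" if z: "z \<in> \<H>" for z
  proof -
    have "modular_deriv (k x) ?G z = (\<Sum>i\<in>{x, y}. e i *s modular_deriv (k x) (F i) z)"
      by (rule modular_deriv_sum[OF holomorphic_vec z])
    also have "\<dots> = (c * a + d * b) *s X z"
      using assms(2) by (simp add: e_def assms(3,4)[OF z] vector_smult_assoc vector_sadd_rdistrib)
    finally show ?thesis by (simp add: cd)
  qed
  then have "?G z = 0" if "z \<in> \<H>" for z
    using that by (intro stable_1[OF irr _ combination_weight[OF w]]) auto
  then have "e i = 0" if "i \<in> {x, y}" for i using that by (rule combination_nonzero)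
  from this[of x] this[of y] show False using cd(2) assms(2) by (auto simp: e_def)
qed

text \<open>The digits in the names of the following lemmas are the excluded gaps \<open>k\<^sub>i\<^sub>+\<^sub>1 - k\<^sub>i\<close>.\<close>

lemma cases_002_022_000:
  assumes "k 2 = k 1" "k 3 = k 1 \<or> k 3 = k 1 + 2" "k 4 = k 3 \<or> k 4 = k 3 + 2" "\<not> (k 3 = k 1 + 2 \<and> k 4 = k 3)"
  shows False
proof -
  \<comment> \<open>\<open>m\<close> is the only index that can occur in the derivatives of the two
    lowest generators: 4 if \<open>k 3 = k 1\<close>, and otherwise 3, since then
    \<open>k 4 = k 1 + 4\<close> is out of reach.\<close>
  obtain m where m: "\<And>j i. j \<noteq> m \<Longrightarrow> i \<in> {1, 2} \<Longrightarrow> k i + 2 < k j \<or> k i = k j" "k m = k 1 \<or> k m = k 1 + 2"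
  proof (cases "k 3 = k 1")
    case True
    then have "k i + 2 < k j \<or> k i = k j" if "j \<noteq> 4" "i \<in> {1, 2}" for i j
      using that exhaust_4[of j] assms(1) by auto
    then show ?thesis using that[of 4] assms True by auto
  next
    case False
    then have "k i + 2 < k j \<or> k i = k j" if "j \<noteq> 3" "i \<in> {1, 2}" for i j
      using that exhaust_4[of j] assms by auto
    then show ?thesis using that[of 3] assms False by auto
  qed
  have D: "modular_deriv (k i) (F i) z = A i m z *s F m z" if "i \<in> {1, 2}" "z \<in> \<H>" for i z
  proof -
    have "(\<Sum>j\<in>UNIV. A i j z *s F j z) = (\<Sum>j\<in>{m}. A i j z *s F j z)"
      using m(1)[OF _ that(1)] A_eq_0[OF _ that(2)] by (intro sum.mono_neutral_right) auto
    then show ?thesis using deriv_F[OF that(2)] by simp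
  qed
  have const: "\<exists>c. \<forall>z\<in>\<H>. A i m z = c" if "i \<in> {1, 2}" for i
  proof (cases "k m = k i")
    case True
    then show ?thesis using A_eq_0 by auto
  next
    case False
    then show ?thesis using m(2) that assms(1) by (intro A_const) auto
  qed
  obtain a where a: "\<forall>z\<in>\<H>. A 1 m z = a" using const[of 1] by auto
  obtain b where b: "\<forall>z\<in>\<H>. A 2 m z = b" using const[of 2] by auto
  show False
    by (rule not_two_in_one[of 1 2 a "F m" b])
       (use D[of 1] D[of 2] a b assms(1) in auto)
qed

text \<open>\<open>l\<close> is a root of the characteristic polynomial by the quadratic formula,
  and (r, l - p) is a row eigenvector when \<open>r\<close> is nonzero; for \<open>r = 0\<close> the
  row (0, 1) works with eigenvalue \<open>s\<close>.\<close>

lemma left_eigenvector_2: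
  fixes p q r s :: complex
  obtains c d l where "c \<noteq> 0 \<or> d \<noteq> 0" "c * p + d * r = l * c" "c * q + d * s = l * d"
proof (cases "r = 0")
  case True
  then show ?thesis using that[of 0 1 s] by simp
next
  case False
  define l where "l = (p + s + csqrt ((p - s)\<^sup>2 + 4 * q * r)) / 2"
  have "2 * l - p - s = csqrt ((p - s)\<^sup>2 + 4 * q * r)" by (simp add: l_def field_simps)
  then have "(2 * l - p - s)\<^sup>2 = (p - s)\<^sup>2 + 4 * q * r" by simp
  then have "4 * ((l - p) * (l - s)) = 4 * (q * r)" by (simp add: power2_eq_square algebra_simps)
  then have "(l - p) * (l - s) = q * r" by simp
  then show ?thesis using that[of r "l - p" l] False by (simp add: algebra_simps)
qed

text \<open>D sends the lower pair to the upper pair by constants, and the upper pair to the lower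
  by constants times \<open>E4\<close>. A left eigenvector of the product of the two constant
  matrices gives G and H = D G with D H = l E4 G, a stable family.\<close>

lemma case_020:
  assumes "k 2 = k 1" "k 3 = k 1 + 2" "k 4 = k 1 + 2"
  shows False
proof -
  have ks: "k 3 = k 4" "k 3 = k 2 + 2" "k 4 = k 2 + 2" using assms by auto
  obtain a13 a14 a23 a24 where a: "\<And>z. z \<in> \<H> \<Longrightarrow> A 1 3 z = a13" "\<And>z. z \<in> \<H> \<Longrightarrow> A 1 4 z = a14"
      "\<And>z. z \<in> \<H> \<Longrightarrow> A 2 3 z = a23" "\<And>z. z \<in> \<H> \<Longrightarrow> A 2 4 z = a24"
    using A_const[of 3 1] A_const[of 4 1] A_const[of 3 2] A_const[of 4 2] assms ks by metis
  obtain b31 b32 b41 b42 where b: "\<And>z. z \<in> \<H> \<Longrightarrow> A 3 1 z = b31 * E4 z" "\<And>z. z \<in> \<H> \<Longrightarrow> A 3 2 z = b32 * E4 z"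
      "\<And>z. z \<in> \<H> \<Longrightarrow> A 4 1 z = b41 * E4 z" "\<And>z. z \<in> \<H> \<Longrightarrow> A 4 2 z = b42 * E4 z"
    using A_E4[of 3 1] A_E4[of 3 2] A_E4[of 4 1] A_E4[of 4 2] assms ks by metis
  have zero: "A 1 1 z = 0" "A 1 2 z = 0" "A 2 1 z = 0" "A 2 2 z = 0"
    "A 3 3 z = 0" "A 3 4 z = 0" "A 4 3 z = 0" "A 4 4 z = 0" if "z \<in> \<H>" for z
    using A_eq_0[OF _ that] assms by auto
  obtain c d l where cd: "c \<noteq> 0 \<or> d \<noteq> 0"
    "c * (a13 * b31 + a14 * b41) + d * (a23 * b31 + a24 * b41) = l * c"
    "c * (a13 * b32 + a14 * b42) + d * (a23 * b32 + a24 * b42) = l * d"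
    using left_eigenvector_2 by metis
  define u where "u = c * a13 + d * a23"
  define v where "v = c * a14 + d * a24"
  have uv: "u * b31 + v * b41 = l * c" "u * b32 + v * b42 = l * d"
    using cd(2,3) by (simp_all add: u_def v_def algebra_simps)
  define e where "e = (\<lambda>i :: 4. if i = 1 then c else d)"
  define f where "f = (\<lambda>i :: 4. if i = 3 then u else v)"
  let ?G = "\<lambda>z. \<Sum>i\<in>{1, 2}. e i *s F i z" and ?H = "\<lambda>z. \<Sum>i\<in>{3, 4}. f i *s F i z"
  have wG: "\<forall>i\<in>{1, 2}. k i = k 1" using assms by auto
  have wH: "\<forall>i\<in>{3, 4}. k i = k 1 + 2" using assms by auto
  have DG: "modular_deriv (k 1) ?G z = ?H z" if z: "z \<in> \<H>" for z
    unfolding combination_deriv[OF wG z]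
    by (simp add: sum_4 zero[OF z] a[OF z] e_def f_def u_def v_def vec_eq_iff algebra_simps)
  have DH: "modular_deriv (k 1 + 2) ?H z = (l * E4 z) *s ?G z" if z: "z \<in> \<H>" for z
  proof -
    have "modular_deriv (k 1 + 2) ?H z
       = ((u * b31 + v * b41) * E4 z) *s F 1 z + ((u * b32 + v * b42) * E4 z) *s F 2 z"
      unfolding combination_deriv[OF wH z]
      by (simp add: sum_4 zero[OF z] b[OF z] f_def vec_eq_iff algebra_simps)
    then show ?thesis unfolding uv by (simp add: e_def vec_eq_iff algebra_simps)
  qed
  have "?G z = 0" if "z \<in> \<H>" for z
    by (rule stable_3[OF irr _ combination_weight[OF wG, of e]
          combination_weight[OF wH, of f] combination_weight[OF wH, of f],
          where baa = "\<lambda>_. 0" and bab = "\<lambda>_. 1" and bac = "\<lambda>_. 0" and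
            bba = "\<lambda>z. l * E4 z" and bbb = "\<lambda>_. 0" and bbc = "\<lambda>_. 0" and
            bca = "\<lambda>z. l * E4 z" and bcb = "\<lambda>_. 0" and bcc = "\<lambda>_. 0"])
       (use that in \<open>auto simp: DG DH simp del: sum.insert intro!: holomorphic_intros E4_holomorphic\<close>)
  then have "e i = 0" if "i \<in> {1, 2}" for i using that by (rule combination_nonzero)
  from this[of 1] this[of 2] show False using cd(1) by (auto simp: e_def)
qed

text \<open>The three upper generators do not occur in their own derivatives, for lack of forms of
  weight 2. Hence G = D (F 1), a constant combination of them, has D G in the multiples of
  \<open>F 1\<close>, and \<open>F 1\<close>, G are stable.\<close>

lemma case_200:
  assumes "k 2 = k 1 + 2" "k 3 = k 1 + 2" "k 4 = k 1 + 2"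
  shows False
proof -
  obtain a2 a3 a4 where a: "\<And>z. z \<in> \<H> \<Longrightarrow> A 1 2 z = a2" "\<And>z. z \<in> \<H> \<Longrightarrow> A 1 3 z = a3" "\<And>z. z \<in> \<H> \<Longrightarrow> A 1 4 z = a4"
    using A_const[of 2 1] A_const[of 3 1] A_const[of 4 1] assms by metis
  define e where "e = (\<lambda>i :: 4. if i = 2 then a2 else if i = 3 then a3 else a4)"
  let ?G = "\<lambda>z. \<Sum>i\<in>{2, 3, 4}. e i *s F i z"
  have wG: "\<forall>i\<in>{2, 3, 4}. k i = k 1 + 2" using assms by auto
  have zero: "A 1 1 z = 0" "A i 2 z = 0" "A i 3 z = 0" "A i 4 z = 0"
    if "z \<in> \<H>" "i \<in> {2, 3, 4}" for i z
    using A_eq_0[OF _ that(1)] assms that(2) by auto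
  have DF: "modular_deriv (k 1) (F 1) z = ?G z" if z: "z \<in> \<H>" for z
    by (simp add: deriv_F[OF z] sum_4 zero(1)[OF z, of 2] a[OF z] e_def add.assoc)
  define B where "B = (\<lambda>z. a2 * A 2 1 z + a3 * A 3 1 z + a4 * A 4 1 z)"
  have DG: "modular_deriv (k 1 + 2) ?G z = B z *s F 1 z" if z: "z \<in> \<H>" for z
    unfolding combination_deriv[OF wG z]
    by (simp add: sum_4 zero[OF z] e_def B_def vec_eq_iff algebra_simps)
  have "B holomorphic_on \<H>" unfolding B_def by (intro holomorphic_intros A_holomorphic)
  then have "F 1 z = 0" if "z \<in> \<H>" for z
    by (intro stable_3[OF irr _ basis_weight[OF basis] combination_weight[OF wG, of e] combination_weight[OF wG, of e],
          where baa = "\<lambda>_. 0" and bab = "\<lambda>_. 1" and bac = "\<lambda>_. 0" and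
            bba = B and bbb = "\<lambda>_. 0" and bbc = "\<lambda>_. 0" and
            bca = B and bcb = "\<lambda>_. 0" and bcc = "\<lambda>_. 0"])
       (use that in \<open>auto simp: DF DG simp del: sum.insert\<close>)
  then show False by (rule F_nonzero)
qed

text \<open>The stable family is \<open>F 1\<close>, \<open>F 2\<close> and the part G of D (F 2)
  lying in the two highest generators; D G has no component along these two because their weights
  agree.\<close>

lemma case_220:
  assumes "k 2 = k 1 + 2" "k 3 = k 1 + 4" "k 4 = k 1 + 4"
  shows False
proof -
  have ks: "k 3 = k 2 + 2" "k 4 = k 2 + 2" using assms by auto
  obtain a b3 b4 where a: "\<And>z. z \<in> \<H> \<Longrightarrow> A 1 2 z = a" "\<And>z. z \<in> \<H> \<Longrightarrow> A 2 3 z = b3" "\<And>z. z \<in> \<H> \<Longrightarrow> A 2 4 z = b4"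
    using A_const[of 2 1] A_const[of 3 2] A_const[of 4 2] assms(1) ks by metis
  define e where "e = (\<lambda>i :: 4. if i = 3 then b3 else b4)"
  let ?G = "\<lambda>z. \<Sum>i\<in>{3, 4}. e i *s F i z"
  have wG: "\<forall>i\<in>{3, 4}. k i = k 1 + 4" using assms by auto
  have zero: "A 1 1 z = 0" "A 1 3 z = 0" "A 1 4 z = 0" "A 2 2 z = 0"
    "A 3 3 z = 0" "A 3 4 z = 0" "A 4 3 z = 0" "A 4 4 z = 0" if "z \<in> \<H>" for z
    using A_eq_0[OF _ that] assms by auto
  have D1: "modular_deriv (k 1) (F 1) z = a *s F 2 z" if z: "z \<in> \<H>" for z
    by (simp add: deriv_F[OF z] sum_4 zero[OF z] a[OF z])
  have D2: "modular_deriv (k 2) (F 2) z = A 2 1 z *s F 1 z + ?G z" if z: "z \<in> \<H>" for z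
    by (simp add: deriv_F[OF z] sum_4 zero[OF z] a[OF z] e_def add.assoc)
  define B where "B = (\<lambda>j z. b3 * A 3 j z + b4 * A 4 j z)"
  have DG: "modular_deriv (k 1 + 4) ?G z = B 1 z *s F 1 z + B 2 z *s F 2 z" if z: "z \<in> \<H>" for z
    unfolding combination_deriv[OF wG z]
    by (simp add: sum_4 zero[OF z] e_def B_def vec_eq_iff algebra_simps)
  have "B j holomorphic_on \<H>" for j unfolding B_def by (intro holomorphic_intros A_holomorphic)
  then have "F 1 z = 0" if "z \<in> \<H>" for z
    by (intro stable_3[OF irr _ basis_weight[OF basis] basis_weight[OF basis] combination_weight[OF wG, of e],
          where baa = "\<lambda>_. 0" and bab = "\<lambda>_. a" and bac = "\<lambda>_. 0" and
            bba = "A 2 1" and bbb = "\<lambda>_. 0" and bbc = "\<lambda>_. 1" and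
            bca = "B 1" and bcb = "B 2" and bcc = "\<lambda>_. 0"])
       (use that in \<open>auto simp: D1 D2 DG A_holomorphic simp del: sum.insert\<close>)
  then show False by (rule F_nonzero)
qed

lemma weights:
  assumes "k 1 \<le> k 2" "k 2 \<le> k 3" "k 3 \<le> k 4" and parity: "\<And>i j. even (k i - k j)"
  shows "(k 2 = k 1 + 2 \<and> k 3 = k 1 + 2 \<and> k 4 = k 1 + 4) \<or>
    (k 2 = k 1 + 2 \<and> k 3 = k 1 + 4 \<and> k 4 = k 1 + 6)"
proof -
  have "k 2 \<le> k 1 + 2"
  proof -
    \<comment> \<open>\<open>gap\<close> is applied to the initial segments {1}, {1, 2}, {1, 2, 3},
      with 4 witnessing that they are proper. By monotonicity it bounds the step from each segment
      to the next weight.\<close>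
    obtain j where "j \<noteq> 1" "k j \<le> k 1 + 2" using gap[of 1 "{1}" 4] by auto
    then show ?thesis using exhaust_4[of j] assms(1-3) by auto
  qed
  moreover have "k 3 \<le> k 2 + 2"
  proof -
    obtain i j where "i = 1 \<or> i = 2" "j \<noteq> 1" "j \<noteq> 2" "k j \<le> k i + 2"
      using gap[of 1 "{1, 2}" 4] by auto
    then show ?thesis using exhaust_4[of j] assms(1-3) by auto
  qed
  moreover have "k 4 \<le> k 3 + 2"
  proof -
    obtain i j where "i = 1 \<or> i = 2 \<or> i = 3" "j \<noteq> 1" "j \<noteq> 2" "j \<noteq> 3" "k j \<le> k i + 2"
      using gap[of 1 "{1, 2, 3}" 4] by auto
    then show ?thesis using exhaust_4[of j] assms(1-3) by auto
  qed
  moreover have gap_0_2: "y = x \<or> y = x + 2" if "x \<le> y" "y \<le> x + 2" "even (y - x)" for x y :: int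
    using that by presburger
  ultimately have "k 2 = k 1 \<or> k 2 = k 1 + 2" "k 3 = k 2 \<or> k 3 = k 2 + 2" "k 4 = k 3 \<or> k 4 = k 3 + 2"
    using assms by (blast intro: gap_0_2)+
  then show ?thesis
    using cases_002_022_000 case_020 case_200 case_220 by auto
qed

end

theorem theorem16:
  fixes \<rho> :: "int^2^2 \<Rightarrow> complex^4^4"
    and L :: "complex^4^4"
    and e :: nat
    and k :: "4 \<Rightarrow> int"
    and F :: "4 \<Rightarrow> complex \<Rightarrow> complex^4"
  assumes "irreducible_representation \<rho>"
    and "e \<in> {0, 1}"
    and "\<rho> (- mat 1) = mat ((-1) ^ e)"
    and "choice_of_exponents \<rho> L"
    and "homogeneous_free_basis \<rho> L k F"
    and "k 1 \<le> k 2" and "k 2 \<le> k 3" and "k 3 \<le> k 4"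
  shows "\<exists>t :: int. of_int t = 3 * trace L \<and>
    (let cyclic_case = ([t \<noteq> int e] (mod 2) \<and> k 1 = t - 3 \<and>
           (k 1, k 2, k 3, k 4) = (k 1, k 1 + 2, k 1 + 4, k 1 + 6));
         noncyclic_case = ([t = int e] (mod 2) \<and> k 1 = t - 2 \<and>
           (k 1, k 2, k 3, k 4) = (k 1, k 1 + 2, k 1 + 2, k 1 + 4))
     in (cyclic_case \<or> noncyclic_case) \<and> \<not> (cyclic_case \<and> noncyclic_case))"
proof -
  have rep: "representation \<rho>" using assms(1) by (simp add: irreducible_representation_def)
  have par: "even (k i + int e)" for i by (rule basis_parity[OF assms(5,3)])
  have parity: "even (k i - k j)" for i j using par[of i] par[of j] by presburger
  obtain A where "(\<forall>i j. A i j \<in> level_one_weight (k i + 2 - k j)) \<and>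
    (\<forall>i. \<forall>z\<in>\<H>. modular_deriv (k i) (F i) z = (\<Sum>j\<in>UNIV. A i j z *s F j z))"
    using basis_derivative[OF assms(5) rep] ..
  then interpret rank_4_basis \<rho> L k F A
    using assms(1,5) by unfold_locales simp_all
  have "of_int (\<Sum>i\<in>UNIV. k i) = 12 * trace L"
    by (rule sum_weights_eq_trace[OF rep assms(5) parity])
  then have sum: "of_int (k 1 + k 2 + k 3 + k 4) = 12 * trace L"
    by (simp only: sum_4)
  \<comment> \<open>In both patterns the sum of the weights is divisible by 4, so the integer
    \<open>t\<close> for 3 Tr L is read off here.\<close>
  have quarter: "of_int t = 3 * trace L" if "k 1 + k 2 + k 3 + k 4 = 4 * t" for t
  proof -
    have "4 * of_int t = 4 * (3 * trace L)" using sum unfolding that by simp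
    then show ?thesis by (simp only: mult_cancel_left) simp
  qed
  from weights[OF assms(6-8) parity] show ?thesis
  proof (elim disjE conjE)
    assume *: "k 2 = k 1 + 2" "k 3 = k 1 + 2" "k 4 = k 1 + 4"
    have "k 1 + k 2 + k 3 + k 4 = 4 * (k 1 + 2)" by (simp add: *)
    then have "of_int (k 1 + 2) = 3 * trace L" by (rule quarter)
    \<comment> \<open>\<open>k 1\<close> has the parity of \<open>e\<close>, so adding 2 or 3 makes
      the parity of 3 Tr L distinguish the two patterns and exclude the other one.\<close>
    moreover have "[k 1 + 2 = int e] (mod 2)"
      using par[of 1] unfolding cong_def by presburger
    ultimately show ?thesis
      by (intro exI[of _ "k 1 + 2"]) (simp add: * Let_def)
  next
    assume *: "k 2 = k 1 + 2" "k 3 = k 1 + 4" "k 4 = k 1 + 6"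
    have "k 1 + k 2 + k 3 + k 4 = 4 * (k 1 + 3)" by (simp add: *)
    then have "of_int (k 1 + 3) = 3 * trace L" by (rule quarter)
    moreover have "[k 1 + 3 \<noteq> int e] (mod 2)"
      using par[of 1] unfolding cong_def by presburger
    ultimately show ?thesis
      by (intro exI[of _ "k 1 + 3"]) (simp add: * Let_def)
  qed
qed

end
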